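(* Let $\Lambda$ be a gentle algebra, let $\sigma$ be a homotopy string and let $\tau$ be a homotopy band. For $\mu \in \mathbf{k}^*$, let $f^\bullet \colon P^\bullet_\sigma \to B^\bullet_{\tau,\mu}$ be a graph map determined by a (possibly trivial) maximal common homotopy string $\rho$. Suppose there is an integer $\ell \geq 1$ such that $\rho$ is a proper subword of $\tau^{\ell+1}$ and $\tau^\ell$ is a (not necessarily proper) subword of $\rho$. Then, after suitable rotation of $\tau$, there is a decomposition $\tau = \delta\gamma$, with $\delta$ or $\gamma$ possibly trivial, such that $$\sigma = \beta\,\tau^\ell\delta\,\alpha \quad\text{for some } \ell \geq 1 \text{ and some homotopy strings } \alpha \text{ and } \beta .$$ In this case the mapping cone of $f^\bullet$ is $M^\bullet_{f^\bullet} \cong P^\bullet_c$, where $c = \beta\,\tau^{\ell-1}\delta\,\alpha$.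
   Context: **Gentle algebras.** $\mathbf{k}$ is a field and $\Lambda=\mathbf{k}Q/I$ is a finite-dimensional algebra, with $Q$ a finite quiver, $I$ generated by paths of length 2, at most two arrows starting and at most two arrows ending at each vertex, and for each arrow $b$: at most one arrow $a$ with $ba$ a path not in $I$, at most one $a$ with $ba$ a path in $I$, at most one arrow $c$ with $cb$ a path not in $I$, and at most one $c$ with $cb$ a path in $I$. For a path or arrow $p$, $s(p)$ and $e(p)$ are its start and end; paths compose right to left ($qp$ is $p$ followed by $q$). $P(x)$ is the indecomposable projective at $x$; a path $p$ nonzero in $\Lambda$ induces a map $P(e(p))\to P(s(p))$, also denoted $p$; the path $qp$ induces the map "first $q$, then $p$", and products of maps below are written in this path order. **Homotopy strings and bands.** A direct homotopy letter is a nontrivial path $p$ nonzero in $\Lambda$; an inverse homotopy letter is a formal inverse $\overline p$, with $s(\overline p)=e(p)$, $e(\overline p)=s(p)$. A (finite) homotopy string is a trivial word at a vertex, or a word $\sigma=\sigma_n\cdots\sigma_1$ of homotopy letters with $s(\sigma_{i+1})=e(\sigma_i)$ such that for consecutive letters: if $\sigma_{i+1},\sigma_i$ are both direct, then $\sigma_{i+1}\sigma_i$ is zero because the length two path at the junction is in $I$; if both are inverse, the same holds for $\overline{\sigma_i}\,\overline{\sigma_{i+1}}$; if $\sigma_{i+1}=p$, $\sigma_i=\overline q$, then $p,q$ have different first arrows; if $\sigma_{i+1}=\overline p$, $\sigma_i=q$, then $p,q$ have different last arrows. This is the homotopy letter partition and $n$ is the length of $\sigma$. Infinite homotopy strings are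 defined in the same way, restricted to those whose complex below is a right bounded complex with bounded cohomology. $\sigma$ is drawn as a diagram $\bullet - \bullet - \cdots - \bullet$ labelled from left to right by $\sigma_n,\dots,\sigma_1$, a direct letter being an arrow $\rightarrow$ and an inverse letter an arrow $\leftarrow$; vertices carry cohomological degrees, arrows raising degree by one. Words are considered up to inversion. A homotopy band is a nontrivial finite homotopy string $\sigma$ starting and ending at the same vertex and in the same degree (equally many direct and inverse letters), such that $\sigma^2$ is a homotopy string whose letters are the letters of the two copies of $\sigma$ (no merging), and $\sigma$ is not a proper power; bands are considered up to rotation (cyclic permutation) and inversion. ${}^\infty\sigma^\infty$ is the infinite concatenation of copies of $\sigma$. **Complexes.** The string complex $P^\bullet_\sigma$ is the complex of projectives given by the direct sum of the $P(x)$ over the vertices $x$ of the diagram, placed in their degrees, with differential given by the letters. For a band $\sigma$ and $\lambda\in\mathbf{k}^*$, the band complex $B^\bullet_{\sigma,\lambda}$ is defined in the same way from the cyclic diagram of $\sigma$ (first and last vertex identified), the scalar $\lambda$ multiplying one direct letter. Its unfolded diagram is the repeating infinite diagram of ${}^\infty\sigma^\infty$. The cohomological grading is suppressed in the notation: a complex attached to a word describing a mapping cone has the degrees inherited from the cone. The mapping cone $M^\bullet_{f^\bullet}$ of $f^\bullet\colon P^\bullet\to Q^\bullet$ is $\Sigma P^\bullet\oplus Q^\bullet$ with differential $\left[\begin{smallmatrix}-d_P&0\\ f&d_Q\end{smallmatrix}\right]$; isomorphisms are in the bounded derived category $\mathsf{D}^b(\Lambda)$, equivalently the homotopy category of right bounded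 complexes of finitely generated projectives with bounded cohomology. **Graph maps.** Let $\rho$ be a maximal common homotopy substring (the overlap, possibly trivial), in matching degrees, of $\sigma$ and $\tau$ (of ${}^\infty\sigma^\infty$ if $\sigma$ is a band, and likewise for $\tau$). Let $\sigma_L,\sigma_R$ (resp. $\tau_L,\tau_R$) be the homotopy letters, possibly empty, immediately to the left and right of $\rho$ in $\sigma$ (resp. $\tau$). $\rho$ determines a graph map from the complex of $\sigma$ to that of $\tau$ if: at the left end, either $\sigma_L,\tau_L$ are both direct with $\sigma_L=f_L\tau_L$, or both inverse with $\overline{\tau_L}=\overline{\sigma_L}f_L$, for a nontrivial path $f_L$; or $\sigma_L$ is empty or inverse and $\tau_L$ is empty or direct (then $f_L=\varnothing$); and at the right end, either both $\sigma_R,\tau_R$ are direct with $\tau_R=\sigma_Rf_R$, or both inverse with $\overline{\sigma_R}=f_R\overline{\tau_R}$, for a nontrivial path $f_R$; or $\sigma_R$ is empty or direct and $\tau_R$ is empty or inverse ($f_R=\varnothing$). There is no condition at an end at which $\rho$ is infinite. The graph map has as components identities between corresponding vertices of $\rho$ together with $f_L,f_R$, up to the nonzero scalars forced by the band parameters, and zero elsewhere. **Convention.** In decompositions such as $\sigma=\beta\tau^\ell\delta\alpha$, the factors are subwords of the underlying walk; the last homotopy letter of one factor may merge with the first homotopy letter of the next, and factors may be trivial. *)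

theory Defs
  imports "HOL-Algebra.QuotRing" "HOL-Algebra.Embedded_Algebras" "HOL-Library.Sublist"
    "Graph_Theory.Arc_Walk"
begin

section \<open>Path algebras and gentle algebras\<close>

text \<open>A quiver is a (multi-)digraph; start and end of an arrow \<open>a\<close> are \<open>tail Q a\<close> and
  \<open>head Q a\<close>. The triple \<open>(u, p, v)\<close> is the path from \<open>u\<close> to \<open>v\<close> along the arc list \<open>p\<close>, listed
  in the order in which the arrows are traversed. Since paths compose right to left, the product
  \<open>q p\<close> (\<open>p\<close> followed by \<open>q\<close>) has arc list \<open>p @ q\<close>.\<close>

type_synonym ('v, 'a) qpath = "'v \<times> 'a list \<times> 'v"

definition is_path :: "('v, 'a) pre_digraph \<Rightarrow> ('v, 'a) qpath \<Rightarrow> bool" where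
  "is_path Q = (\<lambda>(u, p, v). pre_digraph.awalk Q u p v)"

text \<open>In the product, the coefficient at a path sums over all ways of cutting it into a first
  part (taken from \<open>g\<close>) and a second part (taken from \<open>f\<close>). The summand for \<open>v\<close> vanishes unless
  \<open>v\<close> is the vertex at which the path is cut.\<close>

definition path_algebra :: "('v, 'a) pre_digraph \<Rightarrow> (('v, 'a) qpath \<Rightarrow> 'k::field) ring" where
  "path_algebra Q =
    \<lparr>carrier = {f. finite {r. f r \<noteq> 0} \<and> (\<forall>r. f r \<noteq> 0 \<longrightarrow> is_path Q r)},
     mult = (\<lambda>f g (u, p, w). \<Sum>v\<in>verts Q. \<Sum>k\<le>length p. f (v, drop k p, w) * g (u, take k p, v)),
     one = (\<lambda>(u, p, v). if u \<in> verts Q \<and> p = [] \<and> v = u then 1 else 0),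
     zero = (\<lambda>_. 0),
     add = (\<lambda>f g r. f r + g r)\<rparr>"

definition path_term :: "'k::field \<Rightarrow> ('v, 'a) qpath \<Rightarrow> ('v, 'a) qpath \<Rightarrow> 'k" where
  "path_term c r = (\<lambda>r'. if r' = r then c else 0)"

text \<open>The path along a nonempty arc list.\<close>

definition arc_path :: "('v, 'a) pre_digraph \<Rightarrow> 'a list \<Rightarrow> ('v, 'a) qpath" where
  "arc_path Q p = (tail Q (hd p), p, head Q (last p))"

abbreviation in_ideal ::
    "('v, 'a) pre_digraph \<Rightarrow> (('v, 'a) qpath \<Rightarrow> 'k::field) set \<Rightarrow> 'a list \<Rightarrow> bool" where
  "in_ideal Q I p \<equiv> path_term 1 (arc_path Q p) \<in> I"

abbreviation quiver_algebra ::
    "('v, 'a) pre_digraph \<Rightarrow> (('v, 'a) qpath \<Rightarrow> 'k::field) set \<Rightarrow> (('v, 'a) qpath \<Rightarrow> 'k) set ring"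
  where "quiver_algebra Q I \<equiv> path_algebra Q Quot I"

definition path_class ::
    "('v, 'a) pre_digraph \<Rightarrow> (('v, 'a) qpath \<Rightarrow> 'k::field) set \<Rightarrow> 'k \<Rightarrow> ('v, 'a) qpath
      \<Rightarrow> (('v, 'a) qpath \<Rightarrow> 'k) set" where
  "path_class Q I c r = I +>\<^bsub>path_algebra Q\<^esub> path_term c r"

definition scalars ::
    "('v, 'a) pre_digraph \<Rightarrow> (('v, 'a) qpath \<Rightarrow> 'k::field) set \<Rightarrow> (('v, 'a) qpath \<Rightarrow> 'k) set set"
  where "scalars Q I = range (\<lambda>c. I +>\<^bsub>path_algebra Q\<^esub> (\<lambda>r. c * \<one>\<^bsub>path_algebra Q\<^esub> r))"

definition gentle ::
    "('v, 'a) pre_digraph \<Rightarrow> (('v, 'a) qpath \<Rightarrow> 'k::field) set \<Rightarrow> bool" where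
  "gentle Q I \<longleftrightarrow>
     fin_digraph Q \<and>
     (\<exists>R. (\<forall>p\<in>R. length p = 2 \<and> is_path Q (arc_path Q p)) \<and>
          I = genideal (path_algebra Q) ((\<lambda>p. path_term 1 (arc_path Q p)) ` R)) \<and>
     ring.finite_dimension (quiver_algebra Q I) (scalars Q I) (carrier (quiver_algebra Q I)) \<and>
     (\<forall>x\<in>verts Q. card (out_arcs Q x) \<le> 2 \<and> card (in_arcs Q x) \<le> 2) \<and>
     (\<forall>b\<in>arcs Q.
        card {a \<in> arcs Q. head Q a = tail Q b \<and> \<not> in_ideal Q I [a, b]} \<le> 1 \<and>
        card {a \<in> arcs Q. head Q a = tail Q b \<and> in_ideal Q I [a, b]} \<le> 1 \<and>
        card {c \<in> arcs Q. tail Q c = head Q b \<and> \<not> in_ideal Q I [b, c]} \<le> 1 \<and>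
        card {c \<in> arcs Q. tail Q c = head Q b \<and> in_ideal Q I [b, c]} \<le> 1)"

text \<open>The left module \<open>P(x) = \<Lambda>e\<^sub>x\<close>. A path \<open>p\<close> acts by right multiplication, which is a map
  \<open>P(e(p)) \<rightarrow> P(s(p))\<close>; the product \<open>q p\<close> then acts as first \<open>q\<close>, then \<open>p\<close>.\<close>

definition proj ::
    "('v, 'a) pre_digraph \<Rightarrow> (('v, 'a) qpath \<Rightarrow> 'k::field) set \<Rightarrow> 'v
      \<Rightarrow> (('v, 'a) qpath \<Rightarrow> 'k) set set" where
  "proj Q I x =
    (\<lambda>u. u \<otimes>\<^bsub>quiver_algebra Q I\<^esub> path_class Q I 1 (x, [], x)) ` carrier (quiver_algebra Q I)"


section \<open>Complexes and the homotopy category\<close>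

text \<open>All modules occurring here are left submodules of a module of functions \<open>'i \<Rightarrow> \<Lambda>\<close>
  with pointwise operations.\<close>

record ('i, 'r) cplx =
  obj :: "int \<Rightarrow> ('i \<Rightarrow> 'r) set"
  diff :: "int \<Rightarrow> ('i \<Rightarrow> 'r) \<Rightarrow> ('i \<Rightarrow> 'r)"

definition module_map ::
    "('r, 'm) ring_scheme \<Rightarrow> ('i \<Rightarrow> 'r) set \<Rightarrow> ('j \<Rightarrow> 'r) set
      \<Rightarrow> (('i \<Rightarrow> 'r) \<Rightarrow> ('j \<Rightarrow> 'r)) \<Rightarrow> bool" where
  "module_map L M N f \<longleftrightarrow>
     f \<in> M \<rightarrow> N \<and>
     (\<forall>u\<in>M. \<forall>v\<in>M. f (\<lambda>i. u i \<oplus>\<^bsub>L\<^esub> v i) = (\<lambda>j. f u j \<oplus>\<^bsub>L\<^esub> f v j)) \<and>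
     (\<forall>r\<in>carrier L. \<forall>u\<in>M. f (\<lambda>i. r \<otimes>\<^bsub>L\<^esub> u i) = (\<lambda>j. r \<otimes>\<^bsub>L\<^esub> f u j))"

definition chain_map ::
    "('r, 'm) ring_scheme \<Rightarrow> ('i, 'r) cplx \<Rightarrow> ('j, 'r) cplx
      \<Rightarrow> (int \<Rightarrow> ('i \<Rightarrow> 'r) \<Rightarrow> ('j \<Rightarrow> 'r)) \<Rightarrow> bool" where
  "chain_map L X Y f \<longleftrightarrow>
     (\<forall>n. module_map L (obj X n) (obj Y n) (f n) \<and>
          (\<forall>u\<in>obj X n. f (n + 1) (diff X n u) = diff Y n (f n u)))"

definition homotopic ::
    "('r, 'm) ring_scheme \<Rightarrow> ('i, 'r) cplx \<Rightarrow> ('j, 'r) cplx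
      \<Rightarrow> (int \<Rightarrow> ('i \<Rightarrow> 'r) \<Rightarrow> ('j \<Rightarrow> 'r)) \<Rightarrow> (int \<Rightarrow> ('i \<Rightarrow> 'r) \<Rightarrow> ('j \<Rightarrow> 'r)) \<Rightarrow> bool" where
  "homotopic L X Y f g \<longleftrightarrow>
     (\<exists>h. \<forall>n. module_map L (obj X n) (obj Y (n - 1)) (h n) \<and>
        (\<forall>u\<in>obj X n. \<forall>j.
           f n u j \<ominus>\<^bsub>L\<^esub> g n u j = diff Y (n - 1) (h n u) j \<oplus>\<^bsub>L\<^esub> h (n + 1) (diff X n u) j))"

definition homotopy_iso ::
    "('r, 'm) ring_scheme \<Rightarrow> ('i, 'r) cplx \<Rightarrow> ('j, 'r) cplx \<Rightarrow> bool" where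
  "homotopy_iso L X Y \<longleftrightarrow>
     (\<exists>f g. chain_map L X Y f \<and> chain_map L Y X g \<and>
        homotopic L X X (\<lambda>n u. g n (f n u)) (\<lambda>n u. u) \<and>
        homotopic L Y Y (\<lambda>n u. f n (g n u)) (\<lambda>n u. u))"

definition mapping_cone ::
    "('r, 'm) ring_scheme \<Rightarrow> ('i, 'r) cplx \<Rightarrow> ('j, 'r) cplx
      \<Rightarrow> (int \<Rightarrow> ('i \<Rightarrow> 'r) \<Rightarrow> ('j \<Rightarrow> 'r)) \<Rightarrow> ('i + 'j, 'r) cplx" where
  "mapping_cone L X Y f =
    \<lparr>obj = (\<lambda>n. {u. u \<circ> Inl \<in> obj X (n + 1) \<and> u \<circ> Inr \<in> obj Y n}),
     diff = (\<lambda>n u. case_sum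
       (\<lambda>i. \<ominus>\<^bsub>L\<^esub> diff X (n + 1) (u \<circ> Inl) i)
       (\<lambda>j. f (n + 1) (u \<circ> Inl) j \<oplus>\<^bsub>L\<^esub> diff Y n (u \<circ> Inr) j))\<rparr>"

definition right_bounded :: "('r, 'm) ring_scheme \<Rightarrow> ('i, 'r) cplx \<Rightarrow> bool" where
  "right_bounded L X \<longleftrightarrow> (\<exists>N. \<forall>n>N. obj X n = {\<lambda>_. \<zero>\<^bsub>L\<^esub>})"

definition bounded_cohomology :: "('r, 'm) ring_scheme \<Rightarrow> ('i, 'r) cplx \<Rightarrow> bool" where
  "bounded_cohomology L X \<longleftrightarrow>
     (\<exists>N. \<forall>n. N < \<bar>n\<bar> \<longrightarrow>
        {u \<in> obj X n. diff X n u = (\<lambda>_. \<zero>\<^bsub>L\<^esub>)} = diff X (n - 1) ` obj X (n - 1))"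


section \<open>Homotopy strings and bands\<close>

text \<open>The argument of \<open>Inverse\<close> is the path that is formally inverted.\<close>

datatype 'a hletter = is_direct: Direct (lpath: "'a list") | Inverse (lpath: "'a list")

text \<open>In a word, \<open>e\<close> of a letter is its left and \<open>s\<close> its right vertex.\<close>

fun lvertex :: "('v, 'a) pre_digraph \<Rightarrow> 'a hletter \<Rightarrow> 'v" where
  "lvertex Q (Direct p) = head Q (last p)"
| "lvertex Q (Inverse p) = tail Q (hd p)"

fun rvertex :: "('v, 'a) pre_digraph \<Rightarrow> 'a hletter \<Rightarrow> 'v" where
  "rvertex Q (Direct p) = tail Q (hd p)"
| "rvertex Q (Inverse p) = head Q (last p)"

definition is_letter ::
    "('v, 'a) pre_digraph \<Rightarrow> (('v, 'a) qpath \<Rightarrow> 'k::field) set \<Rightarrow> 'a hletter \<Rightarrow> bool" where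
  "is_letter Q I l \<longleftrightarrow>
     lpath l \<noteq> [] \<and> is_path Q (arc_path Q (lpath l)) \<and> \<not> in_ideal Q I (lpath l)"

text \<open>The condition on a letter and the letter immediately to its right.\<close>

fun consecutive ::
    "('v, 'a) pre_digraph \<Rightarrow> (('v, 'a) qpath \<Rightarrow> 'k::field) set \<Rightarrow> 'a hletter \<Rightarrow> 'a hletter \<Rightarrow> bool"
  where
  "consecutive Q I (Direct p) (Direct q) \<longleftrightarrow> in_ideal Q I [last q, hd p]"
| "consecutive Q I (Inverse p) (Inverse q) \<longleftrightarrow> in_ideal Q I [last p, hd q]"
| "consecutive Q I (Direct p) (Inverse q) \<longleftrightarrow> hd p \<noteq> hd q"
| "consecutive Q I (Inverse p) (Direct q) \<longleftrightarrow> last p \<noteq> last q"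

text \<open>The vertices of the diagram of a finite or infinite word sit at an interval \<open>pos\<close> of integer
  positions, from left to right; \<open>ltr w i\<close> is the letter between positions \<open>i\<close> and \<open>i + 1\<close>. The
  values of \<open>vtx\<close> and \<open>ltr\<close> elsewhere are irrelevant, so equality of words is \<open>word_eq\<close>.\<close>

record ('v, 'a) word =
  pos :: "int set"
  vtx :: "int \<Rightarrow> 'v"
  ltr :: "int \<Rightarrow> 'a hletter"

definition edges :: "('v, 'a) word \<Rightarrow> int set" where
  "edges w = {i. i \<in> pos w \<and> i + 1 \<in> pos w}"

definition word_eq :: "('v, 'a) word \<Rightarrow> ('v, 'a) word \<Rightarrow> bool" where
  "word_eq w w' \<longleftrightarrow>
     pos w = pos w' \<and> (\<forall>i\<in>pos w. vtx w i = vtx w' i) \<and> (\<forall>i\<in>edges w. ltr w i = ltr w' i)"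

definition grading :: "('v, 'a) word \<Rightarrow> (int \<Rightarrow> int) \<Rightarrow> bool" where
  "grading w d \<longleftrightarrow> (\<forall>i\<in>edges w. d (i + 1) = (if is_direct (ltr w i) then d i + 1 else d i - 1))"

definition fin_word :: "('v, 'a) pre_digraph \<Rightarrow> 'v \<Rightarrow> 'a hletter list \<Rightarrow> ('v, 'a) word" where
  "fin_word Q x ls =
    \<lparr>pos = {0..int (length ls)},
     vtx = (\<lambda>i. if i = 0 then x else rvertex Q (ls ! nat (i - 1))),
     ltr = (\<lambda>i. ls ! nat i)\<rparr>"

text \<open>Concatenation, written from left to right as in the diagrams. It keeps the positions of the
  left factor and shifts those of the right factor.\<close>

definition composable :: "('v, 'a) word \<Rightarrow> ('v, 'a) word \<Rightarrow> bool" where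
  "composable w w' \<longleftrightarrow>
     bdd_above (pos w) \<and> bdd_below (pos w') \<and> vtx w (Sup (pos w)) = vtx w' (Inf (pos w'))"

definition cat :: "('v, 'a) word \<Rightarrow> ('v, 'a) word \<Rightarrow> ('v, 'a) word" where
  "cat w w' = (let r = Sup (pos w); t = Inf (pos w') - r in
    \<lparr>pos = pos w \<union> (\<lambda>i. i - t) ` pos w',
     vtx = (\<lambda>i. if i \<le> r then vtx w i else vtx w' (i + t)),
     ltr = (\<lambda>i. if i < r then ltr w i else ltr w' (i + t))\<rparr>)"

text \<open>The complex of a diagram with vertex set \<open>V\<close>, in which vertex \<open>i\<close> carries \<open>P(x i)\<close> in degree
  \<open>d i\<close>, and with edge set \<open>E\<close>, in which edge \<open>k\<close> is the map \<open>a k\<close> from vertex \<open>src k\<close> to vertex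
  \<open>tgt k\<close>.\<close>

definition diagram_complex ::
    "('v, 'a) pre_digraph \<Rightarrow> (('v, 'a) qpath \<Rightarrow> 'k::field) set \<Rightarrow> int set \<Rightarrow> (int \<Rightarrow> 'v) \<Rightarrow> (int \<Rightarrow> int)
      \<Rightarrow> int set \<Rightarrow> (int \<Rightarrow> int) \<Rightarrow> (int \<Rightarrow> int) \<Rightarrow> (int \<Rightarrow> (('v, 'a) qpath \<Rightarrow> 'k) set)
      \<Rightarrow> (int, (('v, 'a) qpath \<Rightarrow> 'k) set) cplx" where
  "diagram_complex Q I V x d E src tgt a =
    \<lparr>obj = (\<lambda>n. {u. \<forall>i. if i \<in> V \<and> d i = n then u i \<in> proj Q I (x i)
                        else u i = \<zero>\<^bsub>quiver_algebra Q I\<^esub>}),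
     diff = (\<lambda>n u j. \<Oplus>\<^bsub>quiver_algebra Q I\<^esub>k\<in>{k\<in>E. tgt k = j}.
                        u (src k) \<otimes>\<^bsub>quiver_algebra Q I\<^esub> a k)\<rparr>"

definition string_complex ::
    "('v, 'a) pre_digraph \<Rightarrow> (('v, 'a) qpath \<Rightarrow> 'k::field) set \<Rightarrow> ('v, 'a) word \<Rightarrow> (int \<Rightarrow> int)
      \<Rightarrow> (int, (('v, 'a) qpath \<Rightarrow> 'k) set) cplx" where
  "string_complex Q I w d =
     diagram_complex Q I (pos w) (vtx w) d (edges w)
       (\<lambda>k. if is_direct (ltr w k) then k else k + 1)
       (\<lambda>k. if is_direct (ltr w k) then k + 1 else k)
       (\<lambda>k. path_class Q I 1 (arc_path Q (lpath (ltr w k))))"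

text \<open>For infinite words, right bounded complexes of \<^emph>\<open>finitely generated\<close> projectives are meant,
  so each degree may contain only finitely many vertices. The choice of \<open>d\<close> does not matter, since
  two gradings of a word differ by a constant.\<close>

definition homotopy_string ::
    "('v, 'a) pre_digraph \<Rightarrow> (('v, 'a) qpath \<Rightarrow> 'k::field) set \<Rightarrow> ('v, 'a) word \<Rightarrow> bool" where
  "homotopy_string Q I w \<longleftrightarrow>
     pos w \<noteq> {} \<and>
     (\<forall>i\<in>pos w. \<forall>j\<in>pos w. {i..j} \<subseteq> pos w) \<and>
     (\<forall>i\<in>pos w. vtx w i \<in> verts Q) \<and>
     (\<forall>i\<in>edges w. is_letter Q I (ltr w i) \<and>
        lvertex Q (ltr w i) = vtx w i \<and> rvertex Q (ltr w i) = vtx w (i + 1)) \<and>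
     (\<forall>i\<in>edges w. i + 1 \<in> edges w \<longrightarrow> consecutive Q I (ltr w i) (ltr w (i + 1))) \<and>
     (infinite (pos w) \<longrightarrow>
        (\<exists>d. grading w d \<and> (\<forall>n. finite {i \<in> pos w. d i = n}) \<and>
           right_bounded (quiver_algebra Q I) (string_complex Q I w d) \<and>
           bounded_cohomology (quiver_algebra Q I) (string_complex Q I w d)))"

abbreviation word_power :: "'l list \<Rightarrow> nat \<Rightarrow> 'l list" where
  "word_power ls n \<equiv> concat (replicate n ls)"

text \<open>The leftmost vertex of a nonempty list of letters.\<close>

abbreviation lend :: "('v, 'a) pre_digraph \<Rightarrow> 'a hletter list \<Rightarrow> 'v" where
  "lend Q ls \<equiv> lvertex Q (hd ls)"

definition homotopy_band ::
    "('v, 'a) pre_digraph \<Rightarrow> (('v, 'a) qpath \<Rightarrow> 'k::field) set \<Rightarrow> 'a hletter list \<Rightarrow> bool" where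
  "homotopy_band Q I ls \<longleftrightarrow>
     ls \<noteq> [] \<and>
     homotopy_string Q I (fin_word Q (lend Q ls) ls) \<and>
     lvertex Q (hd ls) = rvertex Q (last ls) \<and>
     length (filter is_direct ls) = length (filter (\<lambda>l. \<not> is_direct l) ls) \<and>
     homotopy_string Q I (fin_word Q (lend Q ls) (ls @ ls)) \<and>
     (\<nexists>ks n. 2 \<le> n \<and> ls = word_power ks n)"

definition unfolding_word :: "('v, 'a) pre_digraph \<Rightarrow> 'a hletter list \<Rightarrow> ('v, 'a) word" where
  "unfolding_word Q ls =
    \<lparr>pos = UNIV,
     vtx = (\<lambda>i. lvertex Q (ls ! nat (i mod int (length ls)))),
     ltr = (\<lambda>i. ls ! nat (i mod int (length ls)))\<rparr>"

text \<open>The parameter multiplies the letter with index \<open>m\<close>, which is meant to be direct.\<close>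

definition band_scalar :: "'a hletter list \<Rightarrow> nat \<Rightarrow> 'k::field \<Rightarrow> int \<Rightarrow> 'k" where
  "band_scalar ls m \<mu> k = (if k mod int (length ls) = int m then \<mu> else 1)"

text \<open>The vertices of the cyclic diagram are \<open>0, ..., length ls - 1\<close>. The grading \<open>d\<close> is one of
  the unfolded diagram; for a band it is periodic.\<close>

definition band_complex ::
    "('v, 'a) pre_digraph \<Rightarrow> (('v, 'a) qpath \<Rightarrow> 'k::field) set \<Rightarrow> 'a hletter list \<Rightarrow> nat \<Rightarrow> 'k
      \<Rightarrow> (int \<Rightarrow> int) \<Rightarrow> (int, (('v, 'a) qpath \<Rightarrow> 'k) set) cplx" where
  "band_complex Q I ls m \<mu> d = (let w = unfolding_word Q ls; n = int (length ls) in
     diagram_complex Q I {0..<n} (vtx w) d {0..<n}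
       (\<lambda>k. if is_direct (ltr w k) then k else (k + 1) mod n)
       (\<lambda>k. if is_direct (ltr w k) then (k + 1) mod n else k)
       (\<lambda>k. path_class Q I (band_scalar ls m \<mu> k) (arc_path Q (lpath (ltr w k)))))"


section \<open>Graph maps from string complexes to band complexes\<close>

definition letter_left :: "('v, 'a) word \<Rightarrow> int \<Rightarrow> 'a hletter option" where
  "letter_left w a = (if a - 1 \<in> edges w then Some (ltr w (a - 1)) else None)"

definition letter_right :: "('v, 'a) word \<Rightarrow> int \<Rightarrow> 'a hletter option" where
  "letter_right w b = (if b \<in> edges w then Some (ltr w b) else None)"

definition subword :: "('v, 'a) word \<Rightarrow> int \<Rightarrow> int \<Rightarrow> 'a hletter list" where
  "subword w a b = map (ltr w) [a..b - 1]"

text \<open>The subword of \<open>w\<close> between positions \<open>a\<close> and \<open>b\<close> is a finite maximal common homotopy substring,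
  in matching degrees, with the subword of \<open>w'\<close> between positions \<open>a + t\<close> and \<open>b + t\<close>. Words are
  considered up to inversion; \<open>w\<close> and \<open>w'\<close> are representatives in which the common substring is
  read in the same direction.\<close>

definition overlap ::
    "('v, 'a) word \<Rightarrow> (int \<Rightarrow> int) \<Rightarrow> ('v, 'a) word \<Rightarrow> (int \<Rightarrow> int) \<Rightarrow> int \<Rightarrow> int \<Rightarrow> int \<Rightarrow> bool" where
  "overlap w d w' d' a b t \<longleftrightarrow>
     a \<le> b \<and> {a..b} \<subseteq> pos w \<and> {a + t..b + t} \<subseteq> pos w' \<and>
     (\<forall>i\<in>{a..b}. vtx w i = vtx w' (i + t) \<and> d i = d' (i + t)) \<and>
     (\<forall>i\<in>{a..<b}. ltr w i = ltr w' (i + t)) \<and>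
     (letter_left w a = None \<or> letter_left w a \<noteq> letter_left w' (a + t)) \<and>
     (letter_right w b = None \<or> letter_right w b \<noteq> letter_right w' (b + t))"

text \<open>The arguments are \<open>\<sigma>\<^sub>L\<close>, \<open>\<tau>\<^sub>L\<close>, \<open>f\<^sub>L\<close> and \<open>\<sigma>\<^sub>R\<close>, \<open>\<tau>\<^sub>R\<close>, \<open>f\<^sub>R\<close>, respectively, with \<open>None\<close> for
  empty. Recall that the arc list of a product of paths is reversed.\<close>

inductive left_end :: "'a hletter option \<Rightarrow> 'a hletter option \<Rightarrow> 'a list option \<Rightarrow> bool" where
  "f \<noteq> [] \<Longrightarrow> p = q @ f \<Longrightarrow> left_end (Some (Direct p)) (Some (Direct q)) (Some f)"
| "f \<noteq> [] \<Longrightarrow> q = f @ p \<Longrightarrow> left_end (Some (Inverse p)) (Some (Inverse q)) (Some f)"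
| "(\<forall>p. l \<noteq> Some (Direct p)) \<Longrightarrow> (\<forall>q. l' \<noteq> Some (Inverse q)) \<Longrightarrow> left_end l l' None"

inductive right_end :: "'a hletter option \<Rightarrow> 'a hletter option \<Rightarrow> 'a list option \<Rightarrow> bool" where
  "f \<noteq> [] \<Longrightarrow> q = f @ p \<Longrightarrow> right_end (Some (Direct p)) (Some (Direct q)) (Some f)"
| "f \<noteq> [] \<Longrightarrow> p = q @ f \<Longrightarrow> right_end (Some (Inverse p)) (Some (Inverse q)) (Some f)"
| "(\<forall>p. l \<noteq> Some (Inverse p)) \<Longrightarrow> (\<forall>q. l' \<noteq> Some (Direct q)) \<Longrightarrow> right_end l l' None"

text \<open>The component of a graph map at position \<open>i\<close>, with scalar \<open>c\<close>.\<close>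

definition component ::
    "('v, 'a) pre_digraph \<Rightarrow> (('v, 'a) qpath \<Rightarrow> 'k::field) set \<Rightarrow> ('v, 'a) word \<Rightarrow> int \<Rightarrow> int
      \<Rightarrow> 'a list option \<Rightarrow> 'a list option \<Rightarrow> 'k \<Rightarrow> int \<Rightarrow> (('v, 'a) qpath \<Rightarrow> 'k) set" where
  "component Q I w a b fL fR c i =
    (let end_map = (\<lambda>f. case f of None \<Rightarrow> \<zero>\<^bsub>quiver_algebra Q I\<^esub>
                                | Some p \<Rightarrow> path_class Q I c (arc_path Q p))
     in if i \<in> {a..b} then path_class Q I c (vtx w i, [], vtx w i)
        else if i = a - 1 then end_map fL
        else if i = b + 1 then end_map fR
        else \<zero>\<^bsub>quiver_algebra Q I\<^esub>)"

text \<open>The family \<open>f\<close> is a graph map from the string complex of \<open>w\<close> to the band complex of \<open>ls\<close>,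
  determined by the overlap given by \<open>a\<close>, \<open>b\<close> and \<open>t\<close>. The recursion for the scalars \<open>c\<close> says that
  the squares formed by corresponding letters of the string and of the unfolded band commute; in
  the string all letters have scalar 1, in the band one letter per period has scalar \<open>\<mu>\<close>, and
  that letter is direct.\<close>

definition graph_map_to_band ::
    "('v, 'a) pre_digraph \<Rightarrow> (('v, 'a) qpath \<Rightarrow> 'k::field) set
      \<Rightarrow> ('v, 'a) word \<Rightarrow> (int \<Rightarrow> int) \<Rightarrow> 'a hletter list \<Rightarrow> nat \<Rightarrow> 'k \<Rightarrow> (int \<Rightarrow> int)
      \<Rightarrow> int \<Rightarrow> int \<Rightarrow> int
      \<Rightarrow> (int \<Rightarrow> (int \<Rightarrow> (('v, 'a) qpath \<Rightarrow> 'k) set) \<Rightarrow> (int \<Rightarrow> (('v, 'a) qpath \<Rightarrow> 'k) set)) \<Rightarrow> bool" where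
  "graph_map_to_band Q I w d ls m \<mu> d' a b t f \<longleftrightarrow>
     overlap w d (unfolding_word Q ls) d' a b t \<and>
     (\<exists>fL fR c.
        left_end (letter_left w a) (letter_left (unfolding_word Q ls) (a + t)) fL \<and>
        right_end (letter_right w b) (letter_right (unfolding_word Q ls) (b + t)) fR \<and>
        (\<forall>i. c i \<noteq> 0) \<and>
        (\<forall>i\<in>{a - 1..b}. c (i + 1) = c i * band_scalar ls m \<mu> (i + t)) \<and>
        (\<forall>n. \<forall>u\<in>obj (string_complex Q I w d) n.
           f n u = (\<lambda>j. \<Oplus>\<^bsub>quiver_algebra Q I\<^esub>i\<in>{i \<in> {a - 1..b + 1}. (i + t) mod int (length ls) = j}.
                      u i \<otimes>\<^bsub>quiver_algebra Q I\<^esub> component Q I w a b fL fR (c i) i)))"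

end

theory Submission
  imports Defs
begin

text \<open>Let \<open>N = length \<tau>\<close>. The length conditions on the overlap \<open>\<rho>\<close>, which occupies the positions \<open>a, \<dots>, b\<close>
of \<open>\<sigma>\<close>, imply that \<open>l N \<le> b - a < (l + 1) N\<close>. On these positions \<open>\<sigma>\<close> runs along the \<open>N\<close>-periodic
unfolded band \<open>U\<close>, so one period can be deleted from it; this gives the word \<open>c\<close>, called \<open>cut\<close> below.
The theorem holds because \<open>f\<close> is, in every degree, a split epimorphism whose kernel is the string
complex of \<open>c\<close> up to a shift: the cone of such a map is the shifted kernel (\<open>homotopy_iso_cone\<close>).

To see this, regard an element of the complex of a word as a function \<open>u\<close> on the integers and the
differential as \<open>(d u)\<^sub>p = u\<^sub>p\<^sub>-\<^sub>1 r\<^sub>p\<^sub>-\<^sub>1 + u\<^sub>p\<^sub>+\<^sub>1 l\<^sub>p\<close>, where \<open>r\<^sub>i\<close> or \<open>l\<^sub>i\<close> is the class of the letter \<open>i\<close> if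
that letter is direct or inverse, and \<open>0\<close> otherwise (\<open>string_diff_eq\<close>). A graph map from \<open>\<sigma>\<close> to \<open>U\<close>
is diagonal, \<open>u\<^sub>p \<mapsto> u\<^sub>p comp\<^sub>p\<close>, and commutes with the differentials because the squares at the ends of
the overlap commute (\<open>overlap_squares\<close>; here gentleness enters). The map \<open>f\<close> is this diagonal map
followed by summation over the residue classes modulo \<open>N\<close>. Inside the overlap every \<open>comp\<^sub>p\<close> is an
invertible scalar, and the overlap contains a whole period, so \<open>f\<close> is onto and split
(\<open>graph_map_splitting\<close>).

The word \<open>c\<close> overlaps \<open>U\<close> at the positions \<open>a, \<dots>, b - N\<close>, and the end maps of \<open>f\<close> serve as end maps
there as well: by periodicity, the letters of \<open>c\<close> and of \<open>U\<close> to the right of \<open>b - N\<close> are those of \<open>\<sigma>\<close>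
and of \<open>U\<close> to the right of \<open>b\<close>. This gives a second diagonal map, with components \<open>cut_comp\<close>.
Let \<open>S\<close> be the shift by one period. The embedding \<open>phi\<close> of the complex of \<open>c\<close> identifies the letters
of \<open>c\<close> and of \<open>\<sigma>\<close> outside the overlap, up to a scalar, and is defined on the overlap such that
\<open>comp \<circ> phi = (1 - S) \<circ> cut_comp\<close> (\<open>phi_comp\<close>). The rest follows from this identity: \<open>phi\<close> commutes with the differentials since \<open>comp\<close>, \<open>cut_comp\<close> and
\<open>S\<close> do (\<open>phi_chain\<close>); it is injective since \<open>1 - S\<close> is injective on functions that vanish far to the
left (\<open>phi_inj\<close>); its image lies in the kernel of \<open>f\<close> since the sum of \<open>h - S h\<close> over a residue class
telescopes to \<open>0\<close> (\<open>graph_map_phi\<close>); and it is the whole kernel, since a function of finite support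
all of whose sums over residue classes vanish has the form \<open>h - S h\<close>, with \<open>h\<close> given by partial sums
(\<open>phi_surj\<close>).

What remains concerns words rather than maps. If \<open>b - a = N\<close>, the letters on both sides of the
overlap become neighbours in \<open>c\<close>, and gentleness shows that they may be (\<open>junction_consecutive\<close>). If
\<open>\<sigma>\<close> is infinite, \<open>\<alpha>\<close>, \<open>\<beta>\<close> and \<open>c\<close> must again have bounded cohomology: in degrees of large absolute
value the complexes of \<open>\<alpha>\<close> and \<open>\<beta>\<close> behave like summands of that of \<open>\<sigma>\<close>
(\<open>homotopy_string_restrict_word\<close>), and \<open>phi\<close> is an isomorphism because the band complex vanishes
(\<open>homotopy_string_cut\<close>).\<close>

section \<open>The path algebra\<close>

lemma path_algebra_simps:
  "carrier (path_algebra Q) = {f. finite {r. f r \<noteq> 0} \<and> (\<forall>r. f r \<noteq> 0 \<longrightarrow> is_path Q r)}"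
  "f \<otimes>\<^bsub>path_algebra Q\<^esub> g =
     (\<lambda>(u, p, w). \<Sum>v\<in>verts Q. \<Sum>k\<le>length p. f (v, drop k p, w) * g (u, take k p, v))"
  "\<one>\<^bsub>path_algebra Q\<^esub> = (\<lambda>(u, p, v). if u \<in> verts Q \<and> p = [] \<and> v = u then 1 else 0)"
  "\<zero>\<^bsub>path_algebra Q\<^esub> = (\<lambda>_. 0)"
  "f \<oplus>\<^bsub>path_algebra Q\<^esub> g = (\<lambda>r. f r + g r)"
  by (simp_all add: path_algebra_def)

lemma path_mult_nonzeroE:
  assumes "(f \<otimes>\<^bsub>path_algebra Q\<^esub> g) (u, p, w) \<noteq> (0::'k::field)"
  obtains v k where "v \<in> verts Q" "k \<le> length p" "f (v, drop k p, w) \<noteq> 0" "g (u, take k p, v) \<noteq> 0"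
proof -
  have "(\<Sum>v\<in>verts Q. \<Sum>k\<le>length p. f (v, drop k p, w) * g (u, take k p, v)) \<noteq> 0"
    using assms by (simp add: path_algebra_simps)
  then obtain v where v: "v \<in> verts Q" "(\<Sum>k\<le>length p. f (v, drop k p, w) * g (u, take k p, v)) \<noteq> 0"
    by (meson sum.not_neutral_contains_not_neutral)
  then obtain k where "k \<in> {..length p}" "f (v, drop k p, w) * g (u, take k p, v) \<noteq> 0"
    by (meson sum.not_neutral_contains_not_neutral)
  then show thesis using that v(1) by auto
qed

lemma path_mult_closed:
  assumes "wf_digraph Q" "f \<in> carrier (path_algebra Q)" "g \<in> carrier (path_algebra Q)"
  shows "f \<otimes>\<^bsub>path_algebra Q\<^esub> g \<in> carrier (path_algebra Q :: (('v, 'a) qpath \<Rightarrow> 'k::field) ring)"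
proof -
  let ?h = "f \<otimes>\<^bsub>path_algebra Q\<^esub> g" and ?F = "{r. f r \<noteq> 0}" and ?G = "{r. g r \<noteq> 0}"
  have "{r. ?h r \<noteq> 0} \<subseteq> (\<lambda>((v, q, w), (u, p, v')). (u, p @ q, w)) ` (?F \<times> ?G)"
  proof
    fix r assume r: "r \<in> {r. ?h r \<noteq> 0}"
    obtain u p w where [simp]: "r = (u, p, w)" by (cases r)
    from r obtain v k where "f (v, drop k p, w) \<noteq> 0" "g (u, take k p, v) \<noteq> 0"
      by (auto elim!: path_mult_nonzeroE)
    then show "r \<in> (\<lambda>((v, q, w), (u, p, v')). (u, p @ q, w)) ` (?F \<times> ?G)"
      by (intro image_eqI[where x = "((v, drop k p, w), (u, take k p, v))"]) auto
  qed
  moreover have "finite (?F \<times> ?G)" using assms by (simp add: path_algebra_simps)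
  ultimately have "finite {r. ?h r \<noteq> 0}" by (meson finite_imageI finite_subset)
  moreover have "is_path Q r" if r: "?h r \<noteq> 0" for r
  proof -
    obtain u p w where [simp]: "r = (u, p, w)" by (cases r)
    from r obtain v k where "f (v, drop k p, w) \<noteq> 0" "g (u, take k p, v) \<noteq> 0"
      by (auto elim!: path_mult_nonzeroE)
    then have "is_path Q (v, drop k p, w)" "is_path Q (u, take k p, v)"
      using assms by (auto simp: path_algebra_simps)
    then have "pre_digraph.awalk Q u (take k p @ drop k p) w"
      unfolding is_path_def prod.case by (meson wf_digraph.awalk_appendI assms(1))
    then show ?thesis by (simp add: is_path_def)
  qed
  ultimately show ?thesis by (simp add: path_algebra_simps)
qed

text \<open>Both bracketings sum over all ways of cutting a path into three parts; \<open>k\<close> and \<open>m\<close> below are the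
two places where it is cut.\<close>

lemma path_mult_assoc:
  assumes "finite (verts Q)"
  shows "(f \<otimes>\<^bsub>path_algebra Q\<^esub> g) \<otimes>\<^bsub>path_algebra Q\<^esub> h =
         f \<otimes>\<^bsub>path_algebra Q\<^esub> (g \<otimes>\<^bsub>path_algebra Q\<^esub> (h :: ('v, 'a) qpath \<Rightarrow> 'k::field))"
proof (rule ext)
  fix r :: "('v, 'a) qpath"
  obtain u p w where [simp]: "r = (u, p, w)" by (cases r)
  let ?n = "length p"
  let ?t = "\<lambda>v v' k j. f (v', drop (j + k) p, w) * g (v, take j (drop k p), v') * h (u, take k p, v)"
  have inner: "(\<Sum>k\<le>?n. \<Sum>j\<le>?n - k. ?t v v' k j) = (\<Sum>m\<le>?n. \<Sum>k\<le>m. ?t v v' k (m - k))" for v v'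
  proof -
    have "(\<Sum>k\<le>?n. \<Sum>j\<le>?n - k. ?t v v' k j) = (\<Sum>(k, j)\<in>(SIGMA k:{..?n}. {..?n - k}). ?t v v' k j)"
      by (simp add: sum.Sigma)
    also have "(SIGMA k:{..?n}. {..?n - k}) = {(k, j). k + j \<le> ?n}" by auto
    also have "(\<Sum>(k, j)\<in>{(k, j). k + j \<le> ?n}. ?t v v' k j) = (\<Sum>m\<le>?n. \<Sum>k\<le>m. ?t v v' k (m - k))"
      by (rule sum.triangle_reindex_eq)
    finally show ?thesis .
  qed
  have "((f \<otimes>\<^bsub>path_algebra Q\<^esub> g) \<otimes>\<^bsub>path_algebra Q\<^esub> h) r =
        (\<Sum>v\<in>verts Q. \<Sum>k\<le>?n. \<Sum>v'\<in>verts Q. \<Sum>j\<le>?n - k. ?t v v' k j)"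
    by (simp add: path_algebra_simps sum_distrib_right)
  also have "\<dots> = (\<Sum>v\<in>verts Q. \<Sum>v'\<in>verts Q. \<Sum>k\<le>?n. \<Sum>j\<le>?n - k. ?t v v' k j)"
    by (intro sum.cong refl sum.swap)
  also have "\<dots> = (\<Sum>v\<in>verts Q. \<Sum>v'\<in>verts Q. \<Sum>m\<le>?n. \<Sum>k\<le>m. ?t v v' k (m - k))"
    by (simp only: inner)
  also have "\<dots> = (\<Sum>v'\<in>verts Q. \<Sum>v\<in>verts Q. \<Sum>m\<le>?n. \<Sum>k\<le>m. ?t v v' k (m - k))"
    by (rule sum.swap)
  also have "\<dots> = (\<Sum>v'\<in>verts Q. \<Sum>m\<le>?n. \<Sum>v\<in>verts Q. \<Sum>k\<le>m. ?t v v' k (m - k))"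
    by (intro sum.cong refl sum.swap)
  also have "\<dots> = (\<Sum>v'\<in>verts Q. \<Sum>m\<le>?n. \<Sum>v\<in>verts Q. \<Sum>k\<le>m.
                    f (v', drop m p, w) * (g (v, drop k (take m p), v') * h (u, take k (take m p), v)))"
    by (intro sum.cong refl) (auto simp: drop_take min_absorb1 mult.assoc)
  also have "\<dots> = (f \<otimes>\<^bsub>path_algebra Q\<^esub> (g \<otimes>\<^bsub>path_algebra Q\<^esub> h)) r"
    unfolding path_algebra_simps \<open>r = (u, p, w)\<close> prod.case sum_distrib_left
    by (intro sum.cong refl) auto
  finally show "((f \<otimes>\<^bsub>path_algebra Q\<^esub> g) \<otimes>\<^bsub>path_algebra Q\<^esub> h) r =
                (f \<otimes>\<^bsub>path_algebra Q\<^esub> (g \<otimes>\<^bsub>path_algebra Q\<^esub> h)) r" .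
qed

lemma sum_sum_single:
  assumes "finite A" "finite B" "a \<in> A" "b \<in> B" "\<And>x y. \<lbrakk>x \<in> A; y \<in> B; (x, y) \<noteq> (a, b)\<rbrakk> \<Longrightarrow> F x y = 0"
  shows "(\<Sum>x\<in>A. \<Sum>y\<in>B. F x y) = (F a b :: 'k::comm_monoid_add)"
proof -
  have "(\<Sum>x\<in>A. \<Sum>y\<in>B. F x y) = (\<Sum>x\<in>A. if x = a then F a b else 0)"
  proof (rule sum.cong[OF refl])
    fix x assume "x \<in> A"
    then have "(\<Sum>y\<in>B. F x y) = (\<Sum>y\<in>B. if y = b then (if x = a then F a b else 0) else 0)"
      using assms(5) by (intro sum.cong refl) auto
    then show "(\<Sum>y\<in>B. F x y) = (if x = a then F a b else 0)" using assms by simp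
  qed
  then show ?thesis using assms by simp
qed

lemma path_end_verts:
  assumes "is_path Q (u, p, w)" "wf_digraph Q" shows "u \<in> verts Q" "w \<in> verts Q"
  using assms wf_digraph.awalk_last_in_verts[of Q u p w] by (auto simp: is_path_def pre_digraph.awalk_def)

text \<open>The sum of the trivial paths is a unit because there are only finitely many vertices.\<close>

lemma ring_path_algebra:
  assumes "fin_digraph Q"
  shows "ring (path_algebra Q :: (('v, 'a) qpath \<Rightarrow> 'k::field) ring)" (is "ring ?A")
proof -
  interpret fin_digraph Q by fact
  show ?thesis
  proof (rule ringI)
    show "abelian_group ?A"
    proof (rule abelian_groupI)
      fix f g assume fg: "f \<in> carrier ?A" "g \<in> carrier ?A"
      have "{r. f r + g r \<noteq> 0} \<subseteq> {r. f r \<noteq> 0} \<union> {r. g r \<noteq> 0}" by auto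
      then show "f \<oplus>\<^bsub>?A\<^esub> g \<in> carrier ?A"
        using fg by (auto simp: path_algebra_simps intro: finite_subset)
    next
      fix f assume f: "f \<in> carrier ?A"
      then show "\<exists>y\<in>carrier ?A. y \<oplus>\<^bsub>?A\<^esub> f = \<zero>\<^bsub>?A\<^esub>"
        by (intro bexI[of _ "\<lambda>r. - f r"]) (auto simp: path_algebra_simps)
    qed (auto simp: path_algebra_simps)
  next
    show "Group.monoid ?A"
    proof (rule monoidI)
      have "{r. (\<one>\<^bsub>?A\<^esub> r :: 'k) \<noteq> 0} \<subseteq> (\<lambda>v. (v, [], v)) ` verts Q"
        by (auto simp: path_algebra_simps split: if_splits)
      then show "\<one>\<^bsub>?A\<^esub> \<in> carrier ?A"
        by (auto simp: path_algebra_simps is_path_def awalk_Nil_iff intro: finite_subset split: if_splits)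
    next
      fix f assume f: "f \<in> carrier ?A"
      show "\<one>\<^bsub>?A\<^esub> \<otimes>\<^bsub>?A\<^esub> f = f"
      proof (rule ext)
        fix r :: "('v, 'a) qpath"
        obtain u p w where [simp]: "r = (u, p, w)" by (cases r)
        show "(\<one>\<^bsub>?A\<^esub> \<otimes>\<^bsub>?A\<^esub> f) r = f r"
        proof (cases "w \<in> verts Q")
          case True
          then have "(\<one>\<^bsub>?A\<^esub> \<otimes>\<^bsub>?A\<^esub> f) r =
              (if w \<in> verts Q \<and> drop (length p) p = [] \<and> w = w then 1 else 0) * f (u, take (length p) p, w)"
            unfolding path_algebra_simps \<open>r = (u, p, w)\<close> prod.case
            by (intro sum_sum_single[of _ _ w "length p"]) auto
          with True show ?thesis by simp
        next
          case False
          then have "\<not> is_path Q r" using path_end_verts[OF _ wf_digraph_axioms] by auto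
          then have "f r = 0" using f unfolding path_algebra_simps by blast
          moreover have "(\<one>\<^bsub>?A\<^esub> \<otimes>\<^bsub>?A\<^esub> f) r = 0"
            unfolding path_algebra_simps using False by (auto intro!: sum.neutral)
          ultimately show ?thesis by simp
        qed
      qed
      show "f \<otimes>\<^bsub>?A\<^esub> \<one>\<^bsub>?A\<^esub> = f"
      proof (rule ext)
        fix r :: "('v, 'a) qpath"
        obtain u p w where [simp]: "r = (u, p, w)" by (cases r)
        show "(f \<otimes>\<^bsub>?A\<^esub> \<one>\<^bsub>?A\<^esub>) r = f r"
        proof (cases "u \<in> verts Q")
          case True
          then have "(f \<otimes>\<^bsub>?A\<^esub> \<one>\<^bsub>?A\<^esub>) r =
              f (u, drop 0 p, w) * (if u \<in> verts Q \<and> take 0 p = [] \<and> u = u then 1 else 0)"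
            unfolding path_algebra_simps \<open>r = (u, p, w)\<close> prod.case
            by (intro sum_sum_single[of _ _ u 0]) auto
          with True show ?thesis by simp
        next
          case False
          then have "\<not> is_path Q r" using path_end_verts[OF _ wf_digraph_axioms] by auto
          then have "f r = 0" using f unfolding path_algebra_simps by blast
          moreover have "(f \<otimes>\<^bsub>?A\<^esub> \<one>\<^bsub>?A\<^esub>) r = 0"
            unfolding path_algebra_simps using False by (auto intro!: sum.neutral)
          ultimately show ?thesis by simp
        qed
      qed
    qed (simp_all add: path_mult_closed[OF wf_digraph_axioms] path_mult_assoc)
  next
    fix f g h :: "('v, 'a) qpath \<Rightarrow> 'k"
    show "(f \<oplus>\<^bsub>?A\<^esub> g) \<otimes>\<^bsub>?A\<^esub> h = f \<otimes>\<^bsub>?A\<^esub> h \<oplus>\<^bsub>?A\<^esub> g \<otimes>\<^bsub>?A\<^esub> h"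
         "h \<otimes>\<^bsub>?A\<^esub> (f \<oplus>\<^bsub>?A\<^esub> g) = h \<otimes>\<^bsub>?A\<^esub> f \<oplus>\<^bsub>?A\<^esub> h \<otimes>\<^bsub>?A\<^esub> g"
      unfolding path_algebra_simps
      by (rule ext, simp add: case_prod_beta distrib_left distrib_right sum.distrib)+
  qed
qed

lemma path_term_closed: "is_path Q r \<Longrightarrow> path_term c r \<in> carrier (path_algebra Q)"
  by (auto simp: path_algebra_simps path_term_def)

lemma path_term_mult:
  assumes "finite (verts Q)" "v \<in> verts Q"
  shows "path_term c (v, q, w) \<otimes>\<^bsub>path_algebra Q\<^esub> path_term c' (u, p, v) = path_term (c * c') (u, p @ q, w)"
    (is "?l = _")
proof (rule ext)
  fix r :: "('a, 'b) qpath"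
  obtain x s y where [simp]: "r = (x, s, y)" by (cases r)
  let ?m = "length p"
  show "?l r = path_term (c * c') (u, p @ q, w) r"
  proof (cases "r = (u, p @ q, w)")
    case True
    have len: "k = ?m" if "take k (p @ q) = p" "k \<le> length (p @ q)" for k
      using that by (metis length_take min_absorb2)
    from True have "?l r = path_term c (v, q, w) (v, drop ?m s, y) * path_term c' (u, p, v) (x, take ?m s, v)"
      unfolding path_algebra_simps \<open>r = (x, s, y)\<close> prod.case using assms len
      by (intro sum_sum_single[of _ _ v ?m])
         (auto simp del: take_append drop_append simp: path_term_def split: if_splits)
    with True show ?thesis by (simp add: path_term_def)
  next
    case False
    have "?l r = 0"
    proof (rule ccontr)
      assume "?l r \<noteq> 0"
      then obtain v' k where "path_term c (v, q, w) (v', drop k s, y) \<noteq> 0" "path_term c' (u, p, v) (x, take k s, v') \<noteq> 0"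
        by (auto elim!: path_mult_nonzeroE)
      then have "q = drop k s" "p = take k s" "x = u" "y = w" by (auto simp: path_term_def split: if_splits)
      then show False using False by simp
    qed
    also have "0 = path_term (c * c') (u, p @ q, w) r"
      using False unfolding path_term_def by (simp only: if_False)
    finally show ?thesis .
  qed
qed

section \<open>Paths modulo the ideal\<close>

locale quiver_with_ideal =
  fixes Q :: "('v, 'a) pre_digraph" and I :: "(('v, 'a) qpath \<Rightarrow> 'k::field) set"
  assumes fin_quiver: "fin_digraph Q"
    and ideal: "ideal I (path_algebra Q)"
begin

sublocale fin_digraph Q by (rule fin_quiver)

abbreviation \<Lambda> :: "(('v, 'a) qpath \<Rightarrow> 'k) set ring" where "\<Lambda> \<equiv> quiver_algebra Q I"

sublocale \<Lambda>: ring \<Lambda>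
  using ideal by (rule ideal.quotient_is_ring)

abbreviation mult_\<Lambda> (infixl \<open>\<cdot>\<close> 70) where "u \<cdot> v \<equiv> u \<otimes>\<^bsub>\<Lambda>\<^esub> v"
abbreviation zero_\<Lambda> (\<open>\<zero>\<^sub>\<Lambda>\<close>) where "\<zero>\<^sub>\<Lambda> \<equiv> \<zero>\<^bsub>\<Lambda>\<^esub>"

abbreviation cls :: "'k \<Rightarrow> 'a list \<Rightarrow> (('v, 'a) qpath \<Rightarrow> 'k) set" where
  "cls c p \<equiv> path_class Q I c (arc_path Q p)"

abbreviation idm :: "'k \<Rightarrow> 'v \<Rightarrow> (('v, 'a) qpath \<Rightarrow> 'k) set" where
  "idm c x \<equiv> path_class Q I c (x, [], x)"

definition valid :: "'a list \<Rightarrow> bool" where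
  "valid p \<longleftrightarrow> p \<noteq> [] \<and> is_path Q (arc_path Q p)"

lemma cas_ends: "cas u p v \<Longrightarrow> p \<noteq> [] \<Longrightarrow> u = tail Q (hd p) \<and> v = head Q (last p)"
  by (induction u p v rule: cas.induct) (auto split: if_splits)

lemma valid_iff: "valid p \<longleftrightarrow> p \<noteq> [] \<and> set p \<subseteq> arcs Q \<and> cas (tail Q (hd p)) p (head Q (last p))"
  by (cases p) (auto simp: valid_def is_path_def arc_path_def awalk_def)

lemma cas_append_valid:
  assumes "p \<noteq> []" "q \<noteq> []"
  shows "cas u (p @ q) v \<longleftrightarrow> cas u p (head Q (last p)) \<and> head Q (last p) = tail Q (hd q) \<and> cas (tail Q (hd q)) q v"
  using assms
proof (induction p arbitrary: u)
  case (Cons e p)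
  show ?case
  proof (cases "p = []")
    case True
    then show ?thesis using cas_ends[of "head Q e" q v] Cons.prems by (auto simp del: cas_append_iff)
  next
    case False
    then show ?thesis using Cons by (simp del: cas_append_iff)
  qed
qed simp

lemma valid_append_iff:
  assumes "p \<noteq> []" "q \<noteq> []"
  shows "valid (p @ q) \<longleftrightarrow> valid p \<and> valid q \<and> head Q (last p) = tail Q (hd q)"
  using assms by (auto simp: valid_iff cas_append_valid simp del: cas_append_iff)

lemma valid_ends: "valid p \<Longrightarrow> hd p \<in> arcs Q" "valid p \<Longrightarrow> last p \<in> arcs Q"
  "valid p \<Longrightarrow> tail Q (hd p) \<in> verts Q" "valid p \<Longrightarrow> head Q (last p) \<in> verts Q"
proof -
  assume "valid p"
  then have "p \<noteq> []" "set p \<subseteq> arcs Q" by (auto simp: valid_iff)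
  then show "hd p \<in> arcs Q" "last p \<in> arcs Q" by auto
  then show "tail Q (hd p) \<in> verts Q" "head Q (last p) \<in> verts Q" by auto
qed

lemma is_path_idm: "x \<in> verts Q \<Longrightarrow> is_path Q (x, [], x)"
  by (simp add: is_path_def awalk_Nil_iff)

lemma path_class_closed: "is_path Q r \<Longrightarrow> path_class Q I c r \<in> carrier \<Lambda>"
proof -
  assume "is_path Q r"
  interpret A: ideal I "path_algebra Q" by (rule ideal)
  show ?thesis
    unfolding path_class_def FactRing_def
    using A.a_rcosetsI[OF A.a_subset path_term_closed[OF \<open>is_path Q r\<close>]] by simp
qed

lemma path_class_mult:
  assumes "is_path Q (v, q, w)" "is_path Q (u, p, v)"
  shows "path_class Q I c (v, q, w) \<cdot> path_class Q I c' (u, p, v) = path_class Q I (c * c') (u, p @ q, w)"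
proof -
  interpret A: ideal I "path_algebra Q" by (rule ideal)
  have "v \<in> verts Q" using path_end_verts[OF assms(1) wf_digraph_axioms] by simp
  then show ?thesis
    using A.rcoset_mult_add[OF path_term_closed[OF assms(1)] path_term_closed[OF assms(2)]]
    unfolding path_class_def FactRing_def by (simp add: path_term_mult)
qed

lemma path_class_eq_zero: "path_term c r \<in> I \<Longrightarrow> path_class Q I c r = \<zero>\<^sub>\<Lambda>"
proof -
  assume *: "path_term c r \<in> I"
  interpret A: ideal I "path_algebra Q" by (rule ideal)
  show ?thesis
    unfolding path_class_def FactRing_def
    using A.a_coset_join2[OF _ A.a_subgroup *] A.a_subset * by auto
qed

lemma arc_path_in_ideal_mult:
  assumes "is_path Q (v, q, w)" "is_path Q (u, p, v)" 
    "path_term c (v, q, w) \<in> I \<or> path_term c' (u, p, v) \<in> I"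
  shows "path_term (c * c') (u, p @ q, w) \<in> I"
proof -
  interpret A: ideal I "path_algebra Q" by (rule ideal)
  have "v \<in> verts Q" using path_end_verts[OF assms(1) wf_digraph_axioms] by simp
  then have "path_term (c * c') (u, p @ q, w) = path_term c (v, q, w) \<otimes>\<^bsub>path_algebra Q\<^esub> path_term c' (u, p, v)"
    by (simp add: path_term_mult)
  then show ?thesis
    using assms(3) A.I_l_closed[OF _ path_term_closed[OF assms(1), of c], of "path_term c' (u, p, v)"]
      A.I_r_closed[OF _ path_term_closed[OF assms(2), of c'], of "path_term c (v, q, w)"] by auto
qed

lemma is_path_valid: "valid p \<Longrightarrow> is_path Q (tail Q (hd p), p, head Q (last p))"
  by (simp add: valid_def arc_path_def)

lemma cls_closed: "valid p \<Longrightarrow> cls c p \<in> carrier \<Lambda>"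
  by (simp add: valid_def path_class_closed)

lemma idm_closed: "x \<in> verts Q \<Longrightarrow> idm c x \<in> carrier \<Lambda>"
  by (simp add: is_path_idm path_class_closed)

lemma cls_mult:
  assumes "valid p" "valid q" "head Q (last p) = tail Q (hd q)"
  shows "cls c q \<cdot> cls c' p = cls (c * c') (p @ q)"
  using path_class_mult[OF is_path_valid[OF assms(2)], where u = "tail Q (hd p)" and p = p and c = c and c' = c'] is_path_valid[OF assms(1)] assms
  by (simp add: arc_path_def valid_def)

lemma cls_idm: "valid p \<Longrightarrow> cls c p \<cdot> idm c' (tail Q (hd p)) = cls (c * c') p"
  using path_class_mult[OF is_path_valid[of p], where p = "[]" and u = "tail Q (hd p)" and c = c and c' = c']
    is_path_idm[OF valid_ends(3), of p]
  by (simp add: arc_path_def)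

lemma idm_cls: "valid p \<Longrightarrow> idm c (head Q (last p)) \<cdot> cls c' p = cls (c * c') p"
  using path_class_mult[OF _ is_path_valid[of p], where q = "[]" and w = "head Q (last p)" and c = c and c' = c']
    is_path_idm[OF valid_ends(4), of p]
  by (simp add: arc_path_def)

lemma idm_idm: "x \<in> verts Q \<Longrightarrow> idm c x \<cdot> idm c' x = idm (c * c') x"
  using path_class_mult[where v = x and q = "[]" and w = x and u = x and p = "[]" and c = c and c' = c'] by (simp add: is_path_idm)

text \<open>The path is a product of three paths, the middle one being the path of length two at the
junction.\<close>

lemma in_ideal_append:
  assumes "valid (p @ q)" "p \<noteq> []" "q \<noteq> []" "in_ideal Q I [last p, hd q]"
  shows "path_term c (arc_path Q (p @ q)) \<in> I"
proof -
  define p' q' where "p' = butlast p" and "q' = tl q"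
  have p: "p = p' @ [last p]" and q: "q = hd q # q'"
    using assms by (simp_all add: p'_def q'_def)
  define m where "m = [last p, hd q]"
  have m: "in_ideal Q I m" "m \<noteq> []" "hd m = last p" "last m = hd q" using assms by (auto simp: m_def)
  have pq: "p @ q = p' @ m @ q'" by (subst p, subst q) (simp add: m_def)
  have mq: "valid (m @ q') \<and> path_term c (tail Q (hd m), m @ q', head Q (last (p @ q))) \<in> I"
  proof (cases "q' = []")
    case True
    then have l: "last (p @ q) = last m" using pq m by simp
    have v: "valid m" using assms(1) m True unfolding pq by (cases "p' = []") (auto simp: valid_append_iff)
    have "path_term (1 * c) (tail Q (hd m), [] @ m, head Q (last m)) \<in> I" if "c \<noteq> 0"
      using arc_path_in_ideal_mult[OF is_path_valid[OF v], where u = "tail Q (hd m)" and p = "[]" and c = 1 and c' = c] m is_path_idm[OF valid_ends(3)[OF v]]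
      by (simp add: arc_path_def)
    moreover have "path_term 0 r \<in> I" for r
    proof -
      interpret A: ideal I "path_algebra Q" by (rule ideal)
      have "path_term 0 r = \<zero>\<^bsub>path_algebra Q\<^esub>" by (auto simp: path_term_def path_algebra_simps)
      then show ?thesis using additive_subgroup.zero_closed[OF A.is_additive_subgroup] by metis
    qed
    ultimately show ?thesis using v True l by (cases "c = 0") auto
  next
    case False
    then have l: "last (p @ q) = last q'" using pq m by simp
    have v: "valid m" "valid q'" "head Q (last m) = tail Q (hd q')" "valid (m @ q')"
      using assms(1) m False unfolding pq by (cases "p' = []"; simp add: valid_append_iff)+
    have "path_term (c * 1) (tail Q (hd m), m @ q', head Q (last q')) \<in> I"
      using is_path_valid[OF v(1)] is_path_valid[OF v(2)] v(3) m(1)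
      by (intro arc_path_in_ideal_mult[of "head Q (last m)"]) (auto simp: arc_path_def)
    then show ?thesis using v l by simp
  qed
  show ?thesis
  proof (cases "p' = []")
    case True then show ?thesis using mq pq m by (simp add: arc_path_def)
  next
    case False
    then have v: "valid p'" "head Q (last p') = tail Q (hd m)"
      using assms(1) m unfolding pq by (simp_all add: valid_append_iff)
    have l: "last (p @ q) = last (m @ q')" using pq m by simp
    have "is_path Q (tail Q (hd m), m @ q', head Q (last (m @ q')))"
      using is_path_valid[of "m @ q'"] mq m by simp
    then have "path_term (c * 1) (tail Q (hd p'), p' @ (m @ q'), head Q (last (p @ q))) \<in> I"
      using is_path_valid[OF v(1)] mq v(2) m l
      by (intro arc_path_in_ideal_mult[of "tail Q (hd m)"]) auto
    then show ?thesis using False unfolding pq by (simp add: arc_path_def)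
  qed
qed

lemma cls_mult_zero:
  assumes "valid p" "valid q" "head Q (last p) = tail Q (hd q)" "in_ideal Q I [last p, hd q]"
  shows "cls c q \<cdot> cls c' p = \<zero>\<^sub>\<Lambda>"
proof -
  have "p \<noteq> []" "q \<noteq> []" using assms by (auto simp: valid_def)
  then have "path_term (c * c') (arc_path Q (p @ q)) \<in> I"
    using assms by (intro in_ideal_append) (simp_all add: valid_append_iff)
  then show ?thesis using assms by (simp add: cls_mult path_class_eq_zero)
qed

lemma mem_proj_iff:
  assumes "x \<in> verts Q"
  shows "u \<in> proj Q I x \<longleftrightarrow> u \<in> carrier \<Lambda> \<and> u \<cdot> idm 1 x = u"
proof
  have e: "idm 1 x \<in> carrier \<Lambda>" "idm 1 x \<cdot> idm 1 x = idm 1 x"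
    using assms by (simp_all add: idm_closed idm_idm)
  assume "u \<in> proj Q I x"
  then obtain v where v: "v \<in> carrier \<Lambda>" "u = v \<cdot> idm 1 x" unfolding proj_def by (rule imageE)
  have "u \<cdot> idm 1 x = v \<cdot> (idm 1 x \<cdot> idm 1 x)"
    unfolding v(2) by (rule \<Lambda>.m_assoc[OF v(1) e(1) e(1)])
  then show "u \<in> carrier \<Lambda> \<and> u \<cdot> idm 1 x = u"
    using v(2) \<Lambda>.m_closed[OF v(1) e(1)] by (simp only: e)
next
  assume *: "u \<in> carrier \<Lambda> \<and> u \<cdot> idm 1 x = u"
  show "u \<in> proj Q I x" unfolding proj_def
    by (rule image_eqI[of _ _ u]) (use * in simp_all)
qed

lemma proj_carrier: "u \<in> proj Q I x \<Longrightarrow> x \<in> verts Q \<Longrightarrow> u \<in> carrier \<Lambda>"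
  by (simp add: mem_proj_iff)

lemma proj_closed:
  assumes "x \<in> verts Q"
  shows "\<zero>\<^sub>\<Lambda> \<in> proj Q I x"
    "u \<in> proj Q I x \<Longrightarrow> v \<in> proj Q I x \<Longrightarrow> u \<oplus>\<^bsub>\<Lambda>\<^esub> v \<in> proj Q I x"
    "u \<in> proj Q I x \<Longrightarrow> \<ominus>\<^bsub>\<Lambda>\<^esub> u \<in> proj Q I x"
    "r \<in> carrier \<Lambda> \<Longrightarrow> u \<in> proj Q I x \<Longrightarrow> r \<cdot> u \<in> proj Q I x"
  using assms by (simp_all add: mem_proj_iff \<Lambda>.l_distr idm_closed \<Lambda>.l_minus \<Lambda>.m_assoc)

lemma cls_proj: "valid p \<Longrightarrow> cls c p \<in> proj Q I (tail Q (hd p))"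
  by (simp add: mem_proj_iff[OF valid_ends(3)] cls_closed cls_idm)

lemma idm_proj: "x \<in> verts Q \<Longrightarrow> idm c x \<in> proj Q I x"
  by (simp add: mem_proj_iff idm_closed idm_idm)

text \<open>The image of \<open>c\<close> in the centre of \<open>\<Lambda>\<close>. On \<open>P(x)\<close>, right multiplication by \<open>scalar c\<close> and by the
scaled idempotent \<open>idm c x\<close> agree (\<open>proj_idm\<close>), but \<open>scalar c\<close> does not refer to a vertex and can
be moved past the classes of paths.\<close>

definition scalar :: "'k \<Rightarrow> (('v, 'a) qpath \<Rightarrow> 'k) set" where
  "scalar c = I +>\<^bsub>path_algebra Q\<^esub> (\<lambda>r. c * \<one>\<^bsub>path_algebra Q\<^esub> r)"

lemma path_algebra_scale:
  fixes c :: 'k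
  assumes "f \<in> carrier (path_algebra Q)"
  shows "(\<lambda>r. c * f r) \<in> carrier (path_algebra Q)"
    "(\<lambda>r. c * \<one>\<^bsub>path_algebra Q\<^esub> r) \<otimes>\<^bsub>path_algebra Q\<^esub> f = (\<lambda>r. c * f r)"
    "f \<otimes>\<^bsub>path_algebra Q\<^esub> (\<lambda>r. c * \<one>\<^bsub>path_algebra Q\<^esub> r) = (\<lambda>r. c * f r)"
proof -
  interpret A: ring "path_algebra Q :: (('v, 'a) qpath \<Rightarrow> 'k) ring" by (rule ring_path_algebra[OF fin_quiver])
  have "{r. c * f r \<noteq> 0} \<subseteq> {r. f r \<noteq> 0}" by auto
  then show "(\<lambda>r. c * f r) \<in> carrier (path_algebra Q)"
    using assms by (auto simp: path_algebra_simps intro: finite_subset)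
  have bilin: "(\<lambda>r. c * g r) \<otimes>\<^bsub>path_algebra Q\<^esub> h = (\<lambda>r. c * (g \<otimes>\<^bsub>path_algebra Q\<^esub> h) r)"
    "h \<otimes>\<^bsub>path_algebra Q\<^esub> (\<lambda>r. c * g r) = (\<lambda>r. c * (h \<otimes>\<^bsub>path_algebra Q\<^esub> g) r)" for g h
    by (auto simp: path_algebra_simps(2) fun_eq_iff sum_distrib_left mult.assoc mult.left_commute intro!: sum.cong)
  show "(\<lambda>r. c * \<one>\<^bsub>path_algebra Q\<^esub> r) \<otimes>\<^bsub>path_algebra Q\<^esub> f = (\<lambda>r. c * f r)"
    unfolding bilin A.l_one[OF assms] ..
  show "f \<otimes>\<^bsub>path_algebra Q\<^esub> (\<lambda>r. c * \<one>\<^bsub>path_algebra Q\<^esub> r) = (\<lambda>r. c * f r)"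
    unfolding bilin A.r_one[OF assms] ..
qed

lemma scalar_closed: "scalar c \<in> carrier \<Lambda>"
proof -
  interpret A: ideal I "path_algebra Q" by (rule ideal)
  show ?thesis unfolding scalar_def FactRing_def
    using A.a_rcosetsI[OF A.a_subset path_algebra_scale(1)[OF A.one_closed, of c]] by simp
qed

lemma scalar_mult:
  assumes "f \<in> carrier (path_algebra Q)"
  shows "scalar c \<cdot> (I +>\<^bsub>path_algebra Q\<^esub> f) = I +>\<^bsub>path_algebra Q\<^esub> (\<lambda>r. c * f r)"
    "(I +>\<^bsub>path_algebra Q\<^esub> f) \<cdot> scalar c = I +>\<^bsub>path_algebra Q\<^esub> (\<lambda>r. c * f r)"
proof -
  interpret A: ideal I "path_algebra Q" by (rule ideal)
  note s = path_algebra_scale(1)[OF A.one_closed, of c]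
  show "scalar c \<cdot> (I +>\<^bsub>path_algebra Q\<^esub> f) = I +>\<^bsub>path_algebra Q\<^esub> (\<lambda>r. c * f r)"
    using A.rcoset_mult_add[OF s assms] path_algebra_scale(2)[OF assms, of c]
    unfolding scalar_def FactRing_def by simp
  show "(I +>\<^bsub>path_algebra Q\<^esub> f) \<cdot> scalar c = I +>\<^bsub>path_algebra Q\<^esub> (\<lambda>r. c * f r)"
    using A.rcoset_mult_add[OF assms s] path_algebra_scale(3)[OF assms, of c]
    unfolding scalar_def FactRing_def by simp
qed

lemma scalar_comm:
  assumes "u \<in> carrier \<Lambda>" shows "scalar c \<cdot> u = u \<cdot> scalar c"
proof -
  obtain f where f: "f \<in> carrier (path_algebra Q)" "u = I +>\<^bsub>path_algebra Q\<^esub> f"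
    using assms by (auto simp: FactRing_def A_RCOSETS_def')
  show ?thesis unfolding f(2) scalar_mult[OF f(1)] ..
qed

lemma scalar_path_class: "is_path Q r \<Longrightarrow> scalar c \<cdot> path_class Q I c' r = path_class Q I (c * c') r"
proof -
  assume r: "is_path Q r"
  have "(\<lambda>r'. c * path_term c' r r') = path_term (c * c') r" by (auto simp: path_term_def)
  then show ?thesis unfolding path_class_def scalar_mult(1)[OF path_term_closed[OF r]] by simp
qed

lemma scalar_cls: "valid p \<Longrightarrow> scalar c \<cdot> cls c' p = cls (c * c') p"
  by (simp add: valid_def scalar_path_class)

lemma scalar_idm: "x \<in> verts Q \<Longrightarrow> scalar c \<cdot> idm c' x = idm (c * c') x"
  by (simp add: is_path_idm scalar_path_class)

lemma scalar_scalar: "scalar c \<cdot> scalar c' = scalar (c * c')"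
proof -
  interpret A: ideal I "path_algebra Q" by (rule ideal)
  show ?thesis
    using scalar_mult(1)[OF path_algebra_scale(1)[OF A.one_closed, of c'], of c]
    by (simp add: scalar_def mult.assoc)
qed

lemma scalar_one: "scalar 1 = \<one>\<^bsub>\<Lambda>\<^esub>"
  by (simp add: scalar_def FactRing_def)

lemma scalar_cancel:
  assumes "u \<in> carrier \<Lambda>" "c * c' = 1"
  shows "u \<cdot> scalar c \<cdot> scalar c' = u"
  using assms by (simp add: \<Lambda>.m_assoc scalar_closed scalar_scalar scalar_one)

lemma proj_idm:
  assumes "x \<in> verts Q" "u \<in> proj Q I x" shows "u \<cdot> idm c x = u \<cdot> scalar c"
proof -
  have u: "u \<in> carrier \<Lambda>" "u \<cdot> idm 1 x = u" using assms by (auto simp: mem_proj_iff)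
  have i: "idm 1 x \<in> carrier \<Lambda>" using assms(1) by (rule idm_closed)
  have "idm c x = idm 1 x \<cdot> scalar c"
    using scalar_idm[OF assms(1), of c 1] scalar_comm[OF i, of c] by simp
  then have "u \<cdot> idm c x = u \<cdot> idm 1 x \<cdot> scalar c"
    using u(1) i scalar_closed by (simp add: \<Lambda>.m_assoc)
  then show ?thesis by (simp only: u(2))
qed

lemma scalar_proj: "x \<in> verts Q \<Longrightarrow> u \<in> proj Q I x \<Longrightarrow> u \<cdot> scalar c \<in> proj Q I x"
  using proj_closed(4)[of x "scalar c" u] by (simp add: scalar_comm proj_carrier scalar_closed)

lemma finsum_proj:
  assumes x: "x \<in> verts Q" and "finite A" "\<And>i. i \<in> A \<Longrightarrow> g i \<in> proj Q I x"
  shows "finsum \<Lambda> g A \<in> proj Q I x"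
  using assms(2,3)
proof (induction A rule: finite_induct)
  case empty
  then show ?case using proj_closed(1)[OF x] by simp
next
  case (insert i A)
  have "g \<in> A \<rightarrow> carrier \<Lambda>" "g i \<in> carrier \<Lambda>" using insert.prems proj_carrier[OF _ x] by auto
  then have "finsum \<Lambda> g (insert i A) = g i \<oplus>\<^bsub>\<Lambda>\<^esub> finsum \<Lambda> g A"
    using insert.hyps by (intro \<Lambda>.finsum_insert) auto
  then show ?case using insert proj_closed(2)[OF x] by simp
qed

end

section \<open>The mapping cone of a split epimorphism of complexes\<close>

definition fun_module :: "('r, 'm) ring_scheme \<Rightarrow> ('i \<Rightarrow> 'r) set \<Rightarrow> bool" where
  "fun_module L M \<longleftrightarrow>
     M \<subseteq> {u. \<forall>i. u i \<in> carrier L} \<and> (\<lambda>_. \<zero>\<^bsub>L\<^esub>) \<in> M \<and>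
     (\<forall>u\<in>M. \<forall>v\<in>M. (\<lambda>i. u i \<oplus>\<^bsub>L\<^esub> v i) \<in> M) \<and>
     (\<forall>r\<in>carrier L. \<forall>u\<in>M. (\<lambda>i. r \<otimes>\<^bsub>L\<^esub> u i) \<in> M)"

context ring
begin

lemma fun_moduleD:
  assumes "fun_module R M"
  shows "u \<in> M \<Longrightarrow> u i \<in> carrier R" "(\<lambda>_. \<zero>) \<in> M"
    "u \<in> M \<Longrightarrow> v \<in> M \<Longrightarrow> (\<lambda>i. u i \<oplus> v i) \<in> M"
    "r \<in> carrier R \<Longrightarrow> u \<in> M \<Longrightarrow> (\<lambda>i. r \<otimes> u i) \<in> M"
  using assms by (auto simp: fun_module_def)

lemma fun_module_neg:
  assumes "fun_module R M" "u \<in> M" shows "(\<lambda>i. \<ominus> u i) \<in> M"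
proof -
  have "(\<lambda>i. (\<ominus> \<one>) \<otimes> u i) \<in> M" using assms by (simp add: fun_moduleD)
  then show ?thesis using fun_moduleD(1)[OF assms] by (simp add: l_minus)
qed

lemma module_mapD:
  assumes "module_map R M N f"
  shows "u \<in> M \<Longrightarrow> f u \<in> N" "u \<in> M \<Longrightarrow> v \<in> M \<Longrightarrow> f (\<lambda>i. u i \<oplus> v i) = (\<lambda>j. f u j \<oplus> f v j)"
    "r \<in> carrier R \<Longrightarrow> u \<in> M \<Longrightarrow> f (\<lambda>i. r \<otimes> u i) = (\<lambda>j. r \<otimes> f u j)"
  using assms by (auto simp: module_map_def)

lemma module_map_neg:
  assumes "module_map R M N f" "fun_module R M" "fun_module R N" "u \<in> M"
  shows "f (\<lambda>i. \<ominus> u i) = (\<lambda>j. \<ominus> f u j)"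
proof -
  have "f (\<lambda>i. (\<ominus> \<one>) \<otimes> u i) = (\<lambda>j. (\<ominus> \<one>) \<otimes> f u j)" using assms by (simp add: module_mapD)
  moreover have "u i \<in> carrier R" "f u j \<in> carrier R" for i j
    using assms by (meson fun_moduleD(1) module_mapD(1))+
  ultimately show ?thesis by (simp add: l_minus)
qed

lemma module_map_zero:
  assumes "module_map R M N f" "fun_module R M" "fun_module R N"
  shows "f (\<lambda>_. \<zero>) = (\<lambda>_. \<zero>)"
proof -
  have z: "(\<lambda>_. \<zero>) \<in> M" using assms by (simp add: fun_moduleD)
  have "f (\<lambda>i. \<zero> \<otimes> \<zero>) = (\<lambda>j. \<zero> \<otimes> f (\<lambda>_. \<zero>) j)"
    using module_mapD(3)[OF assms(1) zero_closed z] by simp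
  moreover have "f (\<lambda>_. \<zero>) j \<in> carrier R" for j
    using assms z by (meson fun_moduleD(1) module_mapD(1))
  ultimately show ?thesis by simp
qed

lemma module_map_comb:
  assumes "module_map R M N f" "fun_module R M" "fun_module R N" "u \<in> M" "v \<in> M" "w \<in> M"
  shows "f (\<lambda>i. u i \<oplus> v i \<oplus> \<ominus> w i) = (\<lambda>j. f u j \<oplus> f v j \<oplus> \<ominus> f w j)"
  using module_mapD(2)[OF assms(1) fun_moduleD(3)[OF assms(2) assms(4,5)] fun_module_neg[OF assms(2,6)]]
    module_mapD(2)[OF assms(1,4,5)] module_map_neg[OF assms(1-3,6)] by simp

end

text \<open>The differentials of string and band complexes and the map \<open>phi\<close> have this form. They are linear
because coefficients are multiplied on the right, while \<open>\<Lambda>\<close> acts from the left.\<close>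

lemma (in ring) two_term_module_map:
  assumes M: "fun_module R M" and F: "\<And>u. u \<in> M \<Longrightarrow> F u = (\<lambda>p. u (\<alpha> p) \<otimes> A p \<oplus> u (\<beta> p) \<otimes> B p)"
    and c: "\<And>p. A p \<in> carrier R" "\<And>p. B p \<in> carrier R" and N: "\<And>u. u \<in> M \<Longrightarrow> F u \<in> N"
  shows "module_map R M N F"
  unfolding module_map_def
proof (intro conjI ballI funcsetI)
  note M' = fun_moduleD[OF M]
  fix u assume u: "u \<in> M"
  then show "F u \<in> N" by (rule N)
  note uc = M'(1)[OF u]
  { fix v assume v: "v \<in> M"
    show "F (\<lambda>i. u i \<oplus> v i) = (\<lambda>j. F u j \<oplus> F v j)"
      unfolding F[OF u] F[OF v] F[OF M'(3)[OF u v]] using c uc M'(1)[OF v] by (simp add: l_distr a_ac) }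
next
  note M' = fun_moduleD[OF M]
  fix r u assume r: "r \<in> carrier R" and u: "u \<in> M"
  show "F (\<lambda>i. r \<otimes> u i) = (\<lambda>j. r \<otimes> F u j)"
    unfolding F[OF u] F[OF M'(4)[OF r u]] using c M'(1)[OF u] r by (simp add: r_distr m_assoc)
qed

lemma (in ring) module_map_cong:
  assumes g: "module_map R M N g" and M: "fun_module R M" and f: "\<And>u. u \<in> M \<Longrightarrow> f u = g u"
  shows "module_map R M N f"
  unfolding module_map_def
proof (intro conjI ballI funcsetI)
  fix u assume u: "u \<in> M"
  then show "f u \<in> N" using module_mapD(1)[OF g u] f by simp
  { fix v assume v: "v \<in> M"
    show "f (\<lambda>i. u i \<oplus> v i) = (\<lambda>j. f u j \<oplus> f v j)"
      unfolding f[OF u] f[OF v] f[OF fun_moduleD(3)[OF M u v]] by (rule module_mapD(2)[OF g u v]) }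
next
  fix r u assume r: "r \<in> carrier R" and u: "u \<in> M"
  show "f (\<lambda>i. r \<otimes> u i) = (\<lambda>j. r \<otimes> f u j)"
    unfolding f[OF u] f[OF fun_moduleD(4)[OF M r u]] by (rule module_mapD(3)[OF g r u])
qed

text \<open>A chain map \<open>f\<close> that is split by \<open>s\<close> in every degree. The complex \<open>Z\<close>, moved by one degree, is the kernel of \<open>f\<close>, embedded by \<open>\<phi>\<close>.\<close>

locale split_epi_complexes = ring L for L :: "('a, 'm) ring_scheme" (structure) +
  fixes X :: "('i, 'a) cplx" and Y :: "('j, 'a) cplx" and Z :: "('h, 'a) cplx"
    and f :: "int \<Rightarrow> ('i \<Rightarrow> 'a) \<Rightarrow> ('j \<Rightarrow> 'a)" and s :: "int \<Rightarrow> ('j \<Rightarrow> 'a) \<Rightarrow> ('i \<Rightarrow> 'a)"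
    and \<phi> :: "int \<Rightarrow> ('h \<Rightarrow> 'a) \<Rightarrow> ('i \<Rightarrow> 'a)"
  assumes mod_X: "fun_module L (obj X n)" and mod_Y: "fun_module L (obj Y n)" and mod_Z: "fun_module L (obj Z n)"
    and d_X: "module_map L (obj X n) (obj X (n + 1)) (diff X n)"
    and d_Y: "module_map L (obj Y n) (obj Y (n + 1)) (diff Y n)"
    and d_Z: "module_map L (obj Z n) (obj Z (n + 1)) (diff Z n)"
    and dd_X: "x \<in> obj X n \<Longrightarrow> diff X (n + 1) (diff X n x) = (\<lambda>_. \<zero>)"
    and dd_Y: "y \<in> obj Y n \<Longrightarrow> diff Y (n + 1) (diff Y n y) = (\<lambda>_. \<zero>)"
    and f: "module_map L (obj X n) (obj Y n) (f n)"
    and f_d: "x \<in> obj X n \<Longrightarrow> f (n + 1) (diff X n x) = diff Y n (f n x)"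
    and s: "module_map L (obj Y n) (obj X n) (s n)"
    and f_s: "y \<in> obj Y n \<Longrightarrow> f n (s n y) = y"
    and \<phi>: "module_map L (obj Z n) (obj X (n + 1)) (\<phi> n)"
    and \<phi>_d: "z \<in> obj Z n \<Longrightarrow> \<phi> (n + 1) (diff Z n z) = diff X (n + 1) (\<phi> n z)"
    and \<phi>_inj: "inj_on (\<phi> n) (obj Z n)"
    and \<phi>_image: "\<phi> n ` obj Z n = {x \<in> obj X (n + 1). f (n + 1) x = (\<lambda>_. \<zero>)}"
begin

text \<open>For \<open>(x, y)\<close> in the cone, this is the projection \<open>1 - s f\<close> onto the kernel of \<open>f\<close>, applied to
\<open>x + d (s y)\<close>: note that \<open>f (x + d (s y)) = f x + d y\<close>.\<close>

definition kernel_part :: "int \<Rightarrow> ('i \<Rightarrow> 'a) \<Rightarrow> ('j \<Rightarrow> 'a) \<Rightarrow> 'i \<Rightarrow> 'a" where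
  "kernel_part n x y = (\<lambda>i. x i \<oplus> diff X n (s n y) i \<oplus>
     \<ominus> s (n + 1) (\<lambda>j. f (n + 1) x j \<oplus> diff Y n y j) i)"

text \<open>The differential of the summand \<open>\<Sigma>X\<close> of the cone is \<open>- d\<close>. The sign \<open>(-1)\<^sup>n\<close> in degree \<open>n\<close> turns it
into \<open>d\<close>.\<close>

definition alt_sign :: "int \<Rightarrow> ('x \<Rightarrow> 'a) \<Rightarrow> 'x \<Rightarrow> 'a" where
  "alt_sign n u = (if even n then u else (\<lambda>i. \<ominus> u i))"

definition to_cone :: "int \<Rightarrow> ('h \<Rightarrow> 'a) \<Rightarrow> ('i + 'j \<Rightarrow> 'a)" where
  "to_cone n z = case_sum (alt_sign n (\<phi> n z)) (\<lambda>_. \<zero>)"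

definition from_cone :: "int \<Rightarrow> ('i + 'j \<Rightarrow> 'a) \<Rightarrow> ('h \<Rightarrow> 'a)" where
  "from_cone n w = the_inv_into (obj Z n) (\<phi> n) (alt_sign n (kernel_part n (w \<circ> Inl) (w \<circ> Inr)))"

abbreviation "C \<equiv> mapping_cone L X Y f"

lemma obj_C: "w \<in> obj C n \<longleftrightarrow> w \<circ> Inl \<in> obj X (n + 1) \<and> w \<circ> Inr \<in> obj Y n"
  by (simp add: mapping_cone_def)

lemma diff_C: "diff C n w = case_sum (\<lambda>i. \<ominus> diff X (n + 1) (w \<circ> Inl) i)
    (\<lambda>j. f (n + 1) (w \<circ> Inl) j \<oplus> diff Y n (w \<circ> Inr) j)"
  by (simp add: mapping_cone_def)

lemmas X = fun_moduleD[OF mod_X] and Y = fun_moduleD[OF mod_Y] and Z = fun_moduleD[OF mod_Z]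
lemmas X_neg = fun_module_neg[OF mod_X] and Y_neg = fun_module_neg[OF mod_Y]
lemmas dX = module_mapD[OF d_X] and dY = module_mapD[OF d_Y] and dZ = module_mapD[OF d_Z]
lemmas fm = module_mapD[OF f] and sm = module_mapD[OF s] and \<phi>m = module_mapD[OF \<phi>]

lemma comp_sum: "(\<lambda>i. u i \<oplus> v i) \<circ> g = (\<lambda>i. (u \<circ> g) i \<oplus> (v \<circ> g) i)"
  "(\<lambda>i. r \<otimes> u i) \<circ> g = (\<lambda>i. r \<otimes> (u \<circ> g) i)"
  by auto

lemma case_sum_comp: "case_sum g h \<circ> Inl = g" "case_sum g h \<circ> Inr = h"
  by auto

lemma fun_module_C: "fun_module L (obj C n)"
proof -
  have c: "w i \<in> carrier L" if "w \<in> obj C n" for w i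
  proof (cases i)
    case (Inl a) then show ?thesis using that X(1)[of "w \<circ> Inl"] by (auto simp: obj_C)
  next
    case (Inr a) then show ?thesis using that Y(1)[of "w \<circ> Inr"] by (auto simp: obj_C)
  qed
  have "(\<lambda>_. \<zero>) \<in> obj C n" by (simp add: obj_C comp_def X Y)
  then show ?thesis
    unfolding fun_module_def using c by (auto simp only: obj_C comp_sum intro: X(3,4) Y(3,4))
qed

lemma alt_sign_X: "x \<in> obj X n \<Longrightarrow> alt_sign m x \<in> obj X n"
  by (simp add: alt_sign_def X_neg)

lemma alt_sign_alt_sign: "x \<in> obj X n \<Longrightarrow> alt_sign m (alt_sign m x) = x"
  by (auto simp: alt_sign_def X)

lemma alt_sign_add: "x \<in> obj X n \<Longrightarrow> x' \<in> obj X n \<Longrightarrow> alt_sign m (\<lambda>i. x i \<oplus> x' i) = (\<lambda>i. alt_sign m x i \<oplus> alt_sign m x' i)"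
  by (auto simp: alt_sign_def X minus_add)

lemma alt_sign_smult: "r \<in> carrier L \<Longrightarrow> x \<in> obj X n \<Longrightarrow> alt_sign m (\<lambda>i. r \<otimes> x i) = (\<lambda>i. r \<otimes> alt_sign m x i)"
  by (auto simp: alt_sign_def X r_minus)

lemma d_alt_sign: "x \<in> obj X n \<Longrightarrow> diff X n (alt_sign m x) = alt_sign m (diff X n x)"
  by (simp add: alt_sign_def module_map_neg[OF d_X mod_X mod_X])

lemma alt_sign_Suc: "x \<in> obj X n \<Longrightarrow> alt_sign (m + 1) x = (\<lambda>i. \<ominus> alt_sign m x i)"
  by (auto simp: alt_sign_def X)

lemma f_neg: "x \<in> obj X n \<Longrightarrow> f n (\<lambda>i. \<ominus> x i) = (\<lambda>j. \<ominus> f n x j)"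
  by (rule module_map_neg[OF f mod_X mod_Y])

lemma f_alt_sign: "x \<in> obj X n \<Longrightarrow> f n x = (\<lambda>_. \<zero>) \<Longrightarrow> f n (alt_sign m x) = (\<lambda>_. \<zero>)"
  by (simp add: alt_sign_def f_neg)

lemma f_phi: "z \<in> obj Z n \<Longrightarrow> f (n + 1) (\<phi> n z) = (\<lambda>_. \<zero>)"
  using \<phi>_image by blast

lemma kernel_part_closed:
  assumes "x \<in> obj X (n + 1)" "y \<in> obj Y n" shows "kernel_part n x y \<in> obj X (n + 1)"
  using assms unfolding kernel_part_def by (intro X(3) X_neg sm(1) Y(3) fm(1) dY(1) dX(1)) auto

lemma f_k:
  assumes x: "x \<in> obj X (n + 1)" and y: "y \<in> obj Y n" shows "f (n + 1) (kernel_part n x y) = (\<lambda>_. \<zero>)"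
proof -
  let ?v = "\<lambda>j. f (n + 1) x j \<oplus> diff Y n y j"
  have v: "?v \<in> obj Y (n + 1)" using x y by (intro Y(3) fm(1) dY(1))
  have sy: "s n y \<in> obj X n" "diff X n (s n y) \<in> obj X (n + 1)" using y by (auto intro: sm dX)
  have sv: "s (n + 1) ?v \<in> obj X (n + 1)" using v by (rule sm)
  have "f (n + 1) (kernel_part n x y) = (\<lambda>j. f (n + 1) x j \<oplus> f (n + 1) (diff X n (s n y)) j \<oplus> \<ominus> f (n + 1) (s (n + 1) ?v) j)"
    unfolding kernel_part_def by (rule module_map_comb[OF f mod_X mod_Y x sy(2) sv])
  also have "\<dots> = (\<lambda>j. ?v j \<oplus> \<ominus> ?v j)"
    unfolding f_s[OF v] f_d[OF sy(1)] f_s[OF y] ..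
  also have "\<dots> = (\<lambda>_. \<zero>)" using Y(1)[OF v] by (simp add: r_neg)
  finally show ?thesis .
qed

lemma kernel_part_add:
  assumes "x \<in> obj X (n + 1)" "y \<in> obj Y n" "x' \<in> obj X (n + 1)" "y' \<in> obj Y n"
  shows "kernel_part n (\<lambda>i. x i \<oplus> x' i) (\<lambda>i. y i \<oplus> y' i) = (\<lambda>i. kernel_part n x y i \<oplus> kernel_part n x' y' i)"
proof -
  let ?v = "\<lambda>x y j. f (n + 1) x j \<oplus> diff Y n y j"
  have v: "?v x y \<in> obj Y (n + 1)" "?v x' y' \<in> obj Y (n + 1)"
    using assms by (intro Y(3) fm(1) dY(1); simp)+
  have c: "f (n + 1) x j \<in> carrier L" "f (n + 1) x' j \<in> carrier L"
      "diff Y n y j \<in> carrier L" "diff Y n y' j \<in> carrier L" for j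
    using assms by (blast intro: Y(1) fm(1) dY(1))+
  have "?v (\<lambda>i. x i \<oplus> x' i) (\<lambda>i. y i \<oplus> y' i) = (\<lambda>j. ?v x y j \<oplus> ?v x' y' j)"
    unfolding fm(2)[OF assms(1,3)] dY(2)[OF assms(2,4)] using c by (simp add: a_ac)
  then have sv: "s (n + 1) (?v (\<lambda>i. x i \<oplus> x' i) (\<lambda>i. y i \<oplus> y' i)) =
      (\<lambda>i. s (n + 1) (?v x y) i \<oplus> s (n + 1) (?v x' y') i)"
    using sm(2)[OF v] by simp
  have sd: "diff X n (s n (\<lambda>i. y i \<oplus> y' i)) = (\<lambda>i. diff X n (s n y) i \<oplus> diff X n (s n y') i)"
    unfolding sm(2)[OF assms(2,4)] by (rule dX(2)[OF sm(1)[OF assms(2)] sm(1)[OF assms(4)]])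
  have c: "x i \<in> carrier L" "x' i \<in> carrier L"
    "s (n + 1) (?v x y) i \<in> carrier L" "s (n + 1) (?v x' y') i \<in> carrier L"
    "diff X n (s n y) i \<in> carrier L" "diff X n (s n y') i \<in> carrier L" for i
    using assms v by (blast intro: X(1) sm(1) dX(1))+
  show ?thesis
    unfolding kernel_part_def sv sd using c by (simp add: minus_add a_ac)
qed

lemma kernel_part_smult:
  assumes r: "r \<in> carrier L" and x: "x \<in> obj X (n + 1)" and y: "y \<in> obj Y n"
  shows "kernel_part n (\<lambda>i. r \<otimes> x i) (\<lambda>i. r \<otimes> y i) = (\<lambda>i. r \<otimes> kernel_part n x y i)"
proof -
  let ?v = "\<lambda>x y j. f (n + 1) x j \<oplus> diff Y n y j"
  have v: "?v x y \<in> obj Y (n + 1)" using x y by (intro Y(3) fm(1) dY(1))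
  have c: "f (n + 1) x j \<in> carrier L" "diff Y n y j \<in> carrier L" for j
    using x y by (blast intro: Y(1) fm(1) dY(1))+
  have "?v (\<lambda>i. r \<otimes> x i) (\<lambda>i. r \<otimes> y i) = (\<lambda>j. r \<otimes> ?v x y j)"
    unfolding fm(3)[OF r x] dY(3)[OF r y] using c r by (simp add: r_distr)
  then have sv: "s (n + 1) (?v (\<lambda>i. r \<otimes> x i) (\<lambda>i. r \<otimes> y i)) = (\<lambda>i. r \<otimes> s (n + 1) (?v x y) i)"
    using sm(3)[OF r v] by simp
  have sd: "diff X n (s n (\<lambda>i. r \<otimes> y i)) = (\<lambda>i. r \<otimes> diff X n (s n y) i)"
    unfolding sm(3)[OF r y] by (rule dX(3)[OF r sm(1)[OF y]])
  have c: "x i \<in> carrier L" "s (n + 1) (?v x y) i \<in> carrier L" "diff X n (s n y) i \<in> carrier L" for i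
    using x y v by (blast intro: X(1) sm(1) dX(1))+
  show ?thesis
    unfolding kernel_part_def sv sd using c r by (simp add: r_distr r_minus)
qed

lemma diff_C_closed: "w \<in> obj C n \<Longrightarrow> diff C n w \<in> obj C (n + 1)"
  unfolding obj_C diff_C case_sum_comp by (blast intro: X_neg dX(1) Y(3) fm(1) dY(1))

text \<open>With \<open>v = f x + d y\<close>, the left side is \<open>- d x + d (s v)\<close>, because \<open>f (- d x) + d v = 0\<close>; on the right
side, \<open>d\<close> of \<open>kernel_part n x y\<close> is \<open>d x - d (s v)\<close>, because \<open>d (d (s y)) = 0\<close>.\<close>

lemma kernel_part_diff:
  assumes x: "x \<in> obj X (n + 1)" and y: "y \<in> obj Y n"
  shows "kernel_part (n + 1) (\<lambda>i. \<ominus> diff X (n + 1) x i) (\<lambda>j. f (n + 1) x j \<oplus> diff Y n y j) =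
         (\<lambda>i. \<ominus> diff X (n + 1) (kernel_part n x y) i)"
proof -
  let ?v = "\<lambda>j. f (n + 1) x j \<oplus> diff Y n y j"
  let ?dx = "diff X (n + 1) x"
  have dx: "?dx \<in> obj X (n + 1 + 1)" using x by (rule dX)
  have v: "?v \<in> obj Y (n + 1)" using x y by (intro Y(3) fm(1) dY(1))
  have sy: "s n y \<in> obj X n" "diff X n (s n y) \<in> obj X (n + 1)" using y by (auto intro: sm dX)
  have sv: "s (n + 1) ?v \<in> obj X (n + 1)" using v by (rule sm)
  have dsv: "diff X (n + 1) (s (n + 1) ?v) \<in> obj X (n + 1 + 1)" using sv by (rule dX)
  have fdx: "f (n + 1 + 1) ?dx j \<in> carrier L" for j by (rule Y(1)[OF fm(1)[OF dx]])
  have "diff Y (n + 1) ?v = (\<lambda>j. diff Y (n + 1) (f (n + 1) x) j \<oplus> diff Y (n + 1) (diff Y n y) j)"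
    by (rule dY(2)[OF fm(1)[OF x] dY(1)[OF y]])
  then have dv: "diff Y (n + 1) ?v = f (n + 1 + 1) ?dx"
    unfolding dd_Y[OF y] f_d[OF x, symmetric] using fdx by simp
  have z: "(\<lambda>j. f (n + 1 + 1) (\<lambda>i. \<ominus> ?dx i) j \<oplus> diff Y (n + 1) ?v j) = (\<lambda>_. \<zero>)"
    unfolding dv f_neg[OF dx] using fdx by (simp add: l_neg)
  have dk: "diff X (n + 1) (kernel_part n x y) =
       (\<lambda>i. ?dx i \<oplus> diff X (n + 1) (diff X n (s n y)) i \<oplus> \<ominus> diff X (n + 1) (s (n + 1) ?v) i)"
    unfolding kernel_part_def by (rule module_map_comb[OF d_X mod_X mod_X x sy(2) sv])
  show ?thesis
    unfolding dk dd_X[OF sy(1)] unfolding kernel_part_def z module_map_zero[OF s mod_Y mod_X]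
    using X(1)[OF dx] X(1)[OF dsv] by (simp add: minus_add)
qed

lemma phi_from_cone:
  assumes "w \<in> obj C n"
  shows "from_cone n w \<in> obj Z n" "\<phi> n (from_cone n w) = alt_sign n (kernel_part n (w \<circ> Inl) (w \<circ> Inr))"
proof -
  have w: "w \<circ> Inl \<in> obj X (n + 1)" "w \<circ> Inr \<in> obj Y n" using assms by (auto simp only: obj_C)
  have "alt_sign n (kernel_part n (w \<circ> Inl) (w \<circ> Inr)) \<in> \<phi> n ` obj Z n"
    unfolding \<phi>_image using alt_sign_X[OF kernel_part_closed[OF w]] f_alt_sign[OF kernel_part_closed[OF w] f_k[OF w]] by simp
  then show "from_cone n w \<in> obj Z n" "\<phi> n (from_cone n w) = alt_sign n (kernel_part n (w \<circ> Inl) (w \<circ> Inr))"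
    unfolding from_cone_def using \<phi>_inj[of n] the_inv_into_into[OF \<phi>_inj[of n]] f_the_inv_into_f[OF \<phi>_inj[of n]] by auto
qed

lemma phi_eqD: "\<phi> n z = \<phi> n z' \<Longrightarrow> z \<in> obj Z n \<Longrightarrow> z' \<in> obj Z n \<Longrightarrow> z = z'"
  using \<phi>_inj by (meson inj_onD)

lemmas C = fun_moduleD[OF fun_module_C]

lemma from_cone_diff:
  assumes w: "w \<in> obj C n" shows "from_cone (n + 1) (diff C n w) = diff Z n (from_cone n w)"
proof (rule phi_eqD)
  have xy: "w \<circ> Inl \<in> obj X (n + 1)" "w \<circ> Inr \<in> obj Y n" using w by (auto simp only: obj_C)
  let ?k = "kernel_part n (w \<circ> Inl) (w \<circ> Inr)"
  have "\<phi> (n + 1) (from_cone (n + 1) (diff C n w)) = alt_sign (n + 1) (\<lambda>i. \<ominus> diff X (n + 1) ?k i)"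
    unfolding phi_from_cone(2)[OF diff_C_closed[OF w]] unfolding diff_C case_sum_comp kernel_part_diff[OF xy] ..
  also have "\<dots> = alt_sign n (diff X (n + 1) ?k)"
    using X(1)[OF dX(1)[OF kernel_part_closed[OF xy]]] by (auto simp: alt_sign_def)
  also have "\<dots> = diff X (n + 1) (alt_sign n ?k)" by (rule d_alt_sign[OF kernel_part_closed[OF xy], symmetric])
  also have "\<dots> = \<phi> (n + 1) (diff Z n (from_cone n w))"
    unfolding \<phi>_d[OF phi_from_cone(1)[OF w]] phi_from_cone(2)[OF w] ..
  finally show "\<phi> (n + 1) (from_cone (n + 1) (diff C n w)) = \<phi> (n + 1) (diff Z n (from_cone n w))" .
qed (auto intro: phi_from_cone dZ diff_C_closed w)

lemma from_cone_add:
  assumes w: "w \<in> obj C n" and w': "w' \<in> obj C n"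
  shows "from_cone n (\<lambda>i. w i \<oplus> w' i) = (\<lambda>j. from_cone n w j \<oplus> from_cone n w' j)"
proof (rule phi_eqD)
  have xy: "w \<circ> Inl \<in> obj X (n + 1)" "w \<circ> Inr \<in> obj Y n" "w' \<circ> Inl \<in> obj X (n + 1)" "w' \<circ> Inr \<in> obj Y n"
    using w w' by (auto simp only: obj_C)
  show "\<phi> n (from_cone n (\<lambda>i. w i \<oplus> w' i)) = \<phi> n (\<lambda>j. from_cone n w j \<oplus> from_cone n w' j)"
    unfolding phi_from_cone(2)[OF C(3)[OF w w']] \<phi>m(2)[OF phi_from_cone(1)[OF w] phi_from_cone(1)[OF w']]
      phi_from_cone(2)[OF w] phi_from_cone(2)[OF w'] comp_sum kernel_part_add[OF xy]
    by (rule alt_sign_add[OF kernel_part_closed[OF xy(1,2)] kernel_part_closed[OF xy(3,4)]])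
qed (auto intro: phi_from_cone w w' C Z)

lemma from_cone_smult:
  assumes r: "r \<in> carrier L" and w: "w \<in> obj C n"
  shows "from_cone n (\<lambda>i. r \<otimes> w i) = (\<lambda>j. r \<otimes> from_cone n w j)"
proof (rule phi_eqD)
  have xy: "w \<circ> Inl \<in> obj X (n + 1)" "w \<circ> Inr \<in> obj Y n" using w by (auto simp only: obj_C)
  show "\<phi> n (from_cone n (\<lambda>i. r \<otimes> w i)) = \<phi> n (\<lambda>j. r \<otimes> from_cone n w j)"
    unfolding phi_from_cone(2)[OF C(4)[OF r w]] \<phi>m(3)[OF r phi_from_cone(1)[OF w]]
      phi_from_cone(2)[OF w] comp_sum kernel_part_smult[OF r xy]
    by (rule alt_sign_smult[OF r kernel_part_closed[OF xy]])
qed (auto intro: phi_from_cone w r C Z)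

lemma chain_map_from_cone: "chain_map L C Z from_cone"
  unfolding chain_map_def module_map_def
  using phi_from_cone(1) from_cone_add from_cone_smult from_cone_diff by blast

lemma to_cone_closed: "z \<in> obj Z n \<Longrightarrow> to_cone n z \<in> obj C n"
  by (simp add: obj_C to_cone_def case_sum_comp alt_sign_X \<phi>m Y)

lemma chain_map_to_cone: "chain_map L Z C to_cone"
proof -
  have 1: "to_cone (n + 1) (diff Z n z) = diff C n (to_cone n z)" if z: "z \<in> obj Z n" for n z
  proof -
    have p: "\<phi> n z \<in> obj X (n + 1)" using z by (rule \<phi>m)
    show ?thesis
      unfolding to_cone_def diff_C case_sum_comp \<phi>_d[OF z] alt_sign_Suc[OF dX(1)[OF p]] d_alt_sign[OF p]
        f_alt_sign[OF p f_phi[OF z]] module_map_zero[OF d_Y mod_Y mod_Y] by simp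
  qed
  have 2: "to_cone n (\<lambda>i. z i \<oplus> z' i) = (\<lambda>j. to_cone n z j \<oplus> to_cone n z' j)"
    if z: "z \<in> obj Z n" "z' \<in> obj Z n" for n z z'
    unfolding to_cone_def \<phi>m(2)[OF z] alt_sign_add[OF \<phi>m(1)[OF z(1)] \<phi>m(1)[OF z(2)]]
    by (rule ext) (simp split: sum.split)
  have 3: "to_cone n (\<lambda>i. r \<otimes> z i) = (\<lambda>j. r \<otimes> to_cone n z j)"
    if z: "r \<in> carrier L" "z \<in> obj Z n" for n r z
    unfolding to_cone_def \<phi>m(3)[OF z] alt_sign_smult[OF z(1) \<phi>m(1)[OF z(2)]]
    by (rule ext) (simp add: that split: sum.split)
  show ?thesis
    unfolding chain_map_def module_map_def using 1 2 3 to_cone_closed by blast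
qed

lemma from_to_cone:
  assumes z: "z \<in> obj Z n" shows "from_cone n (to_cone n z) = z"
proof (rule phi_eqD)
  have p: "\<phi> n z \<in> obj X (n + 1)" using z by (rule \<phi>m)
  have z0: "diff X n (\<lambda>_. \<zero>) = (\<lambda>_. \<zero>)" "diff Y n (\<lambda>_. \<zero>) = (\<lambda>_. \<zero>)" "\<And>n. s n (\<lambda>_. \<zero>) = (\<lambda>_. \<zero>)"
    by (rule module_map_zero[OF d_X mod_X mod_X] module_map_zero[OF d_Y mod_Y mod_Y]
        module_map_zero[OF s mod_Y mod_X])+
  have "kernel_part n (alt_sign n (\<phi> n z)) (\<lambda>_. \<zero>) = alt_sign n (\<phi> n z)"
    unfolding kernel_part_def f_alt_sign[OF p f_phi[OF z]] z0 using X(1)[OF alt_sign_X[OF p]] by (simp add: z0)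
  then show "\<phi> n (from_cone n (to_cone n z)) = \<phi> n z"
    unfolding phi_from_cone(2)[OF to_cone_closed[OF z]] by (simp add: to_cone_def case_sum_comp alt_sign_alt_sign[OF p])
qed (auto intro: z phi_from_cone to_cone_closed)

text \<open>The composite on \<open>Z\<close> is the identity, since \<open>kernel_part\<close> is the identity on pairs \<open>(x, 0)\<close> with \<open>x\<close>
in the kernel of \<open>f\<close>. The other composite is \<open>(x, y) \<mapsto> (kernel_part x y, 0)\<close>; it is homotopic to the
identity by \<open>(x, y) \<mapsto> (- s y, 0)\<close>.\<close>

theorem homotopy_iso_cone: "homotopy_iso L C Z"
  unfolding homotopy_iso_def
proof (intro exI conjI)
  show "chain_map L C Z from_cone" by (rule chain_map_from_cone)
  show "chain_map L Z C to_cone" by (rule chain_map_to_cone)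
  show "homotopic L Z Z (\<lambda>n u. from_cone n (to_cone n u)) (\<lambda>n u. u)"
    unfolding homotopic_def
  proof (intro exI allI conjI ballI)
    fix n
    show "module_map L (obj Z n) (obj Z (n - 1)) (\<lambda>_ _. \<zero>)"
      by (simp add: module_map_def Z)
    fix u j assume u: "u \<in> obj Z n"
    have "diff Z (n - 1) (\<lambda>_. \<zero>) = (\<lambda>_. \<zero>)" by (rule module_map_zero[OF d_Z mod_Z mod_Z])
    then show "from_cone n (to_cone n u) j \<ominus> u j = diff Z (n - 1) (\<lambda>_. \<zero>) j \<oplus> \<zero>"
      using u Z(1)[OF u] by (simp add: from_to_cone minus_eq r_neg)
  qed
  show "homotopic L C C (\<lambda>n u. to_cone n (from_cone n u)) (\<lambda>n u. u)"
  proof -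
    let ?h = "\<lambda>n w. case_sum (\<lambda>i. \<ominus> s n (w \<circ> Inr) i) (\<lambda>_. \<zero>)"
    have closed: "?h n w \<in> obj C (n - 1)" if "w \<in> obj C n" for n w
    proof -
      have "w \<circ> Inr \<in> obj Y n" using that by (simp only: obj_C)
      then show ?thesis unfolding obj_C case_sum_comp using X_neg[OF sm(1)] Y by simp
    qed
    have add: "?h n (\<lambda>i. u i \<oplus> v i) = (\<lambda>j. ?h n u j \<oplus> ?h n v j)" if "u \<in> obj C n" "v \<in> obj C n" for n u v
    proof -
      have uv: "u \<circ> Inr \<in> obj Y n" "v \<circ> Inr \<in> obj Y n" using that by (auto simp only: obj_C)
      show ?thesis
        unfolding comp_sum sm(2)[OF uv] using X(1)[OF sm(1)[OF uv(1)]] X(1)[OF sm(1)[OF uv(2)]]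
        by (intro ext) (simp add: minus_add split: sum.split)
    qed
    have smult: "?h n (\<lambda>i. r \<otimes> u i) = (\<lambda>j. r \<otimes> ?h n u j)" if r: "r \<in> carrier L" and "u \<in> obj C n" for n r u
    proof -
      have u: "u \<circ> Inr \<in> obj Y n" using that by (simp only: obj_C)
      show ?thesis
        unfolding comp_sum sm(3)[OF r u] using X(1)[OF sm(1)[OF u]] r
        by (intro ext) (simp add: r_minus split: sum.split)
    qed
    have htp: "to_cone n (from_cone n w) j \<ominus> w j = diff C (n - 1) (?h n w) j \<oplus> ?h (n + 1) (diff C n w) j"
      if w: "w \<in> obj C n" for n w j
    proof -
      define x y where "x = w \<circ> Inl" and "y = w \<circ> Inr"
      have w_eq: "w = case_sum x y" unfolding x_def y_def by (intro ext) (simp split: sum.split)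
      let ?v = "\<lambda>j. f (n + 1) x j \<oplus> diff Y n y j"
      have x: "x \<in> obj X (n + 1)" and y: "y \<in> obj Y n" using w by (auto simp only: obj_C x_def y_def)
      have v: "?v \<in> obj Y (n + 1)" using x y by (intro Y(3) fm(1) dY(1))
      have sy: "s n y \<in> obj X n" "diff X n (s n y) \<in> obj X (n + 1)" using y by (auto intro: sm dX)
      have sv: "s (n + 1) ?v \<in> obj X (n + 1)" using v by (rule sm)
      have FG: "to_cone n (from_cone n w) = case_sum (kernel_part n x y) (\<lambda>_. \<zero>)"
        unfolding to_cone_def phi_from_cone(2)[OF w] x_def[symmetric] y_def[symmetric]
          alt_sign_alt_sign[OF kernel_part_closed[OF x y]] ..
      have dC: "diff C (n - 1) (?h n w) = case_sum (\<lambda>i. \<ominus> (\<ominus> diff X n (s n y) i)) (\<lambda>j. \<ominus> y j \<oplus> \<zero>)"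
        unfolding diff_C case_sum_comp y_def[symmetric] module_map_zero[OF d_Y mod_Y mod_Y]
        using module_map_neg[OF d_X mod_X mod_X sy(1)] f_neg[OF sy(1)] f_s[OF y] by simp
      have hd: "?h (n + 1) (diff C n w) = case_sum (\<lambda>i. \<ominus> s (n + 1) ?v i) (\<lambda>_. \<zero>)"
        unfolding diff_C case_sum_comp x_def y_def ..
      have c: "x i \<in> carrier L" "diff X n (s n y) i \<in> carrier L" "s (n + 1) ?v i \<in> carrier L" for i
        using X(1)[OF x, of i] X(1)[OF sy(2)] X(1)[OF sv] by auto
      have c': "y i \<in> carrier L" for i using Y(1)[OF y] .
      have cancel: "p \<oplus> q \<oplus> \<ominus> r \<ominus> p = q \<oplus> \<ominus> r"
        if "p \<in> carrier L" "q \<in> carrier L" "r \<in> carrier L" for p q r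
        using that by (simp add: minus_eq a_assoc a_comm[of p] l_neg)
      show ?thesis
        unfolding FG dC hd unfolding w_eq kernel_part_def using c cancel[OF c] c'
        by (cases j) (simp_all add: minus_eq)
    qed
    show ?thesis
      unfolding homotopic_def module_map_def
      using closed add smult htp by (intro exI[of _ ?h] allI conjI ballI funcsetI)
  qed
qed

lemma phi_zero: "\<phi> n (\<lambda>_. \<zero>) = (\<lambda>_. \<zero>)"
  by (rule module_map_zero[OF \<phi> mod_Z mod_X])

lemma phi_eq_zeroD: "z \<in> obj Z n \<Longrightarrow> \<phi> n z = (\<lambda>_. \<zero>) \<Longrightarrow> z = (\<lambda>_. \<zero>)"
  using phi_eqD[of n z "\<lambda>_. \<zero>"] Z(2) by (simp add: phi_zero)

lemma dd_Z: "z \<in> obj Z n \<Longrightarrow> diff Z (n + 1) (diff Z n z) = (\<lambda>_. \<zero>)"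
  using \<phi>_d[of "diff Z n z" "n + 1"] \<phi>_d[of z n] dd_X[of "\<phi> n z" "n + 1"] \<phi>m(1)[of z n] dZ(1)[of z n]
    dZ(1)[of "diff Z n z" "n + 1"]
  by (intro phi_eq_zeroD) auto

text \<open>A cycle of \<open>Z\<close> in degree \<open>n\<close> is a boundary \<open>d x\<close> in \<open>X\<close>, and \<open>x\<close> lies in the kernel of \<open>f\<close> because
\<open>Y\<close> vanishes in the degree of \<open>x\<close>.\<close>

lemma exact_Z:
  assumes X: "{x \<in> obj X (n + 1). diff X (n + 1) x = (\<lambda>_. \<zero>)} = diff X n ` obj X n"
    and Y: "obj Y n = {\<lambda>_. \<zero>}"
  shows "{z \<in> obj Z n. diff Z n z = (\<lambda>_. \<zero>)} = diff Z (n - 1) ` obj Z (n - 1)"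
proof (intro equalityI subsetI)
  fix z assume "z \<in> {z \<in> obj Z n. diff Z n z = (\<lambda>_. \<zero>)}"
  then have z: "z \<in> obj Z n" "diff Z n z = (\<lambda>_. \<zero>)" by auto
  have "\<phi> n z \<in> {x \<in> obj X (n + 1). diff X (n + 1) x = (\<lambda>_. \<zero>)}"
    using \<phi>_d[OF z(1)] z(2) phi_zero \<phi>m(1)[OF z(1)] by simp
  then obtain x where x: "x \<in> obj X n" "\<phi> n z = diff X n x" unfolding X by auto
  have "f n x = (\<lambda>_. \<zero>)" using fm(1)[OF x(1)] Y by simp
  then have "x \<in> \<phi> (n - 1) ` obj Z (n - 1)" using x(1) \<phi>_image[of "n - 1"] by simp
  then obtain z' where z': "z' \<in> obj Z (n - 1)" "x = \<phi> (n - 1) z'" by auto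
  have dz': "diff Z (n - 1) z' \<in> obj Z n" using dZ(1)[OF z'(1)] by simp
  have "\<phi> n z = \<phi> n (diff Z (n - 1) z')" using x(2) z'(2) \<phi>_d[OF z'(1)] by simp
  then have "z = diff Z (n - 1) z'" using phi_eqD z(1) dz' by blast
  then show "z \<in> diff Z (n - 1) ` obj Z (n - 1)" using z'(1) by blast
next
  fix z assume "z \<in> diff Z (n - 1) ` obj Z (n - 1)"
  then show "z \<in> {z \<in> obj Z n. diff Z n z = (\<lambda>_. \<zero>)}"
    using dZ(1)[of _ "n - 1"] dd_Z[of _ "n - 1"] by auto
qed

lemma Z_trivial: "obj X (n + 1) = {\<lambda>_. \<zero>} \<Longrightarrow> obj Z n = {\<lambda>_. \<zero>}"
  using \<phi>m(1)[of _ n] phi_eq_zeroD[of _ n] Z(2)[of n] by blast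

end

section \<open>Homotopy letters and the ends of a graph map\<close>

text \<open>Inverting a word reverses the order of its letters and flips each of them. This interchanges
left and right ends, so it suffices to prove statements about ends for left ends.\<close>

fun flip :: "'a hletter \<Rightarrow> 'a hletter" where
  "flip (Direct p) = Inverse p"
| "flip (Inverse p) = Direct p"

lemma flip_simps [simp]: "lvertex Q (flip l) = rvertex Q l" "rvertex Q (flip l) = lvertex Q l"
  "is_direct (flip l) \<longleftrightarrow> \<not> is_direct l" "lpath (flip l) = lpath l"
  by (cases l; simp)+

lemma consecutive_flip: "consecutive Q I (flip l) (flip l') \<longleftrightarrow> consecutive Q I l' l"
  by (cases l; cases l') auto

lemma right_end_iff_left_end_flip: "right_end l l' f \<longleftrightarrow> left_end (map_option flip l) (map_option flip l') f"
proof
  assume "right_end l l' f"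
  then show "left_end (map_option flip l) (map_option flip l') f"
  proof cases
    case 3
    have "map_option flip l \<noteq> Some (Direct p)" for p
      using 3(2) by (cases l) (auto elim: flip.elims)
    moreover have "map_option flip l' \<noteq> Some (Inverse p)" for p
      using 3(3) by (cases l') (auto elim: flip.elims)
    ultimately show ?thesis using 3(1) by (auto intro: left_end.intros)
  qed (auto intro: left_end.intros)
next
  assume "left_end (map_option flip l) (map_option flip l') f"
  then show "right_end l l' f"
  proof cases
    case (1 g p q)
    then have "l = Some (Inverse p)" "l' = Some (Inverse q)" by (auto elim: flip.elims)
    with 1 show ?thesis by (auto intro: right_end.intros)
  next
    case (2 g q p)
    then have "l = Some (Direct p)" "l' = Some (Direct q)" by (auto elim: flip.elims)
    with 2 show ?thesis by (auto intro: right_end.intros)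
  next
    case 3
    have "l \<noteq> Some (Inverse p)" for p using 3(2) by auto
    moreover have "l' \<noteq> Some (Direct p)" for p using 3(3) by auto
    ultimately show ?thesis using 3(1) by (auto intro: right_end.intros)
  qed
qed

context quiver_with_ideal
begin

text \<open>The map that a letter, if there is one, contributes to the differential from its left to its
right vertex; \<open>left_map\<close> is the contribution in the other direction. The scalar \<open>c\<close> is the one carried by
the letter.\<close>

fun right_map :: "'k \<Rightarrow> 'a hletter option \<Rightarrow> (('v, 'a) qpath \<Rightarrow> 'k) set" where
  "right_map c (Some (Direct p)) = cls c p"
| "right_map c _ = \<zero>\<^sub>\<Lambda>"

fun left_map :: "'k \<Rightarrow> 'a hletter option \<Rightarrow> (('v, 'a) qpath \<Rightarrow> 'k) set" where
  "left_map c (Some (Inverse p)) = cls c p"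
| "left_map c _ = \<zero>\<^sub>\<Lambda>"

abbreviation end_map :: "'k \<Rightarrow> 'a list option \<Rightarrow> (('v, 'a) qpath \<Rightarrow> 'k) set" where
  "end_map c f \<equiv> (case f of None \<Rightarrow> \<zero>\<^sub>\<Lambda> | Some p \<Rightarrow> cls c p)"

lemma right_map_flip: "right_map c (map_option flip x) = left_map c x"
  by (cases "(c, x)" rule: left_map.cases) auto

lemma left_map_flip: "left_map c (map_option flip x) = right_map c x"
  by (cases "(c, x)" rule: right_map.cases) auto

lemma is_letter_iff: "is_letter Q I l \<longleftrightarrow> valid (lpath l) \<and> \<not> in_ideal Q I (lpath l)"
  by (auto simp: is_letter_def valid_def)

lemma is_letter_flip: "is_letter Q I (flip l) \<longleftrightarrow> is_letter Q I l"
  by (simp add: is_letter_iff)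

lemma letter_map_closed:
  assumes "\<And>l. x = Some l \<Longrightarrow> is_letter Q I l"
  shows "right_map c x \<in> carrier \<Lambda>" "left_map c x \<in> carrier \<Lambda>"
  using assms by (cases x; cases "the x"; simp add: is_letter_iff cls_closed)+

lemma consecutive_map_zero:
  assumes "is_letter Q I l" "is_letter Q I l'" "consecutive Q I l l'" "rvertex Q l = lvertex Q l'"
  shows "right_map c (Some l) \<cdot> right_map c' (Some l') = \<zero>\<^sub>\<Lambda>"
    "left_map c' (Some l') \<cdot> left_map c (Some l) = \<zero>\<^sub>\<Lambda>"
  using assms by (cases l; cases l'; simp add: is_letter_iff cls_closed cls_mult_zero)+

lemma left_end_valid:
  assumes "left_end x y (Some g)" "\<And>l. x = Some l \<Longrightarrow> is_letter Q I l" "\<And>l. y = Some l \<Longrightarrow> is_letter Q I l"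
  shows "valid g"
  using assms(1)
proof cases
  case (1 p q)
  then have "valid (q @ g)" "q \<noteq> []" using assms(2)[of "Direct p"] assms(3)[of "Direct q"]
    by (auto simp: is_letter_iff valid_def)
  then show ?thesis using 1 by (simp add: valid_append_iff)
next
  case (2 q p)
  then have "valid (g @ p)" "p \<noteq> []" using assms(2)[of "Inverse p"] assms(3)[of "Inverse q"]
    by (auto simp: is_letter_iff valid_def)
  then show ?thesis using 2 by (simp add: valid_append_iff)
qed

end

locale gentle_quiver = quiver_with_ideal Q I
  for Q :: "('v, 'a) pre_digraph" and I :: "(('v, 'a) qpath \<Rightarrow> 'k::field) set" +
  assumes nonzero_after: "\<lbrakk>b \<in> arcs Q; c \<in> arcs Q; c' \<in> arcs Q; tail Q c = head Q b; tail Q c' = head Q b;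
      \<not> in_ideal Q I [b, c]; \<not> in_ideal Q I [b, c']\<rbrakk> \<Longrightarrow> c = c'"
    and nonzero_before: "\<lbrakk>b \<in> arcs Q; a \<in> arcs Q; a' \<in> arcs Q; head Q a = tail Q b; head Q a' = tail Q b;
      \<not> in_ideal Q I [a, b]; \<not> in_ideal Q I [a', b]\<rbrakk> \<Longrightarrow> a = a'"
    and zero_after: "\<lbrakk>b \<in> arcs Q; c \<in> arcs Q; c' \<in> arcs Q; tail Q c = head Q b; tail Q c' = head Q b;
      in_ideal Q I [b, c]; in_ideal Q I [b, c']\<rbrakk> \<Longrightarrow> c = c'"
begin

text \<open>Otherwise the whole letter would lie in \<open>I\<close>.\<close>

lemma junction_not_in_ideal:
  assumes "is_letter Q I l" "lpath l = p @ q" "p \<noteq> []" "q \<noteq> []"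
  shows "\<not> in_ideal Q I [last p, hd q]"
  using in_ideal_append[of p q 1] assms by (auto simp: is_letter_iff)

text \<open>The commuting squares of a graph map at the left end of the overlap. Here \<open>x\<close> and \<open>y\<close> are the
letters of the source and of the target next to the overlap, \<open>x2\<close> and \<open>y2\<close> the letters to the left of
those, \<open>v\<close> the first vertex of the overlap, and \<open>f\<close> the end map, a path between the left vertices of
\<open>x\<close> and \<open>y\<close>. The square of \<open>x\<close> and \<open>y\<close> commutes because one of the two paths is the other one
composed with \<open>f\<close>. In the square of \<open>x2\<close> and \<open>y2\<close> the map opposite to \<open>f\<close> is zero, so both
products with \<open>f\<close> have to vanish. Let \<open>f\<close> be the left part of \<open>x\<close>, say. Then its product with
\<open>x2\<close> vanishes because that of \<open>x\<close> with \<open>x2\<close> does. At its other end, where \<open>y2\<close> begins, \<open>f\<close> continues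
inside \<open>x\<close> with a nonzero product and with an arrow different from that of \<open>y2\<close>, so that gentleness makes
the product of \<open>f\<close> with \<open>y2\<close> zero. If \<open>f\<close> is a part of \<open>y\<close>, the two words change roles.\<close>

lemma left_end_squares:
  assumes ends: "left_end x (Some y) f"
    and x: "\<And>l. x = Some l \<Longrightarrow> is_letter Q I l \<and> rvertex Q l = v"
    and y: "is_letter Q I y" "rvertex Q y = v"
    and x2_letter: "\<And>l2. x2 = Some l2 \<Longrightarrow> is_letter Q I l2"
    and x2: "\<And>l l2. x = Some l \<Longrightarrow> x2 = Some l2 \<Longrightarrow> rvertex Q l2 = lvertex Q l \<and> consecutive Q I l2 l"
    and y2: "is_letter Q I y2" "rvertex Q y2 = lvertex Q y" "consecutive Q I y2 y"
    and sc: "is_direct y \<Longrightarrow> c1 = c0 * s" "\<not> is_direct y \<Longrightarrow> c0 = c1 * s"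
  shows "right_map 1 x \<cdot> idm c1 v = end_map c0 f \<cdot> right_map s (Some y)" (is ?A)
    and "left_map 1 x \<cdot> end_map c0 f = idm c1 v \<cdot> left_map s (Some y)" (is ?B)
    and "right_map 1 x2 \<cdot> end_map c0 f = \<zero>\<^sub>\<Lambda>" (is ?C)
    and "end_map c0 f \<cdot> left_map s2 (Some y2) = \<zero>\<^sub>\<Lambda>" (is ?D)
    and "end_map c0 f \<in> proj Q I (lvertex Q y)" (is ?E)
    and "end_map c0 f \<noteq> \<zero>\<^sub>\<Lambda> \<Longrightarrow> \<exists>l. x = Some l \<and> is_direct l = is_direct y" (is "?nonzero \<Longrightarrow> ?letter")
proof -
  have v: "v \<in> verts Q" and lv: "lvertex Q y \<in> verts Q"
    using y valid_ends(3,4)[of "lpath y"] by (cases y; simp add: is_letter_iff; metis)+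
  have c2: "right_map 1 x2 \<in> carrier \<Lambda>" using x2_letter by (intro letter_map_closed) auto
  have cy2: "left_map s2 (Some y2) \<in> carrier \<Lambda>" using y2 by (intro letter_map_closed) auto
  have "?A \<and> ?B \<and> ?C \<and> ?D \<and> ?E \<and> (?nonzero \<longrightarrow> ?letter)"
    using ends
  proof cases
    case (1 g p q)
    then have [simp]: "x = Some (Direct (q @ g))" "y = Direct q" "f = Some g" "g \<noteq> []" by auto
    have "q \<noteq> []" using y by (simp add: is_letter_iff valid_def)
    have val: "valid q" "valid g" "valid (q @ g)" "head Q (last q) = tail Q (hd g)"
      using x y \<open>q \<noteq> []\<close> by (auto simp: is_letter_iff valid_append_iff)
    have vq: "v = tail Q (hd q)" using y by simp
    have sq1: "cls 1 (q @ g) \<cdot> idm c1 v = cls c0 g \<cdot> cls s q"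
      using cls_idm[OF val(3), of 1 c1] cls_mult[OF val(1,2,4), of c0 s] sc(1) vq \<open>q \<noteq> []\<close> by simp
    have z1: "right_map 1 x2 \<cdot> cls c0 g = \<zero>\<^sub>\<Lambda>"
    proof (cases "(1::'k, x2)" rule: right_map.cases)
      case (1 c p')
      then have [simp]: "x2 = Some (Direct p')" by simp
      have "valid p'" "tail Q (hd p') = head Q (last g)" "in_ideal Q I [last g, hd p']"
        using x2[of "Direct (q @ g)" "Direct p'"] x2_letter by (auto simp: is_letter_iff)
      then show ?thesis using val by (simp add: cls_mult_zero)
    qed (use cls_closed[OF val(2)] in auto)
    have z2: "cls c0 g \<cdot> left_map s2 (Some y2) = \<zero>\<^sub>\<Lambda>"
    proof (cases y2)
      case [simp]: (Inverse p')
      have p': "valid p'" "head Q (last p') = head Q (last q)" "last p' \<noteq> last q"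
        using y2 by (auto simp: is_letter_iff)
      have "\<not> in_ideal Q I [last q, hd g]"
        using x[of "Direct (q @ g)"] \<open>q \<noteq> []\<close> by (intro junction_not_in_ideal[of "Direct (q @ g)"]) auto
      then have "in_ideal Q I [last p', hd g]"
        using nonzero_before[of "hd g" "last p'" "last q"] p' val(4)
          valid_ends(1)[OF val(2)] valid_ends(2)[OF p'(1)] valid_ends(2)[OF val(1)] by metis
      then show ?thesis using p' val by (simp add: cls_mult_zero)
    qed (use cls_closed[OF val(2)] in auto)
    have pr: "cls c0 g \<in> proj Q I (lvertex Q y)" using cls_proj[OF val(2)] val(4) by simp
    show ?thesis using sq1 z1 z2 pr cls_closed[OF val(2)] idm_closed[OF v] by auto
  next
    case (2 g q p)
    then have [simp]: "x = Some (Inverse p)" "y = Inverse (g @ p)" "f = Some g" "g \<noteq> []" by auto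
    have "p \<noteq> []" using x by (simp add: is_letter_iff valid_def)
    have val: "valid g" "valid p" "valid (g @ p)" "head Q (last g) = tail Q (hd p)"
      using x y \<open>p \<noteq> []\<close> by (auto simp: is_letter_iff valid_append_iff)
    have vq: "v = head Q (last p)" using y \<open>p \<noteq> []\<close> by simp
    have sq: "cls 1 p \<cdot> cls c0 g = idm c1 v \<cdot> cls s (g @ p)"
      using idm_cls[OF val(3), of c1 s] cls_mult[OF val(1,2,4), of 1 c0] sc(2) vq \<open>p \<noteq> []\<close> by simp
    have z1: "right_map 1 x2 \<cdot> cls c0 g = \<zero>\<^sub>\<Lambda>"
    proof (cases "(1::'k, x2)" rule: right_map.cases)
      case (1 c p')
      then have [simp]: "x2 = Some (Direct p')" by simp
      have p': "valid p'" "tail Q (hd p') = tail Q (hd p)" "hd p' \<noteq> hd p"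
        using x2[of "Inverse p" "Direct p'"] x2_letter by (auto simp: is_letter_iff)
      have "\<not> in_ideal Q I [last g, hd p]"
        using y \<open>p \<noteq> []\<close> by (intro junction_not_in_ideal[of "Inverse (g @ p)"]) auto
      then have "in_ideal Q I [last g, hd p']"
        using nonzero_after[of "last g" "hd p'" "hd p"] p' val(4)
          valid_ends(2)[OF val(1)] valid_ends(1)[OF p'(1)] valid_ends(1)[OF val(2)] by metis
      then show ?thesis using p' val by (simp add: cls_mult_zero)
    qed (use cls_closed[OF val(1)] in auto)
    have z2: "cls c0 g \<cdot> left_map s2 (Some y2) = \<zero>\<^sub>\<Lambda>"
    proof (cases y2)
      case [simp]: (Inverse p')
      have "valid p'" "head Q (last p') = tail Q (hd g)" "in_ideal Q I [last p', hd g]"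
        using y2 by (auto simp: is_letter_iff)
      then show ?thesis using val by (simp add: cls_mult_zero)
    qed (use cls_closed[OF val(1)] in auto)
    have pr: "cls c0 g \<in> proj Q I (lvertex Q y)" using cls_proj[OF val(1)] by simp
    show ?thesis using sq z1 z2 pr cls_closed[OF val(1)] idm_closed[OF v] by auto
  next
    case 3
    obtain q where [simp]: "y = Direct q" using 3 by (cases y) auto
    have r0: "right_map 1 x = \<zero>\<^sub>\<Lambda>" using 3 by (cases "(1::'k, x)" rule: right_map.cases) auto
    have lc: "left_map 1 x \<in> carrier \<Lambda>" using x by (intro letter_map_closed(2)) simp
    have rc: "right_map s (Some y) \<in> carrier \<Lambda>"
      using y by (intro letter_map_closed(1)) simp
    have l0: "left_map s (Some y) = \<zero>\<^sub>\<Lambda>" by simp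
    show ?thesis
      unfolding r0 l0 \<open>f = None\<close> option.case
      using lc rc c2 cy2 idm_closed[OF v] proj_closed(1)[OF lv] by simp
  qed
  then show ?A and ?B and ?C and ?D and ?E and "?nonzero \<Longrightarrow> ?letter"
    by blast+
qed

text \<open>If the overlap is a full period of the band and that period is deleted, the letters \<open>x\<close> and \<open>x'\<close> of
the string to the left and to the right of the overlap meet at the vertex \<open>v\<close>. The band has the letters
\<open>y\<close> and \<open>y'\<close> around \<open>v\<close>, and the string passes through \<open>x y'\<close> at the first and through \<open>y x'\<close> at the
last vertex of the overlap. If \<open>f\<close> is a path, \<open>x\<close> and \<open>y\<close> have the same arrow at \<open>v\<close>, and the claim is that
\<open>y x'\<close> is admissible; similarly for \<open>f'\<close>. If both are empty, \<open>x\<close> is inverse and \<open>x'\<close> direct, and a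
common last arrow of theirs would have zero product with the first arrows of \<open>y\<close> and of \<open>y'\<close>, which
differ; this is impossible in a gentle algebra.\<close>

lemma ends_consecutive:
  assumes "left_end (Some x) (Some y) f" "right_end (Some x') (Some y') f'"
    and lets: "is_letter Q I x" "is_letter Q I x'" "is_letter Q I y" "is_letter Q I y'"
    and "rvertex Q x = v" "rvertex Q y = v" "lvertex Q x' = v" "lvertex Q y' = v"
    and con: "consecutive Q I x y'" "consecutive Q I y x'" "consecutive Q I y y'"
  shows "consecutive Q I x x'"
proof -
  have ne: "lpath x \<noteq> []" "lpath x' \<noteq> []" "lpath y \<noteq> []" "lpath y' \<noteq> []"
    using lets by (auto simp: is_letter_iff valid_def)
  have ends: "right_end (Some x') (Some y') f'" by (rule assms(2))
  show ?thesis using assms(1)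
  proof cases
    case (1 g p q)
    with ends con ne show ?thesis by (auto elim!: right_end.cases)
      (cases x'; cases y'; simp)+
  next
    case (2 g q p)
    with ends con ne show ?thesis by (auto elim!: right_end.cases)
      (cases x'; cases y'; simp)+
  next
    case 3
    then obtain p q where L: "x = Inverse p" "y = Direct q" by (cases x; cases y) auto
    have "consecutive Q I (Inverse p) x'" if "f' = None"
    proof -
      have "(\<forall>p. Some x' \<noteq> Some (Inverse p)) \<and> (\<forall>q. Some y' \<noteq> Some (Direct q))"
        using ends that by (auto elim: right_end.cases)
      then obtain p' q' where R: "x' = Direct p'" "y' = Inverse q'" by (cases x'; cases y') auto
      have "last p \<noteq> last p'"
      proof
        assume eq: "last p = last p'"
        have "in_ideal Q I [last p, hd q]" "in_ideal Q I [last p, hd q']" "hd q \<noteq> hd q'"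
          using con L R eq by auto
        moreover have "tail Q (hd q) = head Q (last p)" "tail Q (hd q') = head Q (last p)"
          using assms L R by auto
        moreover have "last p \<in> arcs Q" "hd q \<in> arcs Q" "hd q' \<in> arcs Q"
          using lets L R valid_ends(1,2)[of p] valid_ends(1,2)[of q] valid_ends(1,2)[of q'] by (simp_all add: is_letter_iff)
        ultimately show False using zero_after by blast
      qed
      then show ?thesis using R by simp
    qed
    then show ?thesis using ends con ne L by (auto elim!: right_end.cases)
  qed
qed

end

lemma gentle_imp_gentle_quiver:
  assumes "gentle Q I" shows "gentle_quiver Q I"
proof -
  have fin: "fin_digraph Q" using assms by (simp add: gentle_def)
  interpret fin_digraph Q by fact
  obtain R where R: "\<forall>p\<in>R. length p = 2 \<and> is_path Q (arc_path Q p)"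
    "I = genideal (path_algebra Q) ((\<lambda>p. path_term 1 (arc_path Q p)) ` R)"
    using assms by (auto simp: gentle_def)
  have "ideal I (path_algebra Q)"
    unfolding R(2) using R(1) path_term_closed by (intro ring.genideal_ideal ring_path_algebra fin) blast
  then have 1: "quiver_with_ideal Q I" using fin by (intro quiver_with_ideal.intro)
  have unique: "x = y" if "card {x \<in> arcs Q. P x} \<le> 1" "x \<in> arcs Q" "P x" "y \<in> arcs Q" "P y" for P x y
  proof -
    have "finite {x \<in> arcs Q. P x}" by simp
    then show ?thesis using that card_le_Suc0_iff_eq[of "{x \<in> arcs Q. P x}"] by auto
  qed
  have cards: "card {a \<in> arcs Q. head Q a = tail Q b \<and> \<not> in_ideal Q I [a, b]} \<le> 1"
    "card {c \<in> arcs Q. tail Q c = head Q b \<and> \<not> in_ideal Q I [b, c]} \<le> 1"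
    "card {c \<in> arcs Q. tail Q c = head Q b \<and> in_ideal Q I [b, c]} \<le> 1" if "b \<in> arcs Q" for b
    using assms that unfolding gentle_def by blast+
  show ?thesis
    using 1
  proof (rule gentle_quiver.intro)
    show "gentle_quiver_axioms Q I"
    proof (rule gentle_quiver_axioms.intro)
      fix b c c' assume b: "b \<in> arcs Q" and c: "c \<in> arcs Q" "c' \<in> arcs Q" "tail Q c = head Q b" "tail Q c' = head Q b"
      show "c = c'" if "\<not> in_ideal Q I [b, c]" "\<not> in_ideal Q I [b, c']"
        by (rule unique[OF cards(2)[OF b]]) (use c that in auto)
    next
      fix b a a' assume b: "b \<in> arcs Q" and a: "a \<in> arcs Q" "a' \<in> arcs Q" "head Q a = tail Q b" "head Q a' = tail Q b"
      show "a = a'" if "\<not> in_ideal Q I [a, b]" "\<not> in_ideal Q I [a', b]"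
        by (rule unique[OF cards(1)[OF b]]) (use a that in auto)
    next
      fix b c c' assume b: "b \<in> arcs Q" and c: "c \<in> arcs Q" "c' \<in> arcs Q" "tail Q c = head Q b" "tail Q c' = head Q b"
      show "c = c'" if "in_ideal Q I [b, c]" "in_ideal Q I [b, c']"
        by (rule unique[OF cards(3)[OF b]]) (use c that in auto)
    qed
  qed
qed

section \<open>Words as complexes on the line\<close>

definition edge_at :: "('v, 'a) word \<Rightarrow> int \<Rightarrow> 'a hletter option" where
  "edge_at w i = (if i \<in> edges w then Some (ltr w i) else None)"

lemma letter_left_edge_at: "letter_left w a = edge_at w (a - 1)"
  by (simp add: letter_left_def edge_at_def)

lemma letter_right_edge_at: "letter_right w b = edge_at w b"
  by (simp add: letter_right_def edge_at_def)

context quiver_with_ideal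
begin

text \<open>The conditions on a homotopy string that involve only neighbouring letters. The unfolding of a band
satisfies them without being a homotopy string.\<close>

definition local_string :: "('v, 'a) word \<Rightarrow> bool" where
  "local_string w \<longleftrightarrow>
     pos w \<noteq> {} \<and> (\<forall>i\<in>pos w. \<forall>j\<in>pos w. {i..j} \<subseteq> pos w) \<and> (\<forall>i\<in>pos w. vtx w i \<in> verts Q) \<and>
     (\<forall>i\<in>edges w. is_letter Q I (ltr w i) \<and>
        lvertex Q (ltr w i) = vtx w i \<and> rvertex Q (ltr w i) = vtx w (i + 1)) \<and>
     (\<forall>i\<in>edges w. i + 1 \<in> edges w \<longrightarrow> consecutive Q I (ltr w i) (ltr w (i + 1)))"

lemma local_stringD:
  assumes "local_string w"
  shows "pos w \<noteq> {}" "i \<in> pos w \<Longrightarrow> j \<in> pos w \<Longrightarrow> i \<le> k \<Longrightarrow> k \<le> j \<Longrightarrow> k \<in> pos w"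
    "i \<in> pos w \<Longrightarrow> vtx w i \<in> verts Q"
    "i \<in> edges w \<Longrightarrow> is_letter Q I (ltr w i)" "i \<in> edges w \<Longrightarrow> lvertex Q (ltr w i) = vtx w i"
    "i \<in> edges w \<Longrightarrow> rvertex Q (ltr w i) = vtx w (i + 1)"
    "i \<in> edges w \<Longrightarrow> i + 1 \<in> edges w \<Longrightarrow> consecutive Q I (ltr w i) (ltr w (i + 1))"
proof -
  show "pos w \<noteq> {}" using assms by (simp add: local_string_def)
  show "k \<in> pos w" if "i \<in> pos w" "j \<in> pos w" "i \<le> k" "k \<le> j"
    using assms that unfolding local_string_def by (meson atLeastAtMost_iff subsetD)
qed (use assms in \<open>simp_all add: local_string_def\<close>)

lemma edge_at_letter:
  assumes "local_string w" "edge_at w i = Some l"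
  shows "i \<in> edges w" "l = ltr w i" "is_letter Q I l" "lvertex Q l = vtx w i" "rvertex Q l = vtx w (i + 1)"
proof -
  show i: "i \<in> edges w" and l: "l = ltr w i" using assms(2) by (auto simp: edge_at_def split: if_splits)
  show "is_letter Q I l" "lvertex Q l = vtx w i" "rvertex Q l = vtx w (i + 1)"
    unfolding l using local_stringD(4-6)[OF assms(1) i] .
qed

lemma edge_at_consecutive:
  assumes "local_string w" "edge_at w i = Some l" "edge_at w (i + 1) = Some l'"
  shows "consecutive Q I l l'"
  using local_stringD(7)[OF assms(1) edge_at_letter(1)[OF assms(1,2)] edge_at_letter(1)[OF assms(1,3)]]
    edge_at_letter(2)[OF assms(1,2)] edge_at_letter(2)[OF assms(1,3)] by simp

text \<open>The summands of the differential between the positions \<open>i\<close> and \<open>i + 1\<close> in either direction; at most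
one of them is nonzero. The letter \<open>i\<close> carries the scalar \<open>c i\<close>.\<close>

definition rarrow :: "('v, 'a) word \<Rightarrow> (int \<Rightarrow> 'k) \<Rightarrow> int \<Rightarrow> (('v, 'a) qpath \<Rightarrow> 'k) set" where
  "rarrow w c i = right_map (c i) (edge_at w i)"

definition larrow :: "('v, 'a) word \<Rightarrow> (int \<Rightarrow> 'k) \<Rightarrow> int \<Rightarrow> (('v, 'a) qpath \<Rightarrow> 'k) set" where
  "larrow w c i = left_map (c i) (edge_at w i)"

text \<open>The differential of the complex of a word, as an operator on all functions on the integers. It does
not depend on a grading, and every position receives contributions from its two neighbours only.\<close>

definition line_diff :: "('v, 'a) word \<Rightarrow> (int \<Rightarrow> 'k) \<Rightarrow> (int \<Rightarrow> (('v, 'a) qpath \<Rightarrow> 'k) set)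
    \<Rightarrow> int \<Rightarrow> (('v, 'a) qpath \<Rightarrow> 'k) set" where
  "line_diff w c u = (\<lambda>p. u (p - 1) \<cdot> rarrow w c (p - 1) \<oplus>\<^bsub>\<Lambda>\<^esub> u (p + 1) \<cdot> larrow w c p)"

lemma arrows_eq:
  "rarrow w c i = (if i \<in> edges w \<and> is_direct (ltr w i) then cls (c i) (lpath (ltr w i)) else \<zero>\<^sub>\<Lambda>)"
  "larrow w c i = (if i \<in> edges w \<and> \<not> is_direct (ltr w i) then cls (c i) (lpath (ltr w i)) else \<zero>\<^sub>\<Lambda>)"
  by (cases "ltr w i"; simp add: rarrow_def larrow_def edge_at_def)+

lemma arrows_closed:
  assumes "local_string w" shows "rarrow w c i \<in> carrier \<Lambda>" "larrow w c i \<in> carrier \<Lambda>"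
  using local_stringD(4)[OF assms, of i] by (simp_all add: arrows_eq is_letter_iff cls_closed)

lemma arrows_proj:
  assumes "local_string w"
  shows "i \<in> edges w \<Longrightarrow> rarrow w c i \<in> proj Q I (vtx w (i + 1))" "i \<in> edges w \<Longrightarrow> larrow w c i \<in> proj Q I (vtx w i)"
proof -
  assume i: "i \<in> edges w"
  then have ip: "i \<in> pos w" "i + 1 \<in> pos w" by (auto simp: edges_def)
  note v = local_stringD(3)[OF assms ip(1)] local_stringD(3)[OF assms ip(2)]
  note l = local_stringD(4-6)[OF assms i]
  show "rarrow w c i \<in> proj Q I (vtx w (i + 1))"
    using l v proj_closed(1)[OF v(2)] cls_proj[of "lpath (ltr w i)" "c i"]
    by (cases "ltr w i") (auto simp: arrows_eq is_letter_iff)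
  show "larrow w c i \<in> proj Q I (vtx w i)"
    using l v proj_closed(1)[OF v(1)] cls_proj[of "lpath (ltr w i)" "c i"]
    by (cases "ltr w i") (auto simp: arrows_eq is_letter_iff)
qed

lemma arrows_mult_zero:
  assumes "local_string w"
  shows "rarrow w c i \<cdot> rarrow w c (i + 1) = \<zero>\<^sub>\<Lambda>" "larrow w c (i + 1) \<cdot> larrow w c i = \<zero>\<^sub>\<Lambda>"
    "rarrow w c i \<cdot> larrow w c i = \<zero>\<^sub>\<Lambda>" "larrow w c i \<cdot> rarrow w c i = \<zero>\<^sub>\<Lambda>"
proof -
  note cl = arrows_closed[OF assms]
  show "rarrow w c i \<cdot> larrow w c i = \<zero>\<^sub>\<Lambda>" "larrow w c i \<cdot> rarrow w c i = \<zero>\<^sub>\<Lambda>"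
    using cl[of c i] by (auto simp: arrows_eq)
  show "rarrow w c i \<cdot> rarrow w c (i + 1) = \<zero>\<^sub>\<Lambda>" "larrow w c (i + 1) \<cdot> larrow w c i = \<zero>\<^sub>\<Lambda>"
  proof -
    consider "i \<in> edges w" "i + 1 \<in> edges w" | "i \<notin> edges w" | "i + 1 \<notin> edges w" by blast
    then have "rarrow w c i \<cdot> rarrow w c (i + 1) = \<zero>\<^sub>\<Lambda> \<and> larrow w c (i + 1) \<cdot> larrow w c i = \<zero>\<^sub>\<Lambda>"
    proof cases
      case 1
      then show ?thesis
        using consecutive_map_zero[where l = "ltr w i" and l' = "ltr w (i + 1)" and c = "c i" and c' = "c (i + 1)"]
          local_stringD(4-7)[OF assms 1(1)] local_stringD(4,5)[OF assms 1(2)]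
        by (simp add: rarrow_def larrow_def edge_at_def)
    next
      case 2
      then show ?thesis using cl[of c "i + 1"] by (simp add: rarrow_def larrow_def edge_at_def)
    next
      case 3
      then show ?thesis using cl[of c i] by (simp add: rarrow_def larrow_def edge_at_def)
    qed
    then show "rarrow w c i \<cdot> rarrow w c (i + 1) = \<zero>\<^sub>\<Lambda>" "larrow w c (i + 1) \<cdot> larrow w c i = \<zero>\<^sub>\<Lambda>" by auto
  qed
qed

lemma line_diff_closed:
  assumes "local_string w" "\<And>p. u p \<in> carrier \<Lambda>" shows "line_diff w c u p \<in> carrier \<Lambda>"
  using assms arrows_closed[OF assms(1)] by (simp add: line_diff_def)

text \<open>A position two steps away would contribute the product of two consecutive letters with the same
direction, which is zero; returning to the same position would use a letter in both directions.\<close>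

lemma line_diff_line_diff:
  assumes w: "local_string w" and u: "\<And>p. u p \<in> carrier \<Lambda>"
  shows "line_diff w c (line_diff w c u) = (\<lambda>_. \<zero>\<^sub>\<Lambda>)"
proof
  fix p
  note cl = arrows_closed[OF w, of c]
  have 1: "line_diff w c u (p - 1) \<cdot> rarrow w c (p - 1) = \<zero>\<^sub>\<Lambda>"
    using u cl arrows_mult_zero(1)[OF w, of c "p - 1 - 1"] arrows_mult_zero(4)[OF w, of c "p - 1"]
    by (simp add: line_diff_def \<Lambda>.l_distr \<Lambda>.m_assoc)
  have 2: "line_diff w c u (p + 1) \<cdot> larrow w c p = \<zero>\<^sub>\<Lambda>"
    using u cl arrows_mult_zero(2,3)[OF w, of c p]
    by (simp add: line_diff_def \<Lambda>.l_distr \<Lambda>.m_assoc)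
  show "line_diff w c (line_diff w c u) p = \<zero>\<^sub>\<Lambda>"
    by (subst line_diff_def) (simp add: 1 2)
qed

lemma finsum_two:
  assumes "finite S" "S \<subseteq> {i, j}" "i \<noteq> j" "x \<in> carrier \<Lambda>" "y \<in> carrier \<Lambda>"
    "i \<in> S \<Longrightarrow> g i = x" "i \<notin> S \<Longrightarrow> x = \<zero>\<^sub>\<Lambda>" "j \<in> S \<Longrightarrow> g j = y" "j \<notin> S \<Longrightarrow> y = \<zero>\<^sub>\<Lambda>"
  shows "finsum \<Lambda> g S = x \<oplus>\<^bsub>\<Lambda>\<^esub> y"
proof -
  let ?h = "\<lambda>k. if k = i then x else y"
  have "finsum \<Lambda> g S = finsum \<Lambda> ?h {i, j}"
    using assms by (intro \<Lambda>.add.finprod_mono_neutral_cong_left) auto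
  also have "\<dots> = ?h i \<oplus>\<^bsub>\<Lambda>\<^esub> finsum \<Lambda> ?h {j}"
    using assms by (intro \<Lambda>.finsum_insert) auto
  also have "finsum \<Lambda> ?h {j} = y"
    using assms \<Lambda>.finsum_insert[of "{}" j ?h] by simp
  finally show ?thesis by simp
qed

lemma string_diff_eq:
  assumes w: "local_string w" and u: "\<And>p. u p \<in> carrier \<Lambda>"
  shows "diff (string_complex Q I w d) n u = line_diff w (\<lambda>_. 1) u"
proof
  fix p
  note cl = arrows_closed[OF w, of "\<lambda>_. 1"]
  let ?src = "\<lambda>k. if is_direct (ltr w k) then k else k + 1"
  let ?tgt = "\<lambda>k. if is_direct (ltr w k) then k + 1 else k"
  let ?S = "{k \<in> edges w. ?tgt k = p}"
  have S: "?S \<subseteq> {p - 1, p}" by auto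
  have "diff (string_complex Q I w d) n u p = finsum \<Lambda> (\<lambda>k. u (?src k) \<cdot> cls 1 (lpath (ltr w k))) ?S"
    by (simp add: string_complex_def diagram_complex_def)
  also have "\<dots> = u (p - 1) \<cdot> rarrow w (\<lambda>_. 1) (p - 1) \<oplus>\<^bsub>\<Lambda>\<^esub> u (p + 1) \<cdot> larrow w (\<lambda>_. 1) p"
    using u cl S by (intro finsum_two[where i = "p - 1" and j = p] finite_subset[OF S]) (auto simp: arrows_eq)
  finally show "diff (string_complex Q I w d) n u p = line_diff w (\<lambda>_. 1) u p"
    by (simp add: line_diff_def)
qed

lemma diagram_obj: "u \<in> obj (diagram_complex Q I V x d E src tgt a) n \<longleftrightarrow>
    (\<forall>i. if i \<in> V \<and> d i = n then u i \<in> proj Q I (x i) else u i = \<zero>\<^sub>\<Lambda>)"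
  by (simp add: diagram_complex_def)

lemma diagram_fun_module:
  assumes "\<And>i. i \<in> V \<Longrightarrow> x i \<in> verts Q"
  shows "fun_module \<Lambda> (obj (diagram_complex Q I V x d E src tgt a) n)"
  unfolding fun_module_def
proof (intro conjI ballI subsetI)
  fix u assume u: "u \<in> obj (diagram_complex Q I V x d E src tgt a) n"
  then have "u i \<in> carrier \<Lambda>" for i
    using assms proj_carrier[of "u i" "x i"] unfolding diagram_obj by (cases "i \<in> V \<and> d i = n") auto
  then show "u \<in> {u. \<forall>i. u i \<in> carrier \<Lambda>}" by simp
  { fix v assume "v \<in> obj (diagram_complex Q I V x d E src tgt a) n"
    with u show "(\<lambda>i. u i \<oplus>\<^bsub>\<Lambda>\<^esub> v i) \<in> obj (diagram_complex Q I V x d E src tgt a) n"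
      using assms unfolding diagram_obj by (simp add: proj_closed(2)) }
next
  fix r u assume "r \<in> carrier \<Lambda>" "u \<in> obj (diagram_complex Q I V x d E src tgt a) n"
  then show "(\<lambda>i. r \<cdot> u i) \<in> obj (diagram_complex Q I V x d E src tgt a) n"
    using assms unfolding diagram_obj by (simp add: proj_closed(4))
qed (use assms in \<open>simp add: diagram_obj proj_closed(1)\<close>)

lemma string_obj: "u \<in> obj (string_complex Q I w d) n \<longleftrightarrow>
    (\<forall>i. if i \<in> pos w \<and> d i = n then u i \<in> proj Q I (vtx w i) else u i = \<zero>\<^sub>\<Lambda>)"
  unfolding string_complex_def diagram_obj ..

lemma string_fun_module: "local_string w \<Longrightarrow> fun_module \<Lambda> (obj (string_complex Q I w d) n)"
  unfolding string_complex_def by (intro diagram_fun_module) (rule local_stringD)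

lemma string_obj_closed: "local_string w \<Longrightarrow> u \<in> obj (string_complex Q I w d) n \<Longrightarrow> u p \<in> carrier \<Lambda>"
  using \<Lambda>.fun_moduleD(1)[OF string_fun_module] .

lemma line_diff_obj:
  assumes w: "local_string w" and d: "grading w d" and u: "u \<in> obj (string_complex Q I w d) n"
  shows "line_diff w c u \<in> obj (string_complex Q I w d) (n + 1)"
  unfolding string_obj
proof
  fix p
  note cl = arrows_closed[OF w, of c] and uc = string_obj_closed[OF w u]
  note u' = u[unfolded string_obj, rule_format]
  have z1: "u (p - 1) \<cdot> rarrow w c (p - 1) = \<zero>\<^sub>\<Lambda>" if "\<not> (p - 1 \<in> edges w \<and> d p = n + 1)"
  proof (cases "p - 1 \<in> edges w \<and> is_direct (ltr w (p - 1))")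
    case True
    then have "d p = d (p - 1) + 1" using d by (force simp: grading_def)
    with that True have "u (p - 1) = \<zero>\<^sub>\<Lambda>" using u'[of "p - 1"] by (auto split: if_splits)
    then show ?thesis using cl by simp
  qed (use uc in \<open>auto simp: arrows_eq\<close>)
  have z2: "u (p + 1) \<cdot> larrow w c p = \<zero>\<^sub>\<Lambda>" if "\<not> (p \<in> edges w \<and> d p = n + 1)"
  proof (cases "p \<in> edges w \<and> \<not> is_direct (ltr w p)")
    case True
    then have "d (p + 1) = d p - 1" using d by (force simp: grading_def)
    with that True have "u (p + 1) = \<zero>\<^sub>\<Lambda>" using u'[of "p + 1"] by (auto split: if_splits)
    then show ?thesis using cl by simp
  qed (use uc in \<open>auto simp: arrows_eq\<close>)
  show "if p \<in> pos w \<and> d p = n + 1 then line_diff w c u p \<in> proj Q I (vtx w p)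
        else line_diff w c u p = \<zero>\<^sub>\<Lambda>"
  proof (cases "p \<in> pos w \<and> d p = n + 1")
    case True
    then have v: "vtx w p \<in> verts Q" using local_stringD(3)[OF w] by auto
    have "u (p - 1) \<cdot> rarrow w c (p - 1) \<in> proj Q I (vtx w p)"
    proof (cases "p - 1 \<in> edges w")
      case True
      then show ?thesis using arrows_proj(1)[OF w True, of c] proj_closed(4)[OF v uc] by simp
    qed (use z1 proj_closed(1)[OF v] in simp)
    moreover have "u (p + 1) \<cdot> larrow w c p \<in> proj Q I (vtx w p)"
    proof (cases "p \<in> edges w")
      case True
      then show ?thesis using arrows_proj(2)[OF w True, of c] proj_closed(4)[OF v uc] by simp
    qed (use z2 proj_closed(1)[OF v] in simp)
    ultimately show ?thesis using True proj_closed(2)[OF v] by (simp add: line_diff_def)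
  next
    case False
    have "p \<in> pos w" if "p - 1 \<in> edges w \<or> p \<in> edges w" using that by (auto simp: edges_def)
    then have "\<not> (p - 1 \<in> edges w \<and> d p = n + 1)" "\<not> (p \<in> edges w \<and> d p = n + 1)" using False by auto
    then have "line_diff w c u p = \<zero>\<^sub>\<Lambda>" using z1 z2 by (simp add: line_diff_def)
    then show ?thesis unfolding if_not_P[OF False] .
  qed
qed

text \<open>A diagonal map is a chain map if its squares with the letters of both words commute.\<close>

lemma line_diff_diagonal:
  assumes w: "local_string w" "local_string U" and \<kappa>: "\<And>p. \<kappa> p \<in> carrier \<Lambda>" and u: "\<And>p. u p \<in> carrier \<Lambda>"
    and sq: "\<And>p. rarrow w c p \<cdot> \<kappa> (p + 1) = \<kappa> p \<cdot> rarrow U c' p"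
      "\<And>p. larrow w c p \<cdot> \<kappa> p = \<kappa> (p + 1) \<cdot> larrow U c' p"
  shows "line_diff U c' (\<lambda>p. u p \<cdot> \<kappa> p) p = line_diff w c u p \<cdot> \<kappa> p"
  using sq(1)[of "p - 1"] sq(2)[of p] u \<kappa> arrows_closed[OF w(1)] arrows_closed[OF w(2)]
  by (simp add: line_diff_def \<Lambda>.l_distr \<Lambda>.m_assoc)

lemma line_diff_scalar:
  assumes "local_string w" "\<And>p. u p \<in> carrier \<Lambda>"
  shows "line_diff w c (\<lambda>p. u p \<cdot> scalar s) p = line_diff w c u p \<cdot> scalar s"
proof -
  note cl = arrows_closed[OF assms(1), of c]
  have "u q \<cdot> scalar s \<cdot> r = u q \<cdot> r \<cdot> scalar s" if "r \<in> carrier \<Lambda>" for q r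
    using assms(2)[of q] that scalar_closed[of s] scalar_comm[OF that, of s] by (simp add: \<Lambda>.m_assoc)
  then show ?thesis using assms(2) cl scalar_closed by (simp add: line_diff_def \<Lambda>.l_distr)
qed

lemma line_diff_minus:
  assumes "local_string w" "\<And>p. u p \<in> carrier \<Lambda>" "\<And>p. v p \<in> carrier \<Lambda>"
  shows "line_diff w c (\<lambda>p. u p \<ominus>\<^bsub>\<Lambda>\<^esub> v p) q = line_diff w c u q \<ominus>\<^bsub>\<Lambda>\<^esub> line_diff w c v q"
  using assms(2,3) arrows_closed[OF assms(1), of c]
  by (simp add: line_diff_def \<Lambda>.minus_eq \<Lambda>.l_distr \<Lambda>.l_minus \<Lambda>.minus_add \<Lambda>.a_ac)

lemma line_diff_uminus:
  assumes "local_string w" "\<And>p. u p \<in> carrier \<Lambda>"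
  shows "line_diff w c (\<lambda>p. \<ominus>\<^bsub>\<Lambda>\<^esub> u p) q = \<ominus>\<^bsub>\<Lambda>\<^esub> line_diff w c u q"
  using assms(2) arrows_closed[OF assms(1), of c]
  by (simp add: line_diff_def \<Lambda>.l_minus \<Lambda>.minus_add)

lemma line_diff_cong:
  assumes "u (p - 1) = v (p - 1)" "u (p + 1) = v (p + 1)" shows "line_diff w c u p = line_diff w c v p"
  using assms by (simp add: line_diff_def)

lemma homotopy_string_iff: "homotopy_string Q I w \<longleftrightarrow> local_string w \<and>
     (infinite (pos w) \<longrightarrow>
        (\<exists>d. grading w d \<and> (\<forall>n. finite {i \<in> pos w. d i = n}) \<and>
           right_bounded \<Lambda> (string_complex Q I w d) \<and> bounded_cohomology \<Lambda> (string_complex Q I w d)))"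
  unfolding homotopy_string_def local_string_def by blast

lemma gradings_differ_by_constant:
  assumes w: "local_string w" and d: "grading w d" and d': "grading w d'"
  shows "\<exists>k. \<forall>i\<in>pos w. d i = d' i + k"
proof -
  obtain o' where o: "o' \<in> pos w" using local_stringD(1)[OF w] by auto
  have incr: "d (i + 1) - d' (i + 1) = d i - d' i" if "i \<in> pos w" "i + 1 \<in> pos w" for i
  proof -
    have "i \<in> edges w" using that by (simp add: edges_def)
    then show ?thesis using d d' unfolding grading_def by (cases "is_direct (ltr w i)") force+
  qed
  have up: "o' \<le> i \<Longrightarrow> i \<in> pos w \<longrightarrow> d i - d' i = d o' - d' o'" for i
  proof (induction i rule: int_ge_induct)
    case (step i)
    then show ?case using local_stringD(2)[OF w o, of "i + 1" i] incr[of i] by auto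
  qed simp
  have down: "i \<le> o' \<Longrightarrow> i \<in> pos w \<longrightarrow> d i - d' i = d o' - d' o'" for i
  proof (induction i rule: int_le_induct)
    case (step i)
    then show ?case using local_stringD(2)[OF w _ o, of "i - 1" i] incr[of "i - 1"] by auto
  qed simp
  have "d i = d' i + (d o' - d' o')" if "i \<in> pos w" for i
    using up[of i] down[of i] that by (cases "o' \<le> i") auto
  then show ?thesis by blast
qed

lemma string_obj_regrade:
  assumes "\<And>i. i \<in> pos w \<Longrightarrow> d i = d' i + k"
  shows "obj (string_complex Q I w d) n = obj (string_complex Q I w d') (n - k)"
  using assms by (auto simp: string_obj set_eq_iff; force)

lemma string_diff_regrade: "diff (string_complex Q I w d) n = diff (string_complex Q I w d') n'"
  by (simp add: string_complex_def diagram_complex_def)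

lemma infinite_stringD:
  assumes w: "homotopy_string Q I w" and inf: "infinite (pos w)" and d: "grading w d"
  shows "finite {i \<in> pos w. d i = n}" "right_bounded \<Lambda> (string_complex Q I w d)"
    "bounded_cohomology \<Lambda> (string_complex Q I w d)"
proof -
  have l: "local_string w" using w by (simp add: homotopy_string_iff)
  obtain d' where d': "grading w d'" "\<And>n. finite {i \<in> pos w. d' i = n}"
    "right_bounded \<Lambda> (string_complex Q I w d')" "bounded_cohomology \<Lambda> (string_complex Q I w d')"
    using w inf by (auto simp: homotopy_string_iff)
  obtain k where k: "\<And>i. i \<in> pos w \<Longrightarrow> d i = d' i + k"
    using gradings_differ_by_constant[OF l d d'(1)] by blast
  have "{i \<in> pos w. d i = n} = {i \<in> pos w. d' i = n - k}" using k by force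
  then show "finite {i \<in> pos w. d i = n}" using d'(2) by simp
  have o: "obj (string_complex Q I w d) n = obj (string_complex Q I w d') (n - k)" for n
    by (rule string_obj_regrade[of w d d' k, OF k])
  obtain B where "\<forall>n>B. obj (string_complex Q I w d') n = {\<lambda>_. \<zero>\<^sub>\<Lambda>}"
    using d'(3) by (auto simp: right_bounded_def)
  then show "right_bounded \<Lambda> (string_complex Q I w d)"
    unfolding right_bounded_def o by (intro exI[of _ "B + k"]) auto
  obtain B where B: "\<And>n. B < \<bar>n\<bar> \<Longrightarrow>
      {u \<in> obj (string_complex Q I w d') n. diff (string_complex Q I w d') n u = (\<lambda>_. \<zero>\<^sub>\<Lambda>)} =
      diff (string_complex Q I w d') (n - 1) ` obj (string_complex Q I w d') (n - 1)"
    using d'(4) by (auto simp: bounded_cohomology_def)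
  show "bounded_cohomology \<Lambda> (string_complex Q I w d)"
    unfolding bounded_cohomology_def
  proof (intro exI[of _ "B + \<bar>k\<bar>"] allI impI)
    fix n assume "B + \<bar>k\<bar> < \<bar>n\<bar>"
    then have "B < \<bar>n - k\<bar>" by simp
    from B[OF this] show "{u \<in> obj (string_complex Q I w d) n. diff (string_complex Q I w d) n u = (\<lambda>_. \<zero>\<^sub>\<Lambda>)} =
        diff (string_complex Q I w d) (n - 1) ` obj (string_complex Q I w d) (n - 1)"
      unfolding o string_diff_regrade[of w d n d' "n - k"] string_diff_regrade[of w d "n - 1" d' "n - k - 1"]
      by (simp add: algebra_simps)
  qed
qed

definition restrict_word :: "('v, 'a) word \<Rightarrow> int set \<Rightarrow> ('v, 'a) word" where
  "restrict_word w J = w\<lparr>pos := J\<rparr>"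

lemma restrict_word_simps: "pos (restrict_word w J) = J" "vtx (restrict_word w J) = vtx w" "ltr (restrict_word w J) = ltr w"
  by (simp_all add: restrict_word_def)

lemma edges_restrict_word: "J \<subseteq> pos w \<Longrightarrow> i \<in> edges (restrict_word w J) \<longleftrightarrow> i \<in> edges w \<and> i \<in> J \<and> i + 1 \<in> J"
  by (auto simp: edges_def restrict_word_simps)

lemma local_string_restrict_word:
  assumes w: "local_string w" and J: "J \<subseteq> pos w" "J \<noteq> {}" "\<And>i j. i \<in> J \<Longrightarrow> j \<in> J \<Longrightarrow> {i..j} \<subseteq> J"
  shows "local_string (restrict_word w J)"
proof -
  have "i \<in> edges w" if "i \<in> edges (restrict_word w J)" for i using that edges_restrict_word[OF J(1)] by simp
  then show ?thesis
    using w J unfolding local_string_def restrict_word_simps by blast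
qed

text \<open>A cycle of the complex of the subword, extended by zero, need not be a cycle of the complex
of \<open>w\<close>: letters of \<open>w\<close> leave the subword at its boundary vertices. In a degree in which there is no
boundary vertex this does not happen. A preimage under the differential of \<open>w\<close> can then be truncated
to the subword, because the vertices outside the subword map only to boundary vertices and to vertices
outside.\<close>

lemma restrict_word_exact:
  assumes w: "local_string w" and d: "grading w d"
    and J: "J \<subseteq> pos w" "J \<noteq> {}" "\<And>i j. i \<in> J \<Longrightarrow> j \<in> J \<Longrightarrow> {i..j} \<subseteq> J"
    and boundary: "\<And>p. p \<in> J \<Longrightarrow> p + 1 \<in> pos w - J \<or> p - 1 \<in> pos w - J \<Longrightarrow> d p \<noteq> n"
    and exact: "{u \<in> obj (string_complex Q I w d) n. diff (string_complex Q I w d) n u = (\<lambda>_. \<zero>\<^sub>\<Lambda>)} =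
        diff (string_complex Q I w d) (n - 1) ` obj (string_complex Q I w d) (n - 1)"
  shows "{u \<in> obj (string_complex Q I (restrict_word w J) d) n. diff (string_complex Q I (restrict_word w J) d) n u = (\<lambda>_. \<zero>\<^sub>\<Lambda>)} =
        diff (string_complex Q I (restrict_word w J) d) (n - 1) ` obj (string_complex Q I (restrict_word w J) d) (n - 1)"
    (is "?ker = ?im")
proof (intro equalityI subsetI)
  let ?X = "string_complex Q I w d" and ?Y = "string_complex Q I (restrict_word w J) d"
  have lJ: "local_string (restrict_word w J)" by (rule local_string_restrict_word[OF w J])
  have dJ: "grading (restrict_word w J) d"
    using d edges_restrict_word[OF J(1)] by (simp add: grading_def restrict_word_simps)
  let ?rJ = "rarrow (restrict_word w J) (\<lambda>_. 1)" and ?lJ = "larrow (restrict_word w J) (\<lambda>_. 1)"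
  let ?r = "rarrow w (\<lambda>_. 1)" and ?l = "larrow w (\<lambda>_. 1)"
  note cl = arrows_closed[OF w, of "\<lambda>_. 1"] arrows_closed[OF lJ, of "\<lambda>_. 1"]
  have Yobj: "u \<in> obj ?Y k \<longleftrightarrow> (\<forall>i. if i \<in> J \<and> d i = k then u i \<in> proj Q I (vtx w i) else u i = \<zero>\<^sub>\<Lambda>)" for u k
    unfolding string_obj restrict_word_simps ..
  have maps: "?rJ i = (if i \<in> J \<and> i + 1 \<in> J then ?r i else \<zero>\<^sub>\<Lambda>)"
    "?lJ i = (if i \<in> J \<and> i + 1 \<in> J then ?l i else \<zero>\<^sub>\<Lambda>)" for i
    using edges_restrict_word[OF J(1), of i] by (auto simp: arrows_eq restrict_word_simps)
  have no_edge: "?r i = \<zero>\<^sub>\<Lambda>" "?l i = \<zero>\<^sub>\<Lambda>" if "i \<notin> pos w \<or> i + 1 \<notin> pos w" for i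
    using that by (auto simp: arrows_eq edges_def)
  {
    fix u assume u: "u \<in> ?ker"
    then have uY: "u \<in> obj ?Y n" and du: "diff ?Y n u = (\<lambda>_. \<zero>\<^sub>\<Lambda>)" by auto
    have uc: "u p \<in> carrier \<Lambda>" for p by (rule string_obj_closed[OF lJ uY])
    have u0: "u p = \<zero>\<^sub>\<Lambda>" if "p \<notin> J \<or> p + 1 \<in> pos w - J \<or> p - 1 \<in> pos w - J" for p
      using uY[unfolded Yobj, THEN spec, of p] boundary[of p] that by (auto split: if_splits)
    have uX: "u \<in> obj ?X n"
      unfolding string_obj
    proof
      fix i show "if i \<in> pos w \<and> d i = n then u i \<in> proj Q I (vtx w i) else u i = \<zero>\<^sub>\<Lambda>"
        using uY[unfolded Yobj, THEN spec, of i] J(1) proj_closed(1)[OF local_stringD(3)[OF w], of i]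
        by (auto split: if_splits)
    qed
    have "line_diff w (\<lambda>_. 1) u = line_diff (restrict_word w J) (\<lambda>_. 1) u"
    proof
      fix q
      have "u (q - 1) \<cdot> ?r (q - 1) = u (q - 1) \<cdot> ?rJ (q - 1)"
      proof (cases "q - 1 \<in> J \<and> q \<in> J")
        case False
        then have "u (q - 1) = \<zero>\<^sub>\<Lambda> \<or> ?r (q - 1) = \<zero>\<^sub>\<Lambda>"
          using u0[of "q - 1"] no_edge(1)[of "q - 1"] by auto
        then show ?thesis using False maps(1)[of "q - 1"] uc cl by auto
      qed (simp add: maps)
      moreover have "u (q + 1) \<cdot> ?l q = u (q + 1) \<cdot> ?lJ q"
      proof (cases "q \<in> J \<and> q + 1 \<in> J")
        case False
        then have "u (q + 1) = \<zero>\<^sub>\<Lambda> \<or> ?l q = \<zero>\<^sub>\<Lambda>"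
          using u0[of "q + 1"] no_edge(2)[of q] by auto
        then show ?thesis using False maps(2)[of q] uc cl by auto
      qed (simp add: maps)
      ultimately show "line_diff w (\<lambda>_. 1) u q = line_diff (restrict_word w J) (\<lambda>_. 1) u q"
        by (simp add: line_diff_def)
    qed
    also have "\<dots> = (\<lambda>_. \<zero>\<^sub>\<Lambda>)" using du string_diff_eq[OF lJ uc] by simp
    finally have "diff ?X n u = (\<lambda>_. \<zero>\<^sub>\<Lambda>)" using string_diff_eq[OF w uc] by simp
    then have "u \<in> diff ?X (n - 1) ` obj ?X (n - 1)" using uX exact by blast
    then obtain v where v: "v \<in> obj ?X (n - 1)" "u = diff ?X (n - 1) v" by auto
    have vc: "v p \<in> carrier \<Lambda>" for p by (rule string_obj_closed[OF w v(1)])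
    have u_eq: "u = line_diff w (\<lambda>_. 1) v" using v(2) string_diff_eq[OF w vc] by simp
    define v' where "v' p = (if p \<in> J then v p else \<zero>\<^sub>\<Lambda>)" for p
    have v'Y: "v' \<in> obj ?Y (n - 1)"
      unfolding Yobj
    proof
      fix i show "if i \<in> J \<and> d i = n - 1 then v' i \<in> proj Q I (vtx w i) else v' i = \<zero>\<^sub>\<Lambda>"
        using v(1)[unfolded string_obj, THEN spec, of i] J(1) by (auto simp: v'_def split: if_splits)
    qed
    have v'c: "v' p \<in> carrier \<Lambda>" for p by (rule string_obj_closed[OF lJ v'Y])
    have dv'Y: "line_diff (restrict_word w J) (\<lambda>_. 1) v' \<in> obj ?Y n"
      using line_diff_obj[OF lJ dJ v'Y] by simp
    have "u = line_diff (restrict_word w J) (\<lambda>_. 1) v'"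
    proof
      fix q
      show "u q = line_diff (restrict_word w J) (\<lambda>_. 1) v' q"
      proof (cases "q \<notin> J \<or> q + 1 \<in> pos w - J \<or> q - 1 \<in> pos w - J")
        case True
        then have "line_diff (restrict_word w J) (\<lambda>_. 1) v' q = \<zero>\<^sub>\<Lambda>"
          using dv'Y[unfolded Yobj, THEN spec, of q] boundary[of q] by (auto split: if_splits)
        then show ?thesis using u0[OF True] by simp
      next
        case False
        have "v (q - 1) \<cdot> ?r (q - 1) = v' (q - 1) \<cdot> ?rJ (q - 1)"
          using False no_edge(1)[of "q - 1"] maps(1)[of "q - 1"] vc cl by (cases "q - 1 \<in> J") (auto simp: v'_def)
        moreover have "v (q + 1) \<cdot> ?l q = v' (q + 1) \<cdot> ?lJ q"
          using False no_edge(2)[of q] maps(2)[of q] vc cl by (cases "q + 1 \<in> J") (auto simp: v'_def)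
        ultimately show ?thesis unfolding u_eq by (simp add: line_diff_def)
      qed
    qed
    then have "u = diff ?Y (n - 1) v'" using string_diff_eq[OF lJ v'c] by simp
    then show "u \<in> ?im" using v'Y by blast
  }
  {
    fix u assume "u \<in> ?im"
    then obtain v where v: "v \<in> obj ?Y (n - 1)" "u = diff ?Y (n - 1) v" by auto
    have vc: "v p \<in> carrier \<Lambda>" for p by (rule string_obj_closed[OF lJ v(1)])
    have u: "u = line_diff (restrict_word w J) (\<lambda>_. 1) v" using v(2) string_diff_eq[OF lJ vc] by simp
    have uc: "u p \<in> carrier \<Lambda>" for p unfolding u by (rule line_diff_closed[OF lJ vc])
    have "u \<in> obj ?Y n" using line_diff_obj[OF lJ dJ v(1)] u by simp
    moreover have "diff ?Y n u = (\<lambda>_. \<zero>\<^sub>\<Lambda>)"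
      using string_diff_eq[OF lJ uc] line_diff_line_diff[OF lJ vc] u by simp
    ultimately show "u \<in> ?ker" by simp
  }
qed

text \<open>A subword cut out of a homotopy string at finitely many boundary vertices \<open>B\<close> is a homotopy string:
beyond the degrees of these vertices, exactness is inherited.\<close>

lemma homotopy_string_restrict_word:
  assumes w: "homotopy_string Q I w" and d: "grading w d"
    and J: "J \<subseteq> pos w" "J \<noteq> {}" "\<And>i j. i \<in> J \<Longrightarrow> j \<in> J \<Longrightarrow> {i..j} \<subseteq> J"
    and boundary: "finite B" "\<And>p. p \<in> J \<Longrightarrow> p + 1 \<in> pos w - J \<or> p - 1 \<in> pos w - J \<Longrightarrow> p \<in> B"
  shows "homotopy_string Q I (restrict_word w J)"
  unfolding homotopy_string_iff restrict_word_simps(1)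
proof (intro conjI impI exI[of _ d] allI)
  let ?X = "string_complex Q I w d" and ?Y = "string_complex Q I (restrict_word w J) d"
  have l: "local_string w" using w by (simp add: homotopy_string_iff)
  show lJ: "local_string (restrict_word w J)" by (rule local_string_restrict_word[OF l J])
  show "grading (restrict_word w J) d"
    using d edges_restrict_word[OF J(1)] by (simp add: grading_def restrict_word_simps)
  assume "infinite J"
  then have inf: "infinite (pos w)" using J(1) finite_subset by blast
  note X = infinite_stringD[OF w inf d]
  show "finite {i \<in> J. d i = n}" for n by (rule finite_subset[OF _ X(1)[of n]]) (use J(1) in auto)
  obtain M where M: "\<And>n. M < n \<Longrightarrow> obj ?X n = {\<lambda>_. \<zero>\<^sub>\<Lambda>}" using X(2) by (auto simp: right_bounded_def)
  have "obj ?Y n = {\<lambda>_. \<zero>\<^sub>\<Lambda>}" if "M < n" for n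
  proof (intro equalityI subsetI)
    fix u assume u: "u \<in> obj ?Y n"
    have "u \<in> obj ?X n"
      unfolding string_obj
    proof
      fix i show "if i \<in> pos w \<and> d i = n then u i \<in> proj Q I (vtx w i) else u i = \<zero>\<^sub>\<Lambda>"
        using u[unfolded string_obj restrict_word_simps, THEN spec, of i] J(1) proj_closed(1)[OF local_stringD(3)[OF l], of i]
        by (auto split: if_splits)
    qed
    then show "u \<in> {\<lambda>_. \<zero>\<^sub>\<Lambda>}" using M[OF that] by simp
  qed (use \<Lambda>.fun_moduleD(2)[OF string_fun_module[OF lJ]] in auto)
  then show "right_bounded \<Lambda> ?Y" by (auto simp: right_bounded_def)
  obtain K where K: "\<And>n. K < \<bar>n\<bar> \<Longrightarrow> {u \<in> obj ?X n. diff ?X n u = (\<lambda>_. \<zero>\<^sub>\<Lambda>)} = diff ?X (n - 1) ` obj ?X (n - 1)"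
    using X(3) by (auto simp: bounded_cohomology_def)
  let ?D = "Max (insert 0 ((\<lambda>p. \<bar>d p\<bar>) ` B))"
  have D: "\<bar>d p\<bar> \<le> ?D" if "p \<in> B" for p using that boundary(1) by (intro Max_ge) auto
  show "bounded_cohomology \<Lambda> ?Y"
    unfolding bounded_cohomology_def
  proof (intro exI[of _ "max K ?D"] allI impI)
    fix n assume n: "max K ?D < \<bar>n\<bar>"
    show "{u \<in> obj ?Y n. diff ?Y n u = (\<lambda>_. \<zero>\<^sub>\<Lambda>)} = diff ?Y (n - 1) ` obj ?Y (n - 1)"
    proof (rule restrict_word_exact[OF l d J _ K])
      show "d p \<noteq> n" if "p \<in> J" "p + 1 \<in> pos w - J \<or> p - 1 \<in> pos w - J" for p
        using D[OF boundary(2)[OF that]] n by auto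
    qed (use n in simp_all)
  qed
qed

end

section \<open>Graph maps to an unfolded word\<close>

context gentle_quiver
begin

text \<open>The graph map determined by an overlap of a word \<open>w\<close> with a word \<open>U\<close> that is infinite in both
directions, whose letters carry the scalars \<open>sc\<close>; the positions of \<open>U\<close> are numbered such that the
overlap has the same positions in both words. Inside the overlap the squares commute by the recursion
for the scalars \<open>c\<close>, at the left end by \<open>left_end_squares\<close>, and at the right end by the same lemma for the
inverted words.\<close>

lemma overlap_squares:
  fixes w U :: "('v, 'a) word" and c sc :: "int \<Rightarrow> 'k" and a b :: int and fL fR :: "'a list option"
  defines "\<kappa> \<equiv> \<lambda>i. component Q I w a b fL fR (c i) i"
  assumes w: "local_string w" and U: "local_string U" "pos U = UNIV"
    and ab: "a \<le> b" "{a..b} \<subseteq> pos w"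
    and vtx: "\<And>i. i \<in> {a..b} \<Longrightarrow> vtx w i = vtx U i"
    and ltr: "\<And>i. i \<in> {a..<b} \<Longrightarrow> ltr w i = ltr U i"
    and L: "left_end (edge_at w (a - 1)) (Some (ltr U (a - 1))) fL"
    and R: "right_end (edge_at w b) (Some (ltr U b)) fR"
    and c: "\<And>i. i \<in> {a - 1..b} \<Longrightarrow> c (i + 1) = c i * sc i"
    and sc: "\<And>i. \<not> is_direct (ltr U i) \<Longrightarrow> sc i = 1"
  shows "rarrow w (\<lambda>_. 1) p \<cdot> \<kappa> (p + 1) = \<kappa> p \<cdot> rarrow U sc p"
    and "larrow w (\<lambda>_. 1) p \<cdot> \<kappa> p = \<kappa> (p + 1) \<cdot> larrow U sc p"
    and "\<kappa> p \<in> proj Q I (vtx U p)"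
    and "\<kappa> p \<noteq> \<zero>\<^sub>\<Lambda> \<Longrightarrow> p \<in> pos w"
    and "\<lbrakk>\<And>i. i \<in> {a..b} \<Longrightarrow> d i = d' i; grading w d; grading U d'; \<kappa> p \<noteq> \<zero>\<^sub>\<Lambda>\<rbrakk> \<Longrightarrow> d p = d' p"
    and "p \<notin> {a - 1..b + 1} \<Longrightarrow> \<kappa> p = \<zero>\<^sub>\<Lambda>"
    and "p \<in> {a..b} \<Longrightarrow> \<kappa> p = idm (c p) (vtx U p)"
proof -
  have eU: "edges U = UNIV" using U(2) by (simp add: edges_def)
  then have edge_U: "edge_at U i = Some (ltr U i)" for i by (simp add: edge_at_def)
  have Ul: "is_letter Q I (ltr U i)" and Ulv: "lvertex Q (ltr U i) = vtx U i"
    and Urv: "rvertex Q (ltr U i) = vtx U (i + 1)" for i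
    using local_stringD(4-6)[OF U(1), of i] eU by auto
  have UC: "consecutive Q I (ltr U i) (ltr U (i + 1))" for i
    using local_stringD(7)[OF U(1), of i] eU by simp
  have Uv: "vtx U i \<in> verts Q" for i using local_stringD(3)[OF U(1)] U(2) by simp
  have inner: "p \<in> edges w" if "a \<le> p" "p < b" for p using that ab by (auto simp: edges_def)
  have \<kappa>_in: "\<kappa> p = idm (c p) (vtx U p)" if "p \<in> {a..b}" for p
    using that vtx[OF that] by (simp add: \<kappa>_def component_def)
  have \<kappa>_out: "\<kappa> p = \<zero>\<^sub>\<Lambda>" if "p \<notin> {a - 1..b + 1}" for p
  proof -
    have "p \<notin> {a..b}" "p \<noteq> a - 1" "p \<noteq> b + 1" using that ab(1) by auto
    then show ?thesis by (simp only: \<kappa>_def component_def Let_def if_False)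
  qed
  have \<kappa>_L: "\<kappa> (a - 1) = end_map (c (a - 1)) fL"
    by (simp add: \<kappa>_def component_def)
  have \<kappa>_R: "\<kappa> (b + 1) = end_map (c (b + 1)) fR"
    using ab(1) by (simp add: \<kappa>_def component_def)
  have va: "vtx w a = vtx U a" "vtx w b = vtx U b" using vtx ab by auto
  have left: "right_map 1 (edge_at w (a - 1)) \<cdot> idm (c a) (vtx U a) = \<kappa> (a - 1) \<cdot> right_map (sc (a - 1)) (Some (ltr U (a - 1)))" (is ?A)
    "left_map 1 (edge_at w (a - 1)) \<cdot> \<kappa> (a - 1) = idm (c a) (vtx U a) \<cdot> left_map (sc (a - 1)) (Some (ltr U (a - 1)))" (is ?B)
    "right_map 1 (edge_at w (a - 2)) \<cdot> \<kappa> (a - 1) = \<zero>\<^sub>\<Lambda>" (is ?C)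
    "\<kappa> (a - 1) \<cdot> left_map (sc (a - 2)) (Some (ltr U (a - 2))) = \<zero>\<^sub>\<Lambda>" (is ?D)
    "\<kappa> (a - 1) \<in> proj Q I (lvertex Q (ltr U (a - 1)))" (is ?E)
    "\<kappa> (a - 1) \<noteq> \<zero>\<^sub>\<Lambda> \<Longrightarrow> \<exists>l. edge_at w (a - 1) = Some l \<and> is_direct l = is_direct (ltr U (a - 1))" (is "?nzF \<Longrightarrow> ?lF")
  proof -
    have 1: "is_letter Q I l \<and> rvertex Q l = vtx U a" if "edge_at w (a - 1) = Some l" for l
      using edge_at_letter(3,5)[OF w that] va by simp
    have 2: "is_letter Q I l" if "edge_at w (a - 2) = Some l" for l
      using edge_at_letter(3)[OF w that] .
    have 3: "rvertex Q l2 = lvertex Q l \<and> consecutive Q I l2 l"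
      if "edge_at w (a - 1) = Some l" "edge_at w (a - 2) = Some l2" for l l2
      using edge_at_letter(4)[OF w that(1)] edge_at_letter(5)[OF w that(2)]
        edge_at_consecutive[OF w that(2)] that(1) by simp
    have 4: "is_letter Q I (ltr U (a - 1))" "rvertex Q (ltr U (a - 1)) = vtx U a"
      using Ul[of "a - 1"] Urv[of "a - 1"] by auto
    have 5: "is_letter Q I (ltr U (a - 2))" "rvertex Q (ltr U (a - 2)) = lvertex Q (ltr U (a - 1))"
      "consecutive Q I (ltr U (a - 2)) (ltr U (a - 1))"
      using Ul[of "a - 2"] Urv[of "a - 2"] Ulv[of "a - 1"] UC[of "a - 2"] by auto
    have 6: "c a = c (a - 1) * sc (a - 1)" using c[of "a - 1"] ab by simp
    have 7: "\<not> is_direct (ltr U (a - 1)) \<Longrightarrow> c (a - 1) = c a * sc (a - 1)" using 6 sc by simp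
    note * = left_end_squares[where ?x2.0 = "edge_at w (a - 2)" and s = "sc (a - 1)",
        OF L 1 4 2 3 5 6 7]
    show ?A ?B ?C ?D ?E "?nzF \<Longrightarrow> ?lF"
      unfolding \<kappa>_L by (rule *; assumption)+
  qed
  \<comment> \<open>The left end of the inverted words: left and right maps are interchanged, and since the letters
    are flipped, the recursion for the scalars is read backwards.\<close>
  have right: "left_map 1 (edge_at w b) \<cdot> idm (c b) (vtx U b) = \<kappa> (b + 1) \<cdot> left_map (sc b) (Some (ltr U b))" (is ?A)
    "right_map 1 (edge_at w b) \<cdot> \<kappa> (b + 1) = idm (c b) (vtx U b) \<cdot> right_map (sc b) (Some (ltr U b))" (is ?B)
    "left_map 1 (edge_at w (b + 1)) \<cdot> \<kappa> (b + 1) = \<zero>\<^sub>\<Lambda>" (is ?C)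
    "\<kappa> (b + 1) \<cdot> right_map (sc (b + 1)) (Some (ltr U (b + 1))) = \<zero>\<^sub>\<Lambda>" (is ?D)
    "\<kappa> (b + 1) \<in> proj Q I (rvertex Q (ltr U b))" (is ?E)
    "\<kappa> (b + 1) \<noteq> \<zero>\<^sub>\<Lambda> \<Longrightarrow> \<exists>l. edge_at w b = Some l \<and> is_direct l = is_direct (ltr U b)"
  proof -
    have L: "left_end (map_option flip (edge_at w b)) (Some (flip (ltr U b))) fR"
      using R by (simp add: right_end_iff_left_end_flip)
    have 1: "is_letter Q I l \<and> rvertex Q l = vtx U b" if h: "map_option flip (edge_at w b) = Some l" for l
    proof -
      obtain m where m: "edge_at w b = Some m" "l = flip m" using h by auto
      show ?thesis using edge_at_letter(3,4)[OF w m(1)] m(2) va by (simp add: is_letter_flip)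
    qed
    have 2: "is_letter Q I l" if h: "map_option flip (edge_at w (b + 1)) = Some l" for l
    proof -
      obtain m where m: "edge_at w (b + 1) = Some m" "l = flip m" using h by auto
      show ?thesis using edge_at_letter(3)[OF w m(1)] m(2) by (simp add: is_letter_flip)
    qed
    have 3: "rvertex Q l2 = lvertex Q l \<and> consecutive Q I l2 l"
      if h: "map_option flip (edge_at w b) = Some l" "map_option flip (edge_at w (b + 1)) = Some l2" for l l2
    proof -
      obtain m m2 where m: "edge_at w b = Some m" "l = flip m" "edge_at w (b + 1) = Some m2" "l2 = flip m2"
        using h by auto
      show ?thesis using edge_at_letter(5)[OF w m(1)] edge_at_letter(4)[OF w m(3)]
          edge_at_consecutive[OF w m(1,3)] m(2,4) by (simp add: consecutive_flip)
    qed
    have 4: "is_letter Q I (flip (ltr U b))" "rvertex Q (flip (ltr U b)) = vtx U b"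
      using Ul[of b] Ulv[of b] by (auto simp: is_letter_flip)
    have 5: "is_letter Q I (flip (ltr U (b + 1)))" "rvertex Q (flip (ltr U (b + 1))) = lvertex Q (flip (ltr U b))"
      "consecutive Q I (flip (ltr U (b + 1))) (flip (ltr U b))"
      using Ul[of "b + 1"] Urv[of b] Ulv[of "b + 1"] UC[of b] by (auto simp: consecutive_flip is_letter_flip)
    have 6: "c (b + 1) = c b * sc b" using c[of b] ab by simp
    have 7: "is_direct (flip (ltr U b)) \<Longrightarrow> c b = c (b + 1) * sc b" using 6 sc by simp
    note * = left_end_squares[where ?x2.0 = "map_option flip (edge_at w (b + 1))" and s = "sc b",
        OF L 1 4 2 3 5 7 6]
    note flip_maps = right_map_flip left_map_flip right_map_flip[of _ "Some _", simplified]
      left_map_flip[of _ "Some _", simplified]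
    note ** = *[unfolded flip_maps]
    show ?A ?B ?C ?D
      unfolding \<kappa>_R by (rule **; assumption)+
    show ?E
      unfolding \<kappa>_R flip_simps(1)[symmetric] by (rule *(5); assumption)
    show "\<exists>l. edge_at w b = Some l \<and> is_direct l = is_direct (ltr U b)" if "\<kappa> (b + 1) \<noteq> \<zero>\<^sub>\<Lambda>"
    proof -
      have "\<exists>l. map_option flip (edge_at w b) = Some l \<and> is_direct l = is_direct (flip (ltr U b))"
        by (rule *(6); (assumption | rule that[unfolded \<kappa>_R]))
      then show ?thesis by auto
    qed
  qed
  show proj: "\<kappa> p \<in> proj Q I (vtx U p)" for p
  proof -
    consider "p \<in> {a..b}" | "p = a - 1" | "p = b + 1" | "p \<notin> {a - 1..b + 1}" by fastforce
    then show ?thesis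
    proof cases
      case 2 then show ?thesis using left(5) Ulv[of "a - 1"] by simp
    next
      case 3 then show ?thesis using right(5) Urv[of b] by simp
    qed (simp_all add: \<kappa>_in \<kappa>_out idm_proj proj_closed(1) Uv)
  qed
  have cl: "\<kappa> p \<in> carrier \<Lambda>" for p using proj_carrier[OF proj Uv] .
  note rl = arrows_closed[OF w, of "\<lambda>_. 1"] arrows_closed[OF U(1), of sc]
  have squares: "rarrow w (\<lambda>_. 1) p \<cdot> \<kappa> (p + 1) = \<kappa> p \<cdot> rarrow U sc p \<and>
      larrow w (\<lambda>_. 1) p \<cdot> \<kappa> p = \<kappa> (p + 1) \<cdot> larrow U sc p"
  proof -
    consider "p < a - 2" | "p = a - 2" | "p = a - 1" | "a \<le> p" "p < b" | "p = b" | "p = b + 1" | "p > b + 1"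
      by linarith
    then show ?thesis
    proof cases
      case 1
      then show ?thesis using rl \<kappa>_out[of p] \<kappa>_out[of "p + 1"] by simp
    next
      case 2
      then have "p + 1 = a - 1" "\<kappa> p = \<zero>\<^sub>\<Lambda>" using \<kappa>_out[of p] by auto
      then show ?thesis using left(3,4) rl 2 by (simp add: rarrow_def larrow_def edge_U)
    next
      case 3
      then have "\<kappa> (p + 1) = idm (c a) (vtx U a)" using \<kappa>_in[of a] ab by simp
      then show ?thesis using left(1,2) 3 by (simp add: rarrow_def larrow_def edge_U)
    next
      case 4
      have pw: "p \<in> edges w" using inner 4 by simp
      have \<kappa>: "\<kappa> p = idm (c p) (vtx U p)" "\<kappa> (p + 1) = idm (c (p + 1)) (vtx U (p + 1))"
        using \<kappa>_in[of p] \<kappa>_in[of "p + 1"] 4 by auto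
      have l: "ltr w p = ltr U p" using ltr[of p] 4 by simp
      have v: "valid (lpath (ltr U p))" using Ul[of p] by (simp add: is_letter_iff)
      have coef: "c (p + 1) = c p * sc p" using c[of p] 4 by simp
      show ?thesis
      proof (cases "ltr U p")
        case [simp]: (Direct q)
        have "vtx U p = head Q (last q)" "vtx U (p + 1) = tail Q (hd q)" using Ulv[of p] Urv[of p] by auto
        then show ?thesis using v pw l coef eU idm_closed[OF Uv[of p]] idm_closed[OF Uv[of "p + 1"]]
          by (simp add: \<kappa> arrows_eq cls_idm idm_cls)
      next
        case [simp]: (Inverse q)
        have "vtx U p = tail Q (hd q)" "vtx U (p + 1) = head Q (last q)" using Ulv[of p] Urv[of p] by auto
        then show ?thesis using v pw l coef eU sc[of p] idm_closed[OF Uv[of p]] idm_closed[OF Uv[of "p + 1"]]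
          by (simp add: \<kappa> arrows_eq cls_idm idm_cls)
      qed
    next
      case 5
      then have "\<kappa> p = idm (c b) (vtx U b)" using \<kappa>_in[of b] ab by simp
      then show ?thesis using right(1,2) 5 by (simp add: rarrow_def larrow_def edge_U)
    next
      case 6
      then have "\<kappa> (p + 1) = \<zero>\<^sub>\<Lambda>" using \<kappa>_out[of "p + 1"] by simp
      then show ?thesis using right(3,4) rl 6 by (simp add: rarrow_def larrow_def edge_U)
    next
      case 7
      then show ?thesis using rl \<kappa>_out[of p] \<kappa>_out[of "p + 1"] by simp
    qed
  qed
  then show "rarrow w (\<lambda>_. 1) p \<cdot> \<kappa> (p + 1) = \<kappa> p \<cdot> rarrow U sc p"
    and "larrow w (\<lambda>_. 1) p \<cdot> \<kappa> p = \<kappa> (p + 1) \<cdot> larrow U sc p" by auto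
  have nz: "p \<in> {a..b} \<or> p = a - 1 \<and> a - 1 \<in> edges w \<and> is_direct (ltr w p) = is_direct (ltr U p) \<or>
      p = b + 1 \<and> b \<in> edges w \<and> is_direct (ltr w b) = is_direct (ltr U b)" if "\<kappa> p \<noteq> \<zero>\<^sub>\<Lambda>"
  proof -
    consider "p \<in> {a..b}" | "p = a - 1" | "p = b + 1" | "p \<notin> {a - 1..b + 1}" by fastforce
    then show ?thesis
    proof cases
      case 2
      then obtain l where "edge_at w (a - 1) = Some l" "is_direct l = is_direct (ltr U (a - 1))"
        using left(6) \<open>\<kappa> p \<noteq> \<zero>\<^sub>\<Lambda>\<close> by blast
      then show ?thesis using edge_at_letter(1,2)[OF w, of "a - 1" l] 2 by simp
    next
      case 3
      then obtain l where "edge_at w b = Some l" "is_direct l = is_direct (ltr U b)"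
        using right(6) \<open>\<kappa> p \<noteq> \<zero>\<^sub>\<Lambda>\<close> by blast
      then show ?thesis using edge_at_letter(1,2)[OF w, of b l] 3 by simp
    qed (use \<kappa>_out \<open>\<kappa> p \<noteq> \<zero>\<^sub>\<Lambda>\<close> in blast)+
  qed
  show "p \<in> pos w" if "\<kappa> p \<noteq> \<zero>\<^sub>\<Lambda>"
    using nz[OF that] ab by (auto simp: edges_def)
  show "d p = d' p" if "\<And>i. i \<in> {a..b} \<Longrightarrow> d i = d' i" "grading w d" "grading U d'" "\<kappa> p \<noteq> \<zero>\<^sub>\<Lambda>"
  proof -
    have g: "d (i + 1) = (if is_direct (ltr w i) then d i + 1 else d i - 1)" if "i \<in> edges w" for i
      using \<open>grading w d\<close> that by (auto simp: grading_def)
    have g': "d' (i + 1) = (if is_direct (ltr U i) then d' i + 1 else d' i - 1)" for i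
      using \<open>grading U d'\<close> eU by (auto simp: grading_def)
    have e: "d a = d' a" "d b = d' b" using that(1) ab by auto
    from nz[OF that(4)] show ?thesis
    proof (elim disjE conjE)
      assume "p \<in> {a..b}" then show ?thesis by (rule that(1))
    next
      assume p: "p = a - 1" "a - 1 \<in> edges w" "is_direct (ltr w p) = is_direct (ltr U p)"
      then show ?thesis using g[of "a - 1"] g'[of "a - 1"] e(1) by (cases "is_direct (ltr U p)") simp_all
    next
      assume p: "p = b + 1" "b \<in> edges w" "is_direct (ltr w b) = is_direct (ltr U b)"
      then show ?thesis using g[of b] g'[of b] e(2) by (cases "is_direct (ltr U b)") simp_all
    qed
  qed
  show "\<kappa> p = \<zero>\<^sub>\<Lambda>" if "p \<notin> {a - 1..b + 1}" using \<kappa>_out that .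
  show "\<kappa> p = idm (c p) (vtx U p)" if "p \<in> {a..b}" using \<kappa>_in that .
qed

end

section \<open>The unfolding of a band\<close>

lemma prod_period_single:
  fixes \<mu> :: "'b::comm_monoid_mult"
  assumes "0 < N" "0 \<le> m" "m < (N::int)"
  shows "(\<Prod>j\<in>{0..<N}. if (x + j) mod N = m then \<mu> else 1) = \<mu>"
proof -
  have "(x + j) mod N = m \<longleftrightarrow> j = (m - x) mod N" if "j \<in> {0..<N}" for j
  proof
    assume h: "(x + j) mod N = m"
    have "(m - x) mod N = (x + j - x) mod N" unfolding h[symmetric] by (simp add: mod_diff_left_eq)
    then show "j = (m - x) mod N" using that by simp
  next
    assume "j = (m - x) mod N"
    then show "(x + j) mod N = m" using assms by (simp add: mod_add_right_eq)
  qed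
  then have "(\<Prod>j\<in>{0..<N}. if (x + j) mod N = m then \<mu> else 1) =
      (\<Prod>j\<in>{0..<N}. if j = (m - x) mod N then \<mu> else 1)" by (intro prod.cong) auto
  also have "\<dots> = \<mu>" using assms by simp
  finally show ?thesis .
qed

definition shifted_unfolding :: "('v, 'a) pre_digraph \<Rightarrow> 'a hletter list \<Rightarrow> int \<Rightarrow> ('v, 'a) word" where
  "shifted_unfolding Q ls t =
    \<lparr>pos = UNIV, vtx = (\<lambda>i. vtx (unfolding_word Q ls) (i + t)), ltr = (\<lambda>i. ltr (unfolding_word Q ls) (i + t))\<rparr>"

lemma shifted_unfolding_simps:
  "pos (shifted_unfolding Q ls t) = UNIV" "edges (shifted_unfolding Q ls t) = UNIV"
  "vtx (shifted_unfolding Q ls t) i = lvertex Q (ls ! nat ((i + t) mod int (length ls)))"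
  "ltr (shifted_unfolding Q ls t) i = ls ! nat ((i + t) mod int (length ls))"
  by (simp_all add: shifted_unfolding_def unfolding_word_def edges_def)

context quiver_with_ideal
begin

lemma fin_word_simps:
  "pos (fin_word Q x ls) = {0..int (length ls)}" "edges (fin_word Q x ls) = {0..<int (length ls)}"
  "ltr (fin_word Q x ls) i = ls ! nat i"
  "vtx (fin_word Q x ls) i = (if i = 0 then x else rvertex Q (ls ! nat (i - 1)))"
  by (auto simp: fin_word_def edges_def)

text \<open>Any two neighbouring letters of the unfolding are neighbours in \<open>\<tau> \<tau>\<close>, which is a homotopy string.\<close>

lemma local_string_shifted_unfolding:
  assumes "homotopy_band Q I ls"
  shows "local_string (shifted_unfolding Q ls t)"
proof -
  let ?N = "int (length ls)" and ?U = "shifted_unfolding Q ls t"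
  let ?w = "fin_word Q (lend Q ls) (ls @ ls)"
  have ne: "ls \<noteq> []" and w: "local_string ?w" and close: "lvertex Q (hd ls) = rvertex Q (last ls)"
    using assms by (auto simp: homotopy_band_def homotopy_string_iff)
  have N: "0 < ?N" using ne by simp
  note wD = local_stringD[OF w, unfolded fin_word_simps]
  have let1: "is_letter Q I (ls ! k)" "consecutive Q I (ls ! k) (ls ! (Suc k mod length ls))"
      "rvertex Q (ls ! k) = lvertex Q (ls ! (Suc k mod length ls))" if k: "k < length ls" for k
  proof -
    have a: "(ls @ ls) ! k = ls ! k" using k by (simp add: nth_append)
    have b: "(ls @ ls) ! (Suc k) = ls ! (Suc k mod length ls)"
      using k by (cases "Suc k = length ls") (auto simp: nth_append)
    have e: "int k \<in> {0..<int (length (ls @ ls))}" "int k + 1 \<in> {0..<int (length (ls @ ls))}"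
      using k by auto
    have n: "nat (int k + 1) = Suc k" by simp
    show "is_letter Q I (ls ! k)" using wD(4)[OF e(1)] a by simp
    show "consecutive Q I (ls ! k) (ls ! (Suc k mod length ls))"
      using wD(7)[OF e] unfolding n nat_int a b .
    show "rvertex Q (ls ! k) = lvertex Q (ls ! (Suc k mod length ls))"
      using wD(6)[OF e(1)] wD(5)[OF e(2)] unfolding n nat_int a b by simp
  qed
  have idx: "nat ((i + t) mod ?N) < length ls" "nat ((i + 1 + t) mod ?N) = Suc (nat ((i + t) mod ?N)) mod length ls" for i
  proof -
    show "nat ((i + t) mod ?N) < length ls" using N by (simp add: nat_less_iff)
    have "int (Suc (nat ((i + t) mod ?N)) mod length ls) = ((i + t) mod ?N + 1) mod ?N"
      using N by (simp add: zmod_int add.commute)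
    also have "\<dots> = (i + 1 + t) mod ?N" unfolding mod_add_left_eq by (simp add: ac_simps)
    finally show "nat ((i + 1 + t) mod ?N) = Suc (nat ((i + t) mod ?N)) mod length ls" by simp
  qed
  have let2: "is_letter Q I (ltr ?U i)" "consecutive Q I (ltr ?U i) (ltr ?U (i + 1))"
     "rvertex Q (ltr ?U i) = vtx ?U (i + 1)" "lvertex Q (ltr ?U i) = vtx ?U i" for i
    using let1[OF idx(1)[of i]] unfolding shifted_unfolding_simps idx(2) by simp_all
  have "vtx ?U i \<in> verts Q" for i
    using let2(1,4)[of i] valid_ends(3,4)[of "lpath (ltr ?U i)"]
    by (cases "ltr ?U i") (simp_all add: is_letter_iff)
  then show ?thesis
    using let2 by (simp add: local_string_def shifted_unfolding_simps(1,2))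
qed

end

text \<open>Along a period the degree rises as often as it falls.\<close>

lemma band_grading_periodic:
  assumes ls: "ls \<noteq> []" "length (filter is_direct ls) = length (filter (\<lambda>l. \<not> is_direct l) ls)"
    and d: "grading (unfolding_word Q ls) d"
  shows "d (i + int (length ls)) = d i"
proof -
  let ?N = "int (length ls)"
  have step: "d (i + 1) = (if is_direct (ls ! nat (i mod ?N)) then d i + 1 else d i - 1)" for i
    using d by (simp add: grading_def edges_def unfolding_word_def)
  define D where "D i = d (i + ?N) - d i" for i
  have D1: "D (i + 1) = D i" for i
  proof -
    have "(i + ?N) mod ?N = i mod ?N" by simp
    then show ?thesis
      unfolding D_def using step[of i] step[of "i + ?N"] by (simp add: add.assoc add.commute[of 1] split: if_splits)
  qed
  have D: "D i = D 0" for i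
  proof (induction i rule: int_induct[where k = 0])
    case (step2 i) then show ?case using D1[of "i - 1"] by simp
  qed (simp_all add: D1)
  have "k \<le> length ls \<Longrightarrow> d (int k) = d 0 + int (length (filter is_direct (take k ls)))
      - int (length (filter (\<lambda>l. \<not> is_direct l) (take k ls)))" for k
  proof (induction k)
    case (Suc k)
    then have "nat (int k mod ?N) = k" by simp
    then show ?case using Suc step[of "int k"] by (auto simp: take_Suc_conv_app_nth add.commute)
  qed simp
  from this[of "length ls"] ls(2) have "D 0 = 0" by (simp add: D_def)
  then show ?thesis using D[of i] by (simp add: D_def)
qed

section \<open>Cutting one period out of the string\<close>

text \<open>A graph map from \<open>\<sigma>\<close> to a band whose overlap contains at least one full period. In this context \<open>U\<close>
is the unfolded band, renumbered such that the overlap occupies \<open>a, \<dots>, b\<close> in both words, and \<open>sc\<close>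
and \<open>dU\<close> are its scalars and its grading.\<close>

locale band_overlap = gentle_quiver Q I
  for Q :: "('v, 'a) pre_digraph" and I :: "(('v, 'a) qpath \<Rightarrow> 'k::field) set" +
  fixes \<sigma> :: "('v, 'a) word" and \<tau> :: "'a hletter list" and \<mu> :: 'k and m :: nat
    and a b t :: int and d\<sigma> d\<tau> :: "int \<Rightarrow> int" and fL fR :: "'a list option" and coef :: "int \<Rightarrow> 'k"
  assumes string: "local_string \<sigma>" and grading_\<sigma>: "grading \<sigma> d\<sigma>"
    and band: "homotopy_band Q I \<tau>" and grading_\<tau>: "grading (unfolding_word Q \<tau>) d\<tau>"
    and mu: "\<mu> \<noteq> 0" and m: "m < length \<tau>" "is_direct (\<tau> ! m)"
    and overlap: "overlap \<sigma> d\<sigma> (unfolding_word Q \<tau>) d\<tau> a b t"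
    and ends: "left_end (letter_left \<sigma> a) (letter_left (unfolding_word Q \<tau>) (a + t)) fL"
      "right_end (letter_right \<sigma> b) (letter_right (unfolding_word Q \<tau>) (b + t)) fR"
    and coef_nonzero: "\<And>i. coef i \<noteq> 0"
    and coef_step: "\<And>i. i \<in> {a - 1..b} \<Longrightarrow> coef (i + 1) = coef i * band_scalar \<tau> m \<mu> (i + t)"
    and long: "a + int (length \<tau>) \<le> b"
begin

definition N :: int where "N = int (length \<tau>)"
definition U :: "('v, 'a) word" where "U = shifted_unfolding Q \<tau> t"
definition sc :: "int \<Rightarrow> 'k" where "sc i = band_scalar \<tau> m \<mu> (i + t)"
definition dU :: "int \<Rightarrow> int" where "dU i = d\<tau> (i + t)"

lemma long': "a + N \<le> b" using long by (simp add: N_def)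

lemma N_ge_2: "2 \<le> N"
proof -
  have "\<tau> ! m \<in> set (filter is_direct \<tau>)" using m by simp
  then have "length (filter is_direct \<tau>) \<ge> 1" by (cases "filter is_direct \<tau>") auto
  moreover have "length (filter is_direct \<tau>) = length (filter (\<lambda>l. \<not> is_direct l) \<tau>)"
    using band by (simp add: homotopy_band_def)
  moreover have "length (filter is_direct \<tau>) + length (filter (\<lambda>l. \<not> is_direct l) \<tau>) = length \<tau>"
    by (rule sum_length_filter_compl)
  ultimately show ?thesis by (simp add: N_def)
qed

lemma U_local: "local_string U" unfolding U_def by (rule local_string_shifted_unfolding[OF band])

lemmas U_simps = shifted_unfolding_simps[of Q \<tau> t, folded U_def N_def]

lemma U_verts: "vtx U i \<in> verts Q" using local_stringD(3)[OF U_local] by (simp add: U_simps)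

lemma U_periodic: "vtx U (i + N) = vtx U i" "ltr U (i + N) = ltr U i" "sc (i + N) = sc i" "dU (i + N) = dU i"
proof -
  have 1: "(i + N + t) mod N = (i + t) mod N"
  proof -
    have e: "i + N + t = (i + t) + N" by simp
    show ?thesis unfolding e by (rule mod_add_self2)
  qed
  then show "vtx U (i + N) = vtx U i" "ltr U (i + N) = ltr U i" "sc (i + N) = sc i"
    by (simp_all add: U_simps sc_def band_scalar_def N_def)
  have "d\<tau> (i + t + N) = d\<tau> (i + t)"
    unfolding N_def using band by (intro band_grading_periodic[OF _ _ grading_\<tau>]) (auto simp: homotopy_band_def)
  then show "dU (i + N) = dU i" by (simp add: dU_def ac_simps)
qed

lemma periodic_mod:
  assumes "\<And>i. g (i + N) = g i" "i mod N = j mod N" shows "g i = g j"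
proof -
  have k: "g (x + int k * N) = g x" for x k
  proof (induction k)
    case (Suc k)
    have "g (x + int (Suc k) * N) = g ((x + int k * N) + N)" by (simp add: algebra_simps)
    then show ?case using Suc assms(1) by simp
  qed simp
  have "N dvd i - j" using assms(2) by (simp add: mod_eq_dvd_iff)
  then obtain q where q: "i - j = N * q" by (auto simp: dvd_def)
  show ?thesis
  proof (cases "0 \<le> q")
    case True
    then show ?thesis using k[of j "nat q"] q by (simp add: algebra_simps)
  next
    case False
    then show ?thesis using k[of i "nat (- q)"] q by (simp add: algebra_simps)
  qed
qed

lemma sc_inverse: "\<not> is_direct (ltr U i) \<Longrightarrow> sc i = 1"
  using m by (auto simp: U_simps sc_def band_scalar_def N_def)

lemma U_grading: "grading U dU"
proof -
  have "d\<tau> (i + t + 1) = (if is_direct (ltr (unfolding_word Q \<tau>) (i + t)) then d\<tau> (i + t) + 1 else d\<tau> (i + t) - 1)" for i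
    using grading_\<tau> by (simp add: grading_def edges_def unfolding_word_def)
  then show ?thesis by (simp add: grading_def U_def shifted_unfolding_def dU_def ac_simps)
qed

text \<open>The letter with scalar \<open>\<mu>\<close> occurs exactly once in every period.\<close>

lemma coef_period:
  assumes "a - 1 \<le> i" "i + N \<le> b + 1" shows "coef (i + N) = \<mu> * coef i"
proof -
  have "k \<le> nat N \<Longrightarrow> coef (i + int k) = coef i * (\<Prod>j\<in>{0..<int k}. sc (i + j))" for k
  proof (induction k)
    case (Suc k)
    have "{0..<int (Suc k)} = insert (int k) {0..<int k}" by auto
    moreover have "coef (i + int k + 1) = coef (i + int k) * sc (i + int k)"
      unfolding sc_def using Suc.prems assms by (intro coef_step) auto
    ultimately show ?case using Suc by (simp add: ac_simps)
  qed simp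
  from this[of "nat N"] have 1: "coef (i + N) = coef i * (\<Prod>j\<in>{0..<N}. sc (i + j))"
    using N_ge_2 by simp
  have "(\<Prod>j\<in>{0..<N}. sc (i + j)) = (\<Prod>j\<in>{0..<N}. if ((i + t) + j) mod N = int m then \<mu> else 1)"
    by (intro prod.cong) (auto simp: sc_def band_scalar_def N_def ac_simps)
  also have "\<dots> = \<mu>" using N_ge_2 m by (intro prod_period_single) (auto simp: N_def)
  finally show ?thesis using 1 by (simp add: mult.commute)
qed

lemma overlapD:
  shows "{a..b} \<subseteq> pos \<sigma>" "i \<in> {a..b} \<Longrightarrow> vtx \<sigma> i = vtx U i" "i \<in> {a..b} \<Longrightarrow> d\<sigma> i = dU i"
    "i \<in> {a..<b} \<Longrightarrow> ltr \<sigma> i = ltr U i" "a \<le> b"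
  using overlap by (auto simp: overlap_def U_def shifted_unfolding_def dU_def)

lemma ends': "left_end (edge_at \<sigma> (a - 1)) (Some (ltr U (a - 1))) fL"
  "right_end (edge_at \<sigma> b) (Some (ltr U b)) fR"
proof -
  have "edges (unfolding_word Q \<tau>) = UNIV" by (simp add: edges_def unfolding_word_def)
  then have "letter_left (unfolding_word Q \<tau>) (a + t) = Some (ltr U (a - 1))"
    "letter_right (unfolding_word Q \<tau>) (b + t) = Some (ltr U b)"
    by (simp_all add: letter_left_def letter_right_def U_def shifted_unfolding_def algebra_simps)
  then show "left_end (edge_at \<sigma> (a - 1)) (Some (ltr U (a - 1))) fL" "right_end (edge_at \<sigma> b) (Some (ltr U b)) fR"
    using ends by (simp_all add: letter_left_edge_at letter_right_edge_at)
qed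

text \<open>The word \<open>\<sigma>\<close> without one period of the overlap. By periodicity, it does not matter which
period is deleted: \<open>cut\<close> coincides with \<open>\<sigma>\<close> up to the position \<open>b - N\<close>, and with \<open>\<sigma>\<close> moved to the left by \<open>N\<close>
from the position \<open>a\<close> on (\<open>cut_left\<close>, \<open>cut_right\<close>), and both hold at the positions \<open>a, \<dots>, b - N\<close>.\<close>

definition cut :: "('v, 'a) word" where
  "cut = \<lparr>pos = {i. i \<le> b - N \<and> i \<in> pos \<sigma> \<or> b - N \<le> i \<and> i + N \<in> pos \<sigma>},
     vtx = (\<lambda>i. if i \<le> b - N then vtx \<sigma> i else vtx \<sigma> (i + N)),
     ltr = (\<lambda>i. if i < b - N then ltr \<sigma> i else ltr \<sigma> (i + N))\<rparr>"

text \<open>The degrees are those in the shifted summand \<open>\<Sigma>P\<^sub>\<sigma>\<close> of the cone.\<close>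

definition dcut :: "int \<Rightarrow> int" where
  "dcut i = (if i \<le> b - N then d\<sigma> i else d\<sigma> (i + N)) - 1"

lemma in_pos: "a \<le> i \<Longrightarrow> i \<le> b \<Longrightarrow> i \<in> pos \<sigma>"
  using overlapD(1) by auto

lemma cut_left:
  assumes "i \<le> b - N"
  shows "i \<in> pos cut \<longleftrightarrow> i \<in> pos \<sigma>" "vtx cut i = vtx \<sigma> i" "dcut i = d\<sigma> i - 1"
    "i < b - N \<Longrightarrow> ltr cut i = ltr \<sigma> i" "i < b - N \<Longrightarrow> i \<in> edges cut \<longleftrightarrow> i \<in> edges \<sigma>"
    "i < b - N \<Longrightarrow> edge_at cut i = edge_at \<sigma> i"
  using assms in_pos[of i] in_pos[of "i + N"] in_pos[of "i + 1"] in_pos[of "i + 1 + N"] long' N_ge_2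
  by (auto simp: cut_def dcut_def edges_def edge_at_def)

lemma cut_right:
  assumes "a \<le> i"
  shows "i \<in> pos cut \<longleftrightarrow> i + N \<in> pos \<sigma>" "vtx cut i = vtx \<sigma> (i + N)" "dcut i = d\<sigma> (i + N) - 1"
    "ltr cut i = ltr \<sigma> (i + N)" "i \<in> edges cut \<longleftrightarrow> i + N \<in> edges \<sigma>"
    "edge_at cut i = edge_at \<sigma> (i + N)"
proof -
  have p: "j \<in> pos cut \<longleftrightarrow> j + N \<in> pos \<sigma>" if "a \<le> j" for j
    using that in_pos[of j] in_pos[of "j + N"] long' N_ge_2 by (auto simp: cut_def)
  show "i \<in> pos cut \<longleftrightarrow> i + N \<in> pos \<sigma>" using p assms by simp
  show e: "i \<in> edges cut \<longleftrightarrow> i + N \<in> edges \<sigma>"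
    using p[of i] p[of "i + 1"] assms by (simp add: edges_def ac_simps)
  have per: "vtx \<sigma> i = vtx \<sigma> (i + N)" "d\<sigma> i = d\<sigma> (i + N)" if "i \<le> b - N"
  proof -
    have "i \<in> {a..b}" "i + N \<in> {a..b}" using that assms N_ge_2 by auto
    then show "vtx \<sigma> i = vtx \<sigma> (i + N)" "d\<sigma> i = d\<sigma> (i + N)"
      using overlapD(2,3) U_periodic(1,4)[of i] by simp_all
  qed
  have per': "ltr \<sigma> i = ltr \<sigma> (i + N)" if "i < b - N"
  proof -
    have "i \<in> {a..<b}" "i + N \<in> {a..<b}" using that assms N_ge_2 by auto
    then show "ltr \<sigma> i = ltr \<sigma> (i + N)" using overlapD(4) U_periodic(2)[of i] by simp
  qed
  show "vtx cut i = vtx \<sigma> (i + N)" "dcut i = d\<sigma> (i + N) - 1"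
    using per by (simp_all add: cut_def dcut_def)
  show l: "ltr cut i = ltr \<sigma> (i + N)" using per' by (simp add: cut_def)
  show "edge_at cut i = edge_at \<sigma> (i + N)" using e l by (simp add: edge_at_def)
qed

text \<open>The only new pair of neighbours in \<open>cut\<close>; it occurs if the overlap is exactly one period long.\<close>

lemma junction_consecutive:
  assumes "b - N = a" "a - 1 \<in> edges \<sigma>" "b \<in> edges \<sigma>"
  shows "consecutive Q I (ltr \<sigma> (a - 1)) (ltr \<sigma> b)"
proof (rule ends_consecutive)
  have b: "b = a + N" using assms by simp
  have in_e: "a \<in> edges \<sigma>" "b - 1 \<in> edges \<sigma>"
    using in_pos N_ge_2 b by (auto simp: edges_def)
  have lb: "ltr U b = ltr \<sigma> a" "ltr U (a - 1) = ltr \<sigma> (b - 1)"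
    using overlapD(4)[of a] overlapD(4)[of "b - 1"] U_periodic(2)[of a] U_periodic(2)[of "a - 1"] N_ge_2 b
    by (auto simp: algebra_simps)
  note D = local_stringD[OF string]
  show "left_end (Some (ltr \<sigma> (a - 1))) (Some (ltr U (a - 1))) fL"
    "right_end (Some (ltr \<sigma> b)) (Some (ltr U b)) fR"
    using ends' assms by (simp_all add: edge_at_def)
  show "is_letter Q I (ltr \<sigma> (a - 1))" "is_letter Q I (ltr \<sigma> b)" using D(4) assms by auto
  show "is_letter Q I (ltr U (a - 1))" "is_letter Q I (ltr U b)"
    using local_stringD(4)[OF U_local] by (simp_all add: U_simps(2))
  have v: "vtx \<sigma> a = vtx U a" "vtx \<sigma> b = vtx U a"
    using overlapD(2)[of a] overlapD(2)[of b] overlapD(5) U_periodic(1)[of a] b by auto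
  show "rvertex Q (ltr \<sigma> (a - 1)) = vtx U a" using D(6)[of "a - 1"] assms v by simp
  show "lvertex Q (ltr \<sigma> b) = vtx U a" using D(5)[of b] assms v by simp
  show "rvertex Q (ltr U (a - 1)) = vtx U a" "lvertex Q (ltr U b) = vtx U a"
    using local_stringD(6)[OF U_local, of "a - 1"] local_stringD(5)[OF U_local, of b]
      U_periodic(1)[of a] b by (simp_all add: U_simps(2))
  show "consecutive Q I (ltr \<sigma> (a - 1)) (ltr U b)" unfolding lb using D(7)[of "a - 1"] assms in_e by simp
  show "consecutive Q I (ltr U (a - 1)) (ltr \<sigma> b)" unfolding lb using D(7)[of "b - 1"] assms in_e by simp
  have "ltr U (a - 1) = ltr U (b - 1)" using U_periodic(2)[of "a - 1"] b by (simp add: algebra_simps)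
  then show "consecutive Q I (ltr U (a - 1)) (ltr U b)"
    using local_stringD(7)[OF U_local, of "b - 1"] by (simp add: U_simps(2))
qed

lemma cut_local: "local_string cut"
  unfolding local_string_def
proof (intro conjI ballI impI subsetI)
  note D = local_stringD[OF string]
  show "pos cut \<noteq> {}" using cut_left(1)[of a] in_pos[of a] long' overlapD(5) by auto
  { fix i j k assume i: "i \<in> pos cut" and j: "j \<in> pos cut" and k: "k \<in> {i..j}"
    show "k \<in> pos cut"
    proof (cases "k \<le> b - N")
      case True
      then have "i \<in> pos \<sigma>" using cut_left(1)[of i] i k by simp
      then have "k \<in> pos \<sigma>" using D(2)[of i b k] in_pos[of b] overlapD(5) True k N_ge_2 by auto
      then show ?thesis using cut_left(1)[OF True] by simp
    next
      case False
      then have "j + N \<in> pos \<sigma>" using cut_right(1)[of j] j k long' by auto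
      then have "k + N \<in> pos \<sigma>" using D(2)[of b "j + N" "k + N"] in_pos[of b] overlapD(5) False k by auto
      then show ?thesis using cut_right(1)[of k] False long' by auto
    qed }
  fix i
  { assume "i \<in> pos cut"
    then show "vtx cut i \<in> verts Q"
      using cut_left(1,2)[of i] cut_right(1,2)[of i] D(3)[of i] D(3)[of "i + N"] long'
      by (cases "i \<le> b - N") auto }
  assume e: "i \<in> edges cut"
  show "is_letter Q I (ltr cut i)" "lvertex Q (ltr cut i) = vtx cut i" "rvertex Q (ltr cut i) = vtx cut (i + 1)"
  proof -
    have "is_letter Q I (ltr cut i) \<and> lvertex Q (ltr cut i) = vtx cut i \<and> rvertex Q (ltr cut i) = vtx cut (i + 1)"
    proof (cases "i < b - N")
      case True
      then show ?thesis using e cut_left[of i] cut_left(2)[of "i + 1"] D(4-6)[of i] by simp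
    next
      case False
      then have "a \<le> i" using long' by simp
      then show ?thesis using e cut_right[of i] cut_right(2)[of "i + 1"] D(4-6)[of "i + N"]
        by (simp add: ac_simps)
    qed
    then show "is_letter Q I (ltr cut i)" "lvertex Q (ltr cut i) = vtx cut i" "rvertex Q (ltr cut i) = vtx cut (i + 1)"
      by auto
  qed
  assume e2: "i + 1 \<in> edges cut"
  \<comment> \<open>The letters \<open>i\<close> and \<open>i + 1\<close> are neighbours in \<open>\<sigma>\<close> unless \<open>i\<close> is to the left of the overlap and
    \<open>i + 1\<close> to the right of the deleted period.\<close>
  consider "i + 1 < b - N" | "a \<le> i" | "i = a - 1" "b - N = a" using long' by linarith
  then show "consecutive Q I (ltr cut i) (ltr cut (i + 1))"
  proof cases
    case 1
    then show ?thesis using e e2 cut_left[of i] cut_left[of "i + 1"] D(7)[of i] by simp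
  next
    case 2
    then show ?thesis using e e2 cut_right[of i] cut_right[of "i + 1"] D(7)[of "i + N"]
      by (simp add: ac_simps)
  next
    case 3
    have l: "ltr cut i = ltr \<sigma> (a - 1)" "a - 1 \<in> edges \<sigma>"
      using e 3 cut_left(4,5)[of i] by auto
    have r: "ltr cut (i + 1) = ltr \<sigma> b" "b \<in> edges \<sigma>"
      using e2 3 cut_right(4,5)[of a] by (auto simp: algebra_simps)
    show ?thesis unfolding l r using junction_consecutive 3 l r by simp
  qed
qed

lemma cut_grading: "grading cut dcut"
  unfolding grading_def
proof
  fix i assume e: "i \<in> edges cut"
  have g: "d\<sigma> (j + 1) = (if is_direct (ltr \<sigma> j) then d\<sigma> j + 1 else d\<sigma> j - 1)" if "j \<in> edges \<sigma>" for j
    using grading_\<sigma> that by (auto simp: grading_def)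
  show "dcut (i + 1) = (if is_direct (ltr cut i) then dcut i + 1 else dcut i - 1)"
  proof (cases "i < b - N")
    case True
    then show ?thesis using e cut_left[of i] cut_left(3)[of "i + 1"] g[of i] by simp
  next
    case False
    then have "a \<le> i" using long' by simp
    then show ?thesis using e cut_right[of i] cut_right(3)[of "i + 1"] g[of "i + N"]
      by (simp add: ac_simps)
  qed
qed

end

section \<open>The embedding of the shortened string complex\<close>

context band_overlap
begin

text \<open>The components of the graph map from \<open>\<sigma>\<close> to \<open>U\<close>, and those of the graph map from \<open>cut\<close> to \<open>U\<close> with
the same end maps and scalars.\<close>

definition comp :: "int \<Rightarrow> (('v, 'a) qpath \<Rightarrow> 'k) set" where
  "comp i = component Q I \<sigma> a b fL fR (coef i) i"

definition cut_comp :: "int \<Rightarrow> (('v, 'a) qpath \<Rightarrow> 'k) set" where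
  "cut_comp i = component Q I cut a (b - N) fL fR (coef i) i"

lemma coef_sc: "i \<in> {a - 1..b} \<Longrightarrow> coef (i + 1) = coef i * sc i"
  unfolding sc_def by (rule coef_step)

lemma cut_overlap:
  "a \<le> b - N" "{a..b - N} \<subseteq> pos cut" "i \<in> {a..b - N} \<Longrightarrow> vtx cut i = vtx U i"
  "i \<in> {a..<b - N} \<Longrightarrow> ltr cut i = ltr U i" "i \<in> {a - 1..b - N} \<Longrightarrow> coef (i + 1) = coef i * sc i"
  "i \<in> {a..b - N} \<Longrightarrow> dcut i + 1 = dU i"
  "left_end (edge_at cut (a - 1)) (Some (ltr U (a - 1))) fL"
  "right_end (edge_at cut (b - N)) (Some (ltr U (b - N))) fR"
proof -
  show "a \<le> b - N" using long' by simp
  show "{a..b - N} \<subseteq> pos cut" using cut_left(1) in_pos N_ge_2 by auto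
  show "vtx cut i = vtx U i" if "i \<in> {a..b - N}"
    using that cut_left(2)[of i] overlapD(2)[of i] N_ge_2 by auto
  show "dcut i + 1 = dU i" if "i \<in> {a..b - N}"
    using that cut_left(3)[of i] overlapD(3)[of i] N_ge_2 by auto
  show "ltr cut i = ltr U i" if "i \<in> {a..<b - N}"
    using that cut_left(4)[of i] overlapD(4)[of i] N_ge_2 by auto
  show "coef (i + 1) = coef i * sc i" if "i \<in> {a - 1..b - N}" using that N_ge_2 by (intro coef_sc) auto
  show "left_end (edge_at cut (a - 1)) (Some (ltr U (a - 1))) fL"
    using ends'(1) cut_left(6)[of "a - 1"] long' by simp
  show "right_end (edge_at cut (b - N)) (Some (ltr U (b - N))) fR"
    using ends'(2) cut_right(6)[of "b - N"] long' U_periodic(2)[of "b - N"] by simp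
qed

lemma grading_shift: "grading w d \<Longrightarrow> grading w (\<lambda>i. d i + k)"
  by (auto simp: grading_def)

lemma
  shows comp_rarrow: "rarrow \<sigma> (\<lambda>_. 1) p \<cdot> comp (p + 1) = comp p \<cdot> rarrow U sc p" (is ?A)
    and comp_larrow: "larrow \<sigma> (\<lambda>_. 1) p \<cdot> comp p = comp (p + 1) \<cdot> larrow U sc p" (is ?B)
    and comp_proj: "comp p \<in> proj Q I (vtx U p)" (is ?C)
    and comp_pos: "comp p \<noteq> \<zero>\<^sub>\<Lambda> \<Longrightarrow> p \<in> pos \<sigma>"
    and comp_degree: "comp p \<noteq> \<zero>\<^sub>\<Lambda> \<Longrightarrow> d\<sigma> p = dU p"
    and comp_out: "p \<notin> {a - 1..b + 1} \<Longrightarrow> comp p = \<zero>\<^sub>\<Lambda>"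
    and comp_in: "p \<in> {a..b} \<Longrightarrow> comp p = idm (coef p) (vtx U p)"
proof -
  note * = overlap_squares[where w = \<sigma> and U = U and a = a and b = b and c = coef and sc = sc
      and fL = fL and fR = fR, folded comp_def,
      OF string U_local U_simps(1) overlapD(5) overlapD(1) overlapD(2) overlapD(4) ends' coef_sc sc_inverse]
  show ?A ?B ?C by (rule *; assumption)+
  show "p \<in> pos \<sigma>" if "comp p \<noteq> \<zero>\<^sub>\<Lambda>" by (rule *(4); (assumption | rule that))
  show "comp p = \<zero>\<^sub>\<Lambda>" if "p \<notin> {a - 1..b + 1}" by (rule *(6); (assumption | rule that))
  show "comp p = idm (coef p) (vtx U p)" if "p \<in> {a..b}" by (rule *(7); (assumption | rule that))
  show "d\<sigma> p = dU p" if "comp p \<noteq> \<zero>\<^sub>\<Lambda>"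
    by (rule *(5); (assumption | rule that grading_\<sigma> U_grading | (rule overlapD(3); assumption)))
qed

lemma
  shows cut_comp_rarrow: "rarrow cut (\<lambda>_. 1) p \<cdot> cut_comp (p + 1) = cut_comp p \<cdot> rarrow U sc p" (is ?A)
    and cut_comp_larrow: "larrow cut (\<lambda>_. 1) p \<cdot> cut_comp p = cut_comp (p + 1) \<cdot> larrow U sc p" (is ?B)
    and cut_comp_proj: "cut_comp p \<in> proj Q I (vtx U p)" (is ?C)
    and cut_comp_degree: "cut_comp p \<noteq> \<zero>\<^sub>\<Lambda> \<Longrightarrow> dcut p + 1 = dU p"
    and cut_comp_out: "p \<notin> {a - 1..b - N + 1} \<Longrightarrow> cut_comp p = \<zero>\<^sub>\<Lambda>"
    and cut_comp_in: "p \<in> {a..b - N} \<Longrightarrow> cut_comp p = idm (coef p) (vtx U p)"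
proof -
  note * = overlap_squares[where w = cut and U = U and a = a and b = "b - N" and c = coef and sc = sc
      and fL = fL and fR = fR, folded cut_comp_def,
      OF cut_local U_local U_simps(1) cut_overlap(1,2,3,4,7,8,5) sc_inverse]
  show ?A ?B ?C by (rule *; assumption)+
  show "cut_comp p = \<zero>\<^sub>\<Lambda>" if "p \<notin> {a - 1..b - N + 1}" by (rule *(6); (assumption | rule that))
  show "cut_comp p = idm (coef p) (vtx U p)" if "p \<in> {a..b - N}" by (rule *(7); (assumption | rule that))
  show "dcut p + 1 = dU p" if "cut_comp p \<noteq> \<zero>\<^sub>\<Lambda>"
    by (rule *(5)[where d = "\<lambda>i. dcut i + 1"]; (assumption | rule that grading_shift[OF cut_grading] U_grading
          | (rule cut_overlap(6); assumption)))
qed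

lemma comp_closed: "comp p \<in> carrier \<Lambda>" and cut_comp_closed: "cut_comp p \<in> carrier \<Lambda>"
  by (rule proj_carrier[OF comp_proj U_verts], rule proj_carrier[OF cut_comp_proj U_verts])

lemma cut_comp_eq_comp: "p \<le> b - N \<Longrightarrow> cut_comp p = comp p"
proof -
  assume p: "p \<le> b - N"
  consider "p \<in> {a..b - N}" | "p = a - 1" | "p < a - 1" using p by fastforce
  then show ?thesis
  proof cases
    case 1
    then have "p \<in> {a..b}" using N_ge_2 by simp
    then show ?thesis using cut_comp_in[OF 1] comp_in[of p] by simp
  next
    case 2 then show ?thesis by (simp add: cut_comp_def comp_def component_def)
  next
    case 3 then show ?thesis using cut_comp_out[of p] comp_out[of p] by simp
  qed
qed

text \<open>Both components are given by the right end map, but their scalars are one period apart.\<close>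

lemma cut_comp_right: "cut_comp (b - N + 1) \<cdot> scalar \<mu> = comp (b + 1)"
proof -
  have k: "cut_comp (b - N + 1) = end_map (coef (b - N + 1)) fR" using long' by (simp add: cut_comp_def component_def)
  have c: "comp (b + 1) = end_map (coef (b + 1)) fR" using overlapD(5) by (simp add: comp_def component_def)
  have coef: "coef (b + 1) = \<mu> * coef (b - N + 1)" using coef_period[of "b - N + 1"] long' by simp
  show ?thesis
  proof (cases fR)
    case None
    then show ?thesis using k c scalar_closed by simp
  next
    case (Some g)
    have "left_end (map_option flip (edge_at \<sigma> b)) (Some (flip (ltr U b))) (Some g)"
      using ends'(2) Some by (simp add: right_end_iff_left_end_flip)
    then have "valid g"
    proof (rule left_end_valid)
      show "is_letter Q I l" if "map_option flip (edge_at \<sigma> b) = Some l" for l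
        using that edge_at_letter(3)[OF string] by (auto simp: is_letter_flip)
      show "is_letter Q I l" if "Some (flip (ltr U b)) = Some l" for l
        using that local_stringD(4)[OF U_local, of b] by (auto simp: is_letter_flip U_simps(2))
    qed
    have k': "cut_comp (b - N + 1) = cls (coef (b - N + 1)) g" "comp (b + 1) = cls (coef (b + 1)) g"
      using k c Some by (simp_all only: option.case)
    show ?thesis
      using scalar_comm[OF cut_comp_closed, of \<mu> "b - N + 1"] scalar_cls[OF \<open>valid g\<close>] unfolding k' coef by simp
  qed
qed

text \<open>The coefficients of \<open>z p\<close> and of \<open>z (p - N)\<close> in \<open>phi z p\<close>.\<close>

definition own_coeff :: "int \<Rightarrow> (('v, 'a) qpath \<Rightarrow> 'k) set" where
  "own_coeff p = (if p < a then \<one>\<^bsub>\<Lambda>\<^esub> else if p \<le> b then cut_comp p \<cdot> scalar (1 / coef p) else \<zero>\<^sub>\<Lambda>)"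

definition back_coeff :: "int \<Rightarrow> (('v, 'a) qpath \<Rightarrow> 'k) set" where
  "back_coeff p = (if p < a then \<zero>\<^sub>\<Lambda> else if p \<le> b then \<ominus>\<^bsub>\<Lambda>\<^esub> (cut_comp (p - N) \<cdot> scalar (1 / coef p))
     else \<ominus>\<^bsub>\<Lambda>\<^esub> scalar (1 / \<mu>))"

text \<open>The word \<open>cut\<close> can be placed on \<open>\<sigma>\<close> in two ways, aligned with the part of \<open>\<sigma>\<close> to the left of the
overlap or, moved by \<open>N\<close>, with the part to the right. The map \<open>phi\<close> is the difference of the two,
scaled such that both have the same image in the band complex: it is \<open>z p\<close> to the left and
\<open>- \<mu>\<^sup>-\<^sup>1 z (p - N)\<close> to the right of the overlap, and it is given by \<open>phi_comp\<close> on the overlap, where \<open>comp\<close>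
is invertible.\<close>

definition phi :: "(int \<Rightarrow> (('v, 'a) qpath \<Rightarrow> 'k) set) \<Rightarrow> int \<Rightarrow> (('v, 'a) qpath \<Rightarrow> 'k) set" where
  "phi z = (\<lambda>p. z p \<cdot> own_coeff p \<oplus>\<^bsub>\<Lambda>\<^esub> z (p - N) \<cdot> back_coeff p)"

lemma own_coeff_back_coeff_closed: "own_coeff p \<in> carrier \<Lambda>" "back_coeff p \<in> carrier \<Lambda>"
  by (simp_all add: own_coeff_def back_coeff_def cut_comp_closed scalar_closed)

context
  fixes z :: "int \<Rightarrow> (('v, 'a) qpath \<Rightarrow> 'k) set"
  assumes z: "\<And>p. z p \<in> carrier \<Lambda>"
begin

lemma phi_left: "p < a \<Longrightarrow> phi z p = z p"
  using z by (simp add: phi_def own_coeff_def back_coeff_def)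

lemma phi_mid: "a \<le> p \<Longrightarrow> p \<le> b \<Longrightarrow>
    phi z p = (z p \<cdot> cut_comp p \<ominus>\<^bsub>\<Lambda>\<^esub> z (p - N) \<cdot> cut_comp (p - N)) \<cdot> scalar (1 / coef p)"
  using z cut_comp_closed scalar_closed
  by (simp add: phi_def own_coeff_def back_coeff_def \<Lambda>.minus_eq \<Lambda>.l_distr \<Lambda>.r_minus \<Lambda>.l_minus \<Lambda>.m_assoc)

lemma phi_right: "b < p \<Longrightarrow> phi z p = \<ominus>\<^bsub>\<Lambda>\<^esub> (z (p - N) \<cdot> scalar (1 / \<mu>))"
  using z scalar_closed overlapD(5) by (simp add: phi_def own_coeff_def back_coeff_def \<Lambda>.r_minus)

lemma phi_closed: "phi z p \<in> carrier \<Lambda>"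
  using z own_coeff_back_coeff_closed by (simp add: phi_def)

text \<open>With \<open>h p = z p \<cdot> cut_comp p\<close>, the right side is \<open>h p - h (p - N)\<close>. On the overlap this is the
definition of \<open>phi\<close>. To the left of it, \<open>comp\<close> and \<open>cut_comp\<close> agree and \<open>h (p - N)\<close> vanishes; at
\<open>b + 1\<close>, \<open>h p\<close> vanishes and the factor \<open>\<mu>\<close> between \<open>comp\<close> and \<open>cut_comp\<close> cancels the one in \<open>phi\<close>.\<close>

lemma phi_comp:
  "phi z p \<cdot> comp p = z p \<cdot> cut_comp p \<ominus>\<^bsub>\<Lambda>\<^esub> z (p - N) \<cdot> cut_comp (p - N)"
proof -
  consider "p < a" | "p \<in> {a..b}" | "p = b + 1" | "b + 1 < p" by fastforce
  then show ?thesis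
  proof cases
    case 1
    then have "cut_comp p = comp p" "cut_comp (p - N) = \<zero>\<^sub>\<Lambda>"
      using cut_comp_eq_comp[of p] cut_comp_out[of "p - N"] long' N_ge_2 by auto
    then show ?thesis using phi_left[OF 1] z cut_comp_closed[of p] by (simp add: \<Lambda>.minus_eq)
  next
    case 2
    let ?x = "z p \<cdot> cut_comp p \<ominus>\<^bsub>\<Lambda>\<^esub> z (p - N) \<cdot> cut_comp (p - N)"
    have "cut_comp (p - N) \<in> proj Q I (vtx U p)"
      using cut_comp_proj[of "p - N"] U_periodic(1)[of "p - N"] by simp
    then have x: "?x \<in> proj Q I (vtx U p)"
      using z cut_comp_proj U_verts by (simp add: \<Lambda>.minus_eq proj_closed)
    then have xc: "?x \<in> carrier \<Lambda>" using proj_carrier U_verts by blast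
    have "?x \<cdot> scalar (1 / coef p) \<cdot> idm (coef p) (vtx U p) = ?x \<cdot> scalar (1 / coef p) \<cdot> scalar (coef p)"
      using x U_verts by (intro proj_idm scalar_proj)
    also have "\<dots> = ?x" using xc coef_nonzero by (intro scalar_cancel) auto
    finally show ?thesis using phi_mid[of p] comp_in[OF 2] 2 by simp
  next
    case 3
    have 0: "cut_comp (b + 1) = \<zero>\<^sub>\<Lambda>" using cut_comp_out[of "b + 1"] N_ge_2 by simp
    have k: "b + 1 - N = b - N + 1" by simp
    have "z (b - N + 1) \<cdot> scalar (1 / \<mu>) \<cdot> (cut_comp (b - N + 1) \<cdot> scalar \<mu>) =
        z (b - N + 1) \<cdot> cut_comp (b - N + 1) \<cdot> scalar (1 / \<mu>) \<cdot> scalar \<mu>"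
      using z cut_comp_closed scalar_closed scalar_comm[OF cut_comp_closed, of "1 / \<mu>" "b - N + 1", symmetric]
      by (simp add: \<Lambda>.m_assoc[symmetric]) (simp add: \<Lambda>.m_assoc)
    also have "\<dots> = z (b - N + 1) \<cdot> cut_comp (b - N + 1)"
      using z cut_comp_closed mu by (intro scalar_cancel) auto
    finally show ?thesis
      unfolding 3 using phi_right[of "b + 1"] z cut_comp_closed scalar_closed
      by (simp add: 0 k cut_comp_right[symmetric] \<Lambda>.minus_eq \<Lambda>.l_minus)
  next
    case 4
    then have "comp p = \<zero>\<^sub>\<Lambda>" "cut_comp p = \<zero>\<^sub>\<Lambda>" "cut_comp (p - N) = \<zero>\<^sub>\<Lambda>"
      using comp_out[of p] cut_comp_out[of p] cut_comp_out[of "p - N"] N_ge_2 by auto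
    then show ?thesis using z phi_closed by (simp add: \<Lambda>.minus_eq)
  qed
qed

end

abbreviation "P\<^sub>\<sigma> \<equiv> string_complex Q I \<sigma> d\<sigma>"
abbreviation "P\<^sub>c \<equiv> string_complex Q I cut dcut"

lemma cut_obj_proj: "z \<in> obj P\<^sub>c n \<Longrightarrow> p \<in> pos cut \<Longrightarrow> z p \<in> proj Q I (vtx cut p)"
  unfolding string_obj using proj_closed(1)[OF local_stringD(3)[OF cut_local]] by metis

lemma cut_obj_closed: "z \<in> obj P\<^sub>c n \<Longrightarrow> z p \<in> carrier \<Lambda>"
  by (rule string_obj_closed[OF cut_local])

lemma cut_obj_zero: "z \<in> obj P\<^sub>c n \<Longrightarrow> \<not> (p \<in> pos cut \<and> dcut p = n) \<Longrightarrow> z p = \<zero>\<^sub>\<Lambda>"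
  unfolding string_obj by metis

text \<open>The formulas that define \<open>phi\<close> outside the overlap extend to its first and last vertex, because
\<open>N \<ge> 2\<close> keeps the other term at these vertices zero. Hence each of these formulas holds at both ends of
every letter outside the overlap.\<close>

lemma phi_at_a:
  assumes z: "z \<in> obj P\<^sub>c n" and p: "p = a" shows "phi z p = z p"
proof -
  note zc = cut_obj_closed[OF z]
  have a: "a \<in> {a..b - N}" "a \<in> pos cut" using cut_overlap(1,2) by auto
  have v: "z a \<in> proj Q I (vtx U a)" using cut_obj_proj[OF z a(2)] cut_overlap(3)[OF a(1)] by simp
  have "phi z a = z a \<cdot> idm (coef a) (vtx U a) \<cdot> scalar (1 / coef a)"
    using phi_mid[of z, OF zc, of a] overlapD(5) cut_comp_in[OF a(1)] cut_comp_out[of "a - N"] N_ge_2 zc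
      idm_closed[OF U_verts]
    by (simp add: \<Lambda>.minus_eq)
  also have "\<dots> = z a \<cdot> scalar (coef a) \<cdot> scalar (1 / coef a)"
    by (simp only: proj_idm[OF U_verts v])
  also have "\<dots> = z a" using zc coef_nonzero by (intro scalar_cancel) auto
  finally show ?thesis using p by simp
qed

lemma phi_at_b:
  assumes z: "z \<in> obj P\<^sub>c n" and p: "p = b"
  shows "phi z p = \<ominus>\<^bsub>\<Lambda>\<^esub> (z (p - N) \<cdot> scalar (1 / \<mu>))"
proof -
  note zc = cut_obj_closed[OF z]
  have i: "b - N \<in> {a..b - N}" "b - N \<in> pos cut" using cut_overlap(1,2) by auto
  have v: "z (b - N) \<in> proj Q I (vtx U (b - N))"
    using cut_obj_proj[OF z i(2)] cut_overlap(3)[OF i(1)] by simp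
  have cb: "coef b = \<mu> * coef (b - N)" using coef_period[of "b - N"] long' by simp
  have sc: "scalar (coef (b - N)) \<cdot> scalar (1 / coef b) = scalar (1 / \<mu>)"
    using coef_nonzero[of "b - N"] mu by (simp add: scalar_scalar cb)
  have "phi z b = (\<ominus>\<^bsub>\<Lambda>\<^esub> (z (b - N) \<cdot> idm (coef (b - N)) (vtx U (b - N)))) \<cdot> scalar (1 / coef b)"
    using phi_mid[of z, OF zc, of b] overlapD(5) cut_comp_in[OF i(1)] cut_comp_out[of b] N_ge_2 zc
      idm_closed[OF U_verts]
    by (simp add: \<Lambda>.minus_eq)
  also have "\<dots> = \<ominus>\<^bsub>\<Lambda>\<^esub> (z (b - N) \<cdot> scalar (coef (b - N)) \<cdot> scalar (1 / coef b))"
    unfolding proj_idm[OF U_verts v] using zc scalar_closed by (simp add: \<Lambda>.l_minus)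
  also have "\<dots> = \<ominus>\<^bsub>\<Lambda>\<^esub> (z (b - N) \<cdot> scalar (1 / \<mu>))"
    using zc scalar_closed sc by (simp add: \<Lambda>.m_assoc)
  finally show ?thesis using p by simp
qed

lemma phi_obj:
  assumes z: "z \<in> obj P\<^sub>c n" shows "phi z \<in> obj P\<^sub>\<sigma> (n + 1)"
  unfolding string_obj
proof
  fix p
  note zc = cut_obj_closed[OF z]
  show "if p \<in> pos \<sigma> \<and> d\<sigma> p = n + 1 then phi z p \<in> proj Q I (vtx \<sigma> p) else phi z p = \<zero>\<^sub>\<Lambda>"
  proof -
    consider "p < a" | "p \<in> {a..b}" | "b < p" by fastforce
    then show ?thesis
    proof cases
      case 1
      then have "p \<le> b - N" using long' by simp
      then show ?thesis
        using z[unfolded string_obj, rule_format, of p] phi_left[of z, OF zc 1] cut_left(1-3)[of p]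
        by (auto split: if_splits)
    next
      case 2
      have v: "vtx \<sigma> p = vtx U p" using overlapD(2)[OF 2] .
      have k: "cut_comp p \<in> proj Q I (vtx U p)" "cut_comp (p - N) \<in> proj Q I (vtx U p)"
        using cut_comp_proj[of p] cut_comp_proj[of "p - N"] U_periodic(1)[of "p - N"] by simp_all
      have pr: "phi z p \<in> proj Q I (vtx U p)"
        unfolding phi_mid[of z, OF zc, of p, OF 2[unfolded atLeastAtMost_iff, THEN conjunct1] 2[unfolded atLeastAtMost_iff, THEN conjunct2]]
        using k zc U_verts by (intro scalar_proj) (auto simp: \<Lambda>.minus_eq proj_closed)
      have zero: "phi z p = \<zero>\<^sub>\<Lambda>" if d: "d\<sigma> p \<noteq> n + 1"
      proof -
        have dU: "dU (p - N) = dU p" "d\<sigma> p = dU p" using U_periodic(4)[of "p - N"] overlapD(3)[OF 2] by auto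
        have "z q \<cdot> cut_comp q = \<zero>\<^sub>\<Lambda>" if "dU q = dU p" for q
        proof (cases "cut_comp q = \<zero>\<^sub>\<Lambda>")
          case False
          then have "dcut q \<noteq> n" using cut_comp_degree[of q] that d dU by simp
          then have "z q = \<zero>\<^sub>\<Lambda>" using cut_obj_zero[OF z] by simp
          then show ?thesis using cut_comp_closed by simp
        qed (use zc in simp)
        from this[of p] this[of "p - N"] show ?thesis
          using phi_mid[of z, OF zc, of p] 2 dU scalar_closed by (simp add: \<Lambda>.minus_eq)
      qed
      show ?thesis using pr zero v in_pos[of p] 2 by auto
    next
      case 3
      have "a \<le> p - N" using 3 long' by simp
      note r = cut_right(1-3)[OF this]
      show ?thesis
      proof (cases "p \<in> pos \<sigma> \<and> d\<sigma> p = n + 1")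
        case True
        then have "vtx \<sigma> p \<in> verts Q" using local_stringD(3)[OF string] by simp
        moreover have "z (p - N) \<in> proj Q I (vtx \<sigma> p)"
          using cut_obj_proj[OF z, of "p - N"] r True by simp
        ultimately show ?thesis using True phi_right[of z, OF zc 3] by (simp add: scalar_proj proj_closed)
      next
        case False
        then have "z (p - N) = \<zero>\<^sub>\<Lambda>" using cut_obj_zero[OF z, of "p - N"] r by auto
        then have "phi z p = \<zero>\<^sub>\<Lambda>" using phi_right[of z, OF zc 3] scalar_closed by simp
        then show ?thesis unfolding if_not_P[OF False] .
      qed
    qed
  qed
qed

lemma X_obj_closed: "x \<in> obj P\<^sub>\<sigma> n \<Longrightarrow> x p \<in> carrier \<Lambda>"
  by (rule string_obj_closed[OF string])

lemma X_obj_proj: "x \<in> obj P\<^sub>\<sigma> n \<Longrightarrow> p \<in> {a..b} \<Longrightarrow> x p \<in> proj Q I (vtx U p)"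
  unfolding string_obj using overlapD(2)[of p] in_pos[of p] proj_closed(1)[OF U_verts]
  by (metis atLeastAtMost_iff)

lemma X_comp_cancel:
  assumes "x \<in> obj P\<^sub>\<sigma> n" "p \<in> {a..b}"
  shows "x p \<cdot> comp p \<cdot> scalar (1 / coef p) = x p"
  unfolding comp_in[OF assms(2)] proj_idm[OF U_verts X_obj_proj[OF assms]]
  using X_obj_closed[OF assms(1)] coef_nonzero by (intro scalar_cancel) auto

lemma line_diff_U_periodic:
  assumes "\<And>p. u p \<in> carrier \<Lambda>"
  shows "line_diff U sc (\<lambda>p. u (p - N)) p = line_diff U sc u (p - N)"
proof -
  have e: "p - 1 - N + N = p - 1" "p - N + N = p" by auto
  have "rarrow U sc (p - 1 - N) = rarrow U sc (p - 1)" "larrow U sc (p - N) = larrow U sc p"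
    using U_periodic(2,3)[of "p - 1 - N"] U_periodic(2,3)[of "p - N"] unfolding e
    by (simp_all add: arrows_eq U_simps(2))
  then show ?thesis by (simp add: line_diff_def algebra_simps)
qed

lemma comp_diagonal:
  "(\<And>p. u p \<in> carrier \<Lambda>) \<Longrightarrow>
    line_diff U sc (\<lambda>p. u p \<cdot> comp p) p = line_diff \<sigma> (\<lambda>_. 1) u p \<cdot> comp p"
  by (rule line_diff_diagonal[OF string U_local comp_closed _ comp_rarrow comp_larrow])

lemma cut_comp_diagonal:
  "(\<And>p. u p \<in> carrier \<Lambda>) \<Longrightarrow>
    line_diff U sc (\<lambda>p. u p \<cdot> cut_comp p) p = line_diff cut (\<lambda>_. 1) u p \<cdot> cut_comp p"
  by (rule line_diff_diagonal[OF cut_local U_local cut_comp_closed _ cut_comp_rarrow cut_comp_larrow])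

text \<open>Outside the overlap, \<open>phi\<close> identifies the letters of \<open>cut\<close> with those of \<open>\<sigma>\<close>. On the overlap it
suffices to compare both sides after multiplication by \<open>comp\<close>, and there \<open>phi_comp\<close> expresses \<open>phi\<close> by
maps that commute with the differentials: multiplication by \<open>comp\<close> and by \<open>cut_comp\<close>, and the shift by one
period on \<open>U\<close>.\<close>

lemma phi_chain:
  assumes z: "z \<in> obj P\<^sub>c n"
  shows "phi (line_diff cut (\<lambda>_. 1) z) = line_diff \<sigma> (\<lambda>_. 1) (phi z)"
proof
  fix p
  let ?d = "line_diff cut (\<lambda>_. 1)" and ?e = "line_diff \<sigma> (\<lambda>_. 1)"
  note zc = cut_obj_closed[OF z]
  have dz: "?d z \<in> obj P\<^sub>c (n + 1)" by (rule line_diff_obj[OF cut_local cut_grading z])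
  have dzc: "?d z q \<in> carrier \<Lambda>" for q using line_diff_closed[OF cut_local zc] .
  have fz: "phi z \<in> obj P\<^sub>\<sigma> (n + 1)" by (rule phi_obj[OF z])
  have fzc: "phi z q \<in> carrier \<Lambda>" for q by (rule phi_closed[of z, OF zc])
  note rlc = arrows_closed[OF cut_local, of "\<lambda>_. 1"]
  consider "p < a" | "p \<in> {a..b}" | "b < p" by fastforce
  then show "phi (?d z) p = ?e (phi z) p"
  proof cases
    case 1
    have e: "edge_at cut (p - 1) = edge_at \<sigma> (p - 1)" "edge_at cut p = edge_at \<sigma> p"
      using cut_left(6)[of "p - 1"] cut_left(6)[of p] 1 long' by auto
    have "?e (phi z) p = ?e z p"
      using phi_left[of z, OF zc, of "p - 1"] phi_left[of z, OF zc, of "p + 1"] phi_at_a[OF z, of "p + 1"] 1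
      by (intro line_diff_cong) (cases "p + 1 = a"; simp)+
    also have "\<dots> = ?d z p" using e by (simp add: line_diff_def rarrow_def larrow_def)
    finally show ?thesis using phi_left[of "?d z", OF dzc 1] by simp
  next
    case 2
    have "?e (phi z) p \<cdot> comp p = line_diff U sc (\<lambda>p. phi z p \<cdot> comp p) p"
      by (rule comp_diagonal[OF fzc, symmetric])
    also have "\<dots> = line_diff U sc (\<lambda>p. z p \<cdot> cut_comp p \<ominus>\<^bsub>\<Lambda>\<^esub> z (p - N) \<cdot> cut_comp (p - N)) p"
      by (simp only: phi_comp[of z, OF zc])
    also have "\<dots> = line_diff U sc (\<lambda>p. z p \<cdot> cut_comp p) p
        \<ominus>\<^bsub>\<Lambda>\<^esub> line_diff U sc (\<lambda>p. z (p - N) \<cdot> cut_comp (p - N)) p"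
      using zc cut_comp_closed by (intro line_diff_minus[OF U_local]) auto
    also have "\<dots> = ?d z p \<cdot> cut_comp p \<ominus>\<^bsub>\<Lambda>\<^esub> ?d z (p - N) \<cdot> cut_comp (p - N)"
      using line_diff_U_periodic[of "\<lambda>p. z p \<cdot> cut_comp p" p] zc cut_comp_closed
      by (simp add: cut_comp_diagonal[OF zc])
    also have "\<dots> = phi (?d z) p \<cdot> comp p" by (rule phi_comp[of "?d z", OF dzc, symmetric])
    finally have eq: "?e (phi z) p \<cdot> comp p = phi (?d z) p \<cdot> comp p" .
    have "phi (?d z) p = phi (?d z) p \<cdot> comp p \<cdot> scalar (1 / coef p)"
      by (rule X_comp_cancel[OF phi_obj[OF dz] 2, symmetric])
    also have "\<dots> = ?e (phi z) p \<cdot> comp p \<cdot> scalar (1 / coef p)" by (simp only: eq)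
    also have "\<dots> = ?e (phi z) p"
      by (rule X_comp_cancel[OF line_diff_obj[OF string grading_\<sigma> fz] 2])
    finally show ?thesis .
  next
    case 3
    have e: "edge_at \<sigma> (p - 1) = edge_at cut (p - 1 - N)" "edge_at \<sigma> p = edge_at cut (p - N)"
      using cut_right(6)[of "p - 1 - N"] cut_right(6)[of "p - N"] 3 long' by auto
    let ?y = "\<lambda>q. \<ominus>\<^bsub>\<Lambda>\<^esub> (z (q - N) \<cdot> scalar (1 / \<mu>))"
    have "?e (phi z) p = ?e ?y p"
      using phi_right[of z, OF zc, of "p - 1"] phi_right[of z, OF zc, of "p + 1"] phi_at_b[OF z, of "p - 1"] 3
      by (intro line_diff_cong) (cases "p - 1 = b"; simp)+
    also have "\<dots> = \<ominus>\<^bsub>\<Lambda>\<^esub> (?e (\<lambda>q. z (q - N)) p \<cdot> scalar (1 / \<mu>))"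
      using zc scalar_closed line_diff_scalar[OF string, of "\<lambda>q. z (q - N)" "\<lambda>_. 1" "1 / \<mu>" p]
      by (subst line_diff_uminus[OF string]) auto
    also have "?e (\<lambda>q. z (q - N)) p = ?d z (p - N)"
      using e by (simp add: line_diff_def rarrow_def larrow_def algebra_simps)
    finally show ?thesis using phi_right[of "?d z", OF dzc 3] by simp
  qed
qed

lemma cut_comp_inj:
  assumes z: "z \<in> obj P\<^sub>c n" and p: "p \<in> {a..b - N}"
  shows "z p \<cdot> cut_comp p \<cdot> scalar (1 / coef p) = z p"
proof -
  have "z p \<in> proj Q I (vtx U p)"
    using cut_obj_proj[OF z, of p] cut_overlap(2,3) p by auto
  then show ?thesis
    unfolding cut_comp_in[OF p] using proj_idm[OF U_verts] scalar_cancel[OF cut_obj_closed[OF z], of "coef p" "1 / coef p" p] coef_nonzero[of p]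
    by simp
qed

text \<open>By \<open>phi_comp\<close>, \<open>phi z\<close> determines \<open>h p - h (p - N)\<close> for \<open>h p = z p \<cdot> cut_comp p\<close>, hence \<open>h\<close>, since
\<open>h\<close> vanishes to the left of \<open>a - 1\<close>; and \<open>h\<close> determines \<open>z\<close> where \<open>cut_comp\<close> is invertible.
Elsewhere \<open>z\<close> is a value of \<open>phi z\<close>, up to a scalar.\<close>

lemma phi_inj: "inj_on phi (obj P\<^sub>c n)"
proof (rule inj_onI, rule ext)
  fix z z' p assume z: "z \<in> obj P\<^sub>c n" "z' \<in> obj P\<^sub>c n" and eq: "phi z = phi z'"
  note zc = cut_obj_closed[OF z(1)] and zc' = cut_obj_closed[OF z(2)]
  have h: "z p \<cdot> cut_comp p = z' p \<cdot> cut_comp p" for p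
  proof (induction "nat (p - a + 2)" arbitrary: p rule: less_induct)
    case less
    show ?case
    proof (cases "p < a - 1")
      case True
      then show ?thesis using cut_comp_out[of p] zc zc' by simp
    next
      case False
      then have IH: "z (p - N) \<cdot> cut_comp (p - N) = z' (p - N) \<cdot> cut_comp (p - N)"
        using N_ge_2 by (intro less) auto
      have "z p \<cdot> cut_comp p = phi z p \<cdot> comp p \<oplus>\<^bsub>\<Lambda>\<^esub> z (p - N) \<cdot> cut_comp (p - N)"
        unfolding phi_comp[of z, OF zc] using zc cut_comp_closed by (simp add: \<Lambda>.minus_eq \<Lambda>.a_assoc \<Lambda>.l_neg)
      also have "\<dots> = z' p \<cdot> cut_comp p"
        unfolding IH eq phi_comp[of z', OF zc'] using zc' cut_comp_closed by (simp add: \<Lambda>.minus_eq \<Lambda>.a_assoc \<Lambda>.l_neg)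
      finally show ?thesis .
    qed
  qed
  consider "p < a" | "p \<in> {a..b - N}" | "b - N < p" by fastforce
  then show "z p = z' p"
  proof cases
    case 1
    then show ?thesis using phi_left[of z, OF zc 1] phi_left[of z', OF zc' 1] eq by simp
  next
    case 2
    have "z p = z p \<cdot> cut_comp p \<cdot> scalar (1 / coef p)" by (rule cut_comp_inj[OF z(1) 2, symmetric])
    also have "\<dots> = z' p \<cdot> cut_comp p \<cdot> scalar (1 / coef p)" by (simp only: h)
    also have "\<dots> = z' p" by (rule cut_comp_inj[OF z(2) 2])
    finally show ?thesis .
  next
    case 3
    then have "b < p + N" by simp
    from phi_right[of z, OF zc this] phi_right[of z', OF zc' this] eq
    have "\<ominus>\<^bsub>\<Lambda>\<^esub> (z p \<cdot> scalar (1 / \<mu>)) = \<ominus>\<^bsub>\<Lambda>\<^esub> (z' p \<cdot> scalar (1 / \<mu>))" by simp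
    from arg_cong[OF this, of "\<lambda>x. \<ominus>\<^bsub>\<Lambda>\<^esub> x"]
    have e: "z p \<cdot> scalar (1 / \<mu>) = z' p \<cdot> scalar (1 / \<mu>)"
      by (simp only: \<Lambda>.minus_minus \<Lambda>.m_closed zc zc' scalar_closed)
    have "1 / \<mu> * \<mu> = 1" using mu by simp
    note c = scalar_cancel[OF zc this] scalar_cancel[OF zc' this]
    have "z p = z p \<cdot> scalar (1 / \<mu>) \<cdot> scalar \<mu>" by (rule c(1)[symmetric])
    also have "\<dots> = z' p \<cdot> scalar (1 / \<mu>) \<cdot> scalar \<mu>" by (simp only: e)
    also have "\<dots> = z' p" by (rule c(2))
    finally show ?thesis .
  qed
qed

end

section \<open>The band complex\<close>

context band_overlap
begin

abbreviation "B\<^sub>\<tau> \<equiv> band_complex Q I \<tau> m \<mu> d\<tau>"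

text \<open>An element of the band complex as a periodic function on the positions of \<open>U\<close>.\<close>

definition unroll :: "(int \<Rightarrow> (('v, 'a) qpath \<Rightarrow> 'k) set) \<Rightarrow> int \<Rightarrow> (('v, 'a) qpath \<Rightarrow> 'k) set" where
  "unroll y q = y ((q + t) mod N)"

lemma N_pos: "0 < N" using N_ge_2 by simp

lemma mod_shift_eq_iff: "(i + t) mod N = (q + t) mod N \<longleftrightarrow> i mod N = q mod N"
  by (simp add: mod_eq_dvd_iff)

lemma unrolled_index:
  assumes "j \<in> {0..<N}" shows "(j - t + t) mod N = j"
  using assms by simp

lemma band_ext:
  assumes "\<And>j. j \<notin> {0..<N} \<Longrightarrow> y j = \<zero>\<^sub>\<Lambda>" "\<And>j. j \<notin> {0..<N} \<Longrightarrow> y' j = \<zero>\<^sub>\<Lambda>" "unroll y = unroll y'"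
  shows "y = y'"
proof
  fix j
  show "y j = y' j"
  proof (cases "j \<in> {0..<N}")
    case True
    then show ?thesis using fun_cong[OF assms(3), of "j - t"] unrolled_index[OF True] by (simp add: unroll_def)
  qed (simp add: assms)
qed

lemma band_obj: "y \<in> obj B\<^sub>\<tau> n \<longleftrightarrow>
    unroll y \<in> obj (string_complex Q I U dU) n \<and> (\<forall>j. j \<notin> {0..<N} \<longrightarrow> y j = \<zero>\<^sub>\<Lambda>)"
proof -
  let ?P = "\<lambda>j. if d\<tau> j = n then y j \<in> proj Q I (vtx (unfolding_word Q \<tau>) j) else y j = \<zero>\<^sub>\<Lambda>"
  have "y \<in> obj B\<^sub>\<tau> n \<longleftrightarrow> (\<forall>j\<in>{0..<N}. ?P j) \<and> (\<forall>j. j \<notin> {0..<N} \<longrightarrow> y j = \<zero>\<^sub>\<Lambda>)"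
    unfolding band_complex_def Let_def diagram_obj N_def by (auto; metis)
  moreover have "(\<forall>j\<in>{0..<N}. ?P j) \<longleftrightarrow> (\<forall>q. ?P ((q + t) mod N))"
  proof
    assume h: "\<forall>j\<in>{0..<N}. ?P j"
    show "\<forall>q. ?P ((q + t) mod N)"
    proof
      fix q show "?P ((q + t) mod N)" using N_pos by (intro h[rule_format]) simp
    qed
  next
    assume h: "\<forall>q. ?P ((q + t) mod N)"
    show "\<forall>j\<in>{0..<N}. ?P j"
    proof
      fix j assume j: "j \<in> {0..<N}"
      have "?P ((j - t + t) mod N)" by (rule h[THEN spec])
      then show "?P j" unfolding unrolled_index[OF j] .
    qed
  qed
  moreover have "?P ((q + t) mod N) \<longleftrightarrow>
      (if dU q = n then unroll y q \<in> proj Q I (vtx U q) else unroll y q = \<zero>\<^sub>\<Lambda>)" for q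
  proof -
    have "dU ((q + t) mod N - t) = dU q"
      by (rule periodic_mod[where g = dU, OF U_periodic(4)]) (simp add: mod_diff_left_eq)
    moreover have "vtx (unfolding_word Q \<tau>) ((q + t) mod N) = vtx U q"
      by (simp add: U_simps unfolding_word_def N_def)
    ultimately show ?thesis by (simp add: unroll_def dU_def)
  qed
  ultimately show ?thesis unfolding string_obj U_simps(1) by simp
qed

lemma unroll_closed: "(\<And>j. y j \<in> carrier \<Lambda>) \<Longrightarrow> unroll y q \<in> carrier \<Lambda>"
  by (simp add: unroll_def)

lemma band_fun_module: "fun_module \<Lambda> (obj B\<^sub>\<tau> n)"
proof -
  have "vtx (unfolding_word Q \<tau>) i \<in> verts Q" for i
    using U_verts[of "i - t"] by (simp add: U_simps unfolding_word_def N_def)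
  then show ?thesis unfolding band_complex_def Let_def by (intro diagram_fun_module)
qed

lemma band_obj_closed: "y \<in> obj B\<^sub>\<tau> n \<Longrightarrow> y j \<in> carrier \<Lambda>"
  using \<Lambda>.fun_moduleD(1)[OF band_fun_module] .

lemma band_diff_outside: "j \<notin> {0..<N} \<Longrightarrow> diff B\<^sub>\<tau> n y j = \<zero>\<^sub>\<Lambda>"
proof -
  assume j: "j \<notin> {0..<N}"
  have "(k + 1) mod N \<in> {0..<N}" for k using N_pos by simp
  then have e: "{k \<in> {0..<N}. (if is_direct (ltr (unfolding_word Q \<tau>) k) then (k + 1) mod N else k) = j} = {}"
    using j by (auto split: if_splits)
  show ?thesis
    unfolding band_complex_def Let_def diagram_complex_def cplx.simps N_def[symmetric] e by simp
qed

text \<open>The cyclic diagram has at least two vertices, so a vertex receives the same two contributions in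
the band as it does in its unfolding.\<close>

lemma band_diff:
  assumes y: "\<And>j. y j \<in> carrier \<Lambda>"
  shows "unroll (diff B\<^sub>\<tau> n y) = line_diff U sc (unroll y)"
proof
  fix q
  let ?u = "unfolding_word Q \<tau>" and ?j = "(q + t) mod N" and ?k = "(q - 1 + t) mod N"
  let ?tgt = "\<lambda>k. if is_direct (ltr ?u k) then (k + 1) mod N else k"
  let ?src = "\<lambda>k. if is_direct (ltr ?u k) then k else (k + 1) mod N"
  let ?g = "\<lambda>k. y (?src k) \<cdot> cls (band_scalar \<tau> m \<mu> k) (lpath (ltr ?u k))"
  let ?S = "{k \<in> {0..<N}. ?tgt k = ?j}"
  note cl = arrows_closed[OF U_local, of sc]
  have range: "?j \<in> {0..<N}" "?k \<in> {0..<N}" using N_pos by auto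
  have kj: "(?k + 1) mod N = ?j" unfolding mod_add_left_eq by (simp add: algebra_simps)
  have jk: "(?j + 1) mod N = (q + 1 + t) mod N" unfolding mod_add_left_eq by (simp add: algebra_simps)
  have ne: "?k \<noteq> ?j"
  proof
    assume "?k = ?j"
    then have "N dvd (q - 1 + t) - (q + t)" by (simp add: mod_eq_dvd_iff)
    then show False using N_ge_2 zdvd_not_zless[of 1 N] by simp
  qed
  have S: "?S \<subseteq> {?k, ?j}"
  proof
    fix k assume k: "k \<in> ?S"
    show "k \<in> {?k, ?j}"
    proof (cases "is_direct (ltr ?u k)")
      case True
      then have "(k + 1) mod N = (q + t) mod N" using k by simp
      then have "k mod N = (q + t - 1) mod N"
        by (simp add: mod_eq_dvd_iff algebra_simps)
      then show ?thesis using k by (simp add: algebra_simps)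
    next
      case False
      then show ?thesis using k by auto
    qed
  qed
  have letter: "ltr ?u ?k = ltr U (q - 1)" "ltr ?u ?j = ltr U q"
    "band_scalar \<tau> m \<mu> ?k = sc (q - 1)" "band_scalar \<tau> m \<mu> ?j = sc q"
    by (simp_all add: U_simps unfolding_word_def sc_def band_scalar_def N_def)
  have "unroll (diff B\<^sub>\<tau> n y) q = finsum \<Lambda> ?g ?S"
    unfolding unroll_def band_complex_def Let_def diagram_complex_def cplx.simps N_def by (rule refl)
  also have "\<dots> = unroll y (q - 1) \<cdot> rarrow U sc (q - 1) \<oplus>\<^bsub>\<Lambda>\<^esub> unroll y (q + 1) \<cdot> larrow U sc q"
  proof (rule finsum_two[OF finite_subset[OF S] S ne])
    show "unroll y (q - 1) \<cdot> rarrow U sc (q - 1) \<in> carrier \<Lambda>" "unroll y (q + 1) \<cdot> larrow U sc q \<in> carrier \<Lambda>"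
      using cl unroll_closed[OF y] by simp_all
    have k_iff: "?k \<in> ?S \<longleftrightarrow> is_direct (ltr U (q - 1))" using range(2) kj ne letter(1) by simp
    have j_iff: "?j \<in> ?S \<longleftrightarrow> \<not> is_direct (ltr U q)"
    proof -
      have "(?j + 1) mod N \<noteq> ?j"
      proof
        assume "(?j + 1) mod N = ?j"
        then have "N dvd (q + 1 + t) - (q + t)" unfolding jk by (simp add: mod_eq_dvd_iff)
        then show False using N_ge_2 zdvd_not_zless[of 1 N] by simp
      qed
      then show ?thesis using range(1) letter(2) by simp
    qed
    show "?g ?k = unroll y (q - 1) \<cdot> rarrow U sc (q - 1)" if "?k \<in> ?S"
      using that unfolding k_iff by (simp only: letter if_True unroll_def arrows_eq U_simps(2) UNIV_I simp_thms)
    show "?g ?j = unroll y (q + 1) \<cdot> larrow U sc q" if "?j \<in> ?S"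
      using that unfolding j_iff by (simp only: letter if_False if_True unroll_def arrows_eq U_simps(2) UNIV_I simp_thms jk not_False_eq_True)
    show "unroll y (q - 1) \<cdot> rarrow U sc (q - 1) = \<zero>\<^sub>\<Lambda>" if "?k \<notin> ?S"
      using that unroll_closed[OF y] unfolding k_iff by (simp add: arrows_eq)
    show "unroll y (q + 1) \<cdot> larrow U sc q = \<zero>\<^sub>\<Lambda>" if "?j \<notin> ?S"
      using that unroll_closed[OF y] unfolding j_iff by (simp add: arrows_eq)
  qed simp
  finally show "unroll (diff B\<^sub>\<tau> n y) q = line_diff U sc (unroll y) q" by (simp add: line_diff_def)
qed

lemma band_diff_obj:
  assumes y: "y \<in> obj B\<^sub>\<tau> n" shows "diff B\<^sub>\<tau> n y \<in> obj B\<^sub>\<tau> (n + 1)"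
  unfolding band_obj band_diff[OF band_obj_closed[OF y]]
  using line_diff_obj[OF U_local U_grading, of "unroll y" n sc] y band_diff_outside
  unfolding band_obj by auto

lemma band_diff_diff:
  assumes y: "y \<in> obj B\<^sub>\<tau> n" shows "diff B\<^sub>\<tau> (n + 1) (diff B\<^sub>\<tau> n y) = (\<lambda>_. \<zero>\<^sub>\<Lambda>)"
proof (rule band_ext)
  show "unroll (diff B\<^sub>\<tau> (n + 1) (diff B\<^sub>\<tau> n y)) = unroll (\<lambda>_. \<zero>\<^sub>\<Lambda>)"
    unfolding band_diff[OF band_obj_closed[OF band_diff_obj[OF y]]] band_diff[OF band_obj_closed[OF y]]
    using line_diff_line_diff[OF U_local, of "unroll y" sc] unroll_closed[of y] band_obj_closed[OF y]
    by (simp add: unroll_def[of "\<lambda>_. \<zero>\<^sub>\<Lambda>"] fun_eq_iff)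
qed (simp_all add: band_diff_outside)

lemma band_diff_module_map: "module_map \<Lambda> (obj B\<^sub>\<tau> n) (obj B\<^sub>\<tau> (n + 1)) (diff B\<^sub>\<tau> n)"
proof (rule \<Lambda>.two_term_module_map[OF band_fun_module])
  let ?A = "\<lambda>j. if j \<in> {0..<N} then rarrow U sc (j - t - 1) else \<zero>\<^sub>\<Lambda>"
  let ?B = "\<lambda>j. if j \<in> {0..<N} then larrow U sc (j - t) else \<zero>\<^sub>\<Lambda>"
  show "?A j \<in> carrier \<Lambda>" "?B j \<in> carrier \<Lambda>" for j using arrows_closed[OF U_local] by auto
  fix y assume y: "y \<in> obj B\<^sub>\<tau> n"
  then show "diff B\<^sub>\<tau> n y \<in> obj B\<^sub>\<tau> (n + 1)" by (rule band_diff_obj)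
  show "diff B\<^sub>\<tau> n y = (\<lambda>j. y ((j - 1) mod N) \<cdot> ?A j \<oplus>\<^bsub>\<Lambda>\<^esub> y ((j + 1) mod N) \<cdot> ?B j)"
  proof
    fix j
    show "diff B\<^sub>\<tau> n y j = y ((j - 1) mod N) \<cdot> ?A j \<oplus>\<^bsub>\<Lambda>\<^esub> y ((j + 1) mod N) \<cdot> ?B j"
    proof (cases "j \<in> {0..<N}")
      case True
      have "diff B\<^sub>\<tau> n y j = unroll (diff B\<^sub>\<tau> n y) (j - t)" using unrolled_index[OF True] by (simp add: unroll_def)
      also have "\<dots> = line_diff U sc (unroll y) (j - t)" by (simp only: band_diff[OF band_obj_closed[OF y]])
      finally show ?thesis using True by (simp add: line_diff_def unroll_def algebra_simps)
    next
      case False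
      then show ?thesis
        unfolding if_not_P[OF False] band_diff_outside[OF False] using band_obj_closed[OF y] by simp
    qed
  qed
qed

text \<open>Summation of \<open>y\<close> over a residue class, the projection from the unfolded to the cyclic diagram. The
window \<open>A, \<dots>, B\<close> makes the sum finite; where \<open>y\<close> vanishes outside a window, the window may be changed
(\<open>fold_sum_extend\<close>).\<close>

definition fold_sum :: "int \<Rightarrow> int \<Rightarrow> (int \<Rightarrow> (('v, 'a) qpath \<Rightarrow> 'k) set) \<Rightarrow> int \<Rightarrow> (('v, 'a) qpath \<Rightarrow> 'k) set" where
  "fold_sum A B y q = finsum \<Lambda> y {i \<in> {A..B}. i mod N = q mod N}"

lemma finite_residues: "finite {i \<in> {A..B}. i mod N = q mod (N::int)}"
  by (rule finite_subset[of _ "{A..B}"]) auto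

lemma fold_sum_closed: "(\<And>p. y p \<in> carrier \<Lambda>) \<Longrightarrow> fold_sum A B y q \<in> carrier \<Lambda>"
  unfolding fold_sum_def by (intro \<Lambda>.finsum_closed) auto

lemma fold_sum_extend:
  assumes y: "\<And>p. y p \<in> carrier \<Lambda>" and z: "\<And>p. p \<in> {A'..B'} \<Longrightarrow> p \<notin> {A..B} \<Longrightarrow> p mod N = q mod N \<Longrightarrow> y p = \<zero>\<^sub>\<Lambda>"
    and "A' \<le> A" "B \<le> B'"
  shows "fold_sum A' B' y q = fold_sum A B y q"
  unfolding fold_sum_def
  using assms by (intro \<Lambda>.add.finprod_mono_neutral_cong_left[symmetric] finite_residues) auto

lemma fold_sum_shift: 
  assumes "\<And>p. y p \<in> carrier \<Lambda>"
  shows "fold_sum A B (\<lambda>i. y (i - s)) q = fold_sum (A - s) (B - s) y (q - s)"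
proof -
  have inj: "inj_on (\<lambda>i. i - s) {i \<in> {A..B}. i mod N = q mod N}" by (auto simp: inj_on_def)
  have "(\<lambda>i. i - s) ` {i \<in> {A..B}. i mod N = q mod N} = {i \<in> {A - s..B - s}. i mod N = (q - s) mod N}"
  proof (intro equalityI subsetI)
    fix i assume "i \<in> {i \<in> {A - s..B - s}. i mod N = (q - s) mod N}"
    then have "i + s \<in> {i \<in> {A..B}. i mod N = q mod N}"
      by (auto simp: mod_eq_dvd_iff algebra_simps)
    then show "i \<in> (\<lambda>i. i - s) ` {i \<in> {A..B}. i mod N = q mod N}" by (intro image_eqI[of _ _ "i + s"]) auto
  qed (auto simp: mod_eq_dvd_iff)
  then show ?thesis
    unfolding fold_sum_def using \<Lambda>.finsum_reindex[OF _ inj, of y] assms by simp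
qed

lemma fold_sum_add:
  assumes "\<And>p. y p \<in> carrier \<Lambda>" "\<And>p. y' p \<in> carrier \<Lambda>"
  shows "fold_sum A B (\<lambda>i. y i \<oplus>\<^bsub>\<Lambda>\<^esub> y' i) q = fold_sum A B y q \<oplus>\<^bsub>\<Lambda>\<^esub> fold_sum A B y' q"
  unfolding fold_sum_def using assms by (intro \<Lambda>.finsum_addf) auto

lemma fold_sum_mult:
  assumes "\<And>p. y p \<in> carrier \<Lambda>" "r \<in> carrier \<Lambda>" "\<And>p. p mod N = q mod N \<Longrightarrow> g p = r"
  shows "fold_sum A B (\<lambda>i. y i \<cdot> g i) q = fold_sum A B y q \<cdot> r"
proof -
  have "fold_sum A B (\<lambda>i. y i \<cdot> g i) q = finsum \<Lambda> (\<lambda>i. y i \<cdot> r) {i \<in> {A..B}. i mod N = q mod N}"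
    unfolding fold_sum_def using assms by (intro \<Lambda>.add.finprod_cong') auto
  also have "\<dots> = fold_sum A B y q \<cdot> r"
    unfolding fold_sum_def using assms by (intro \<Lambda>.finsum_ldistr[symmetric] finite_residues) auto
  finally show ?thesis .
qed

lemma fold_sum_zero: "(\<And>p. p \<in> {A..B} \<Longrightarrow> p mod N = q mod N \<Longrightarrow> y p = \<zero>\<^sub>\<Lambda>) \<Longrightarrow> fold_sum A B y q = \<zero>\<^sub>\<Lambda>"
  unfolding fold_sum_def by (intro \<Lambda>.add.finprod_one_eqI) auto

text \<open>The maps given by the letters of \<open>U\<close> are periodic, so they can be taken out of the sum over a
residue class.\<close>

lemma fold_sum_line_diff:
  assumes y: "\<And>p. y p \<in> carrier \<Lambda>" and z: "\<And>p. p \<notin> {A..B} \<Longrightarrow> y p = \<zero>\<^sub>\<Lambda>"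
    and z': "\<And>p. p \<notin> {A..B} \<Longrightarrow> line_diff U sc y p = \<zero>\<^sub>\<Lambda>"
  shows "fold_sum A B (line_diff U sc y) q = line_diff U sc (fold_sum A B y) q"
proof -
  note cl = arrows_closed[OF U_local, of sc]
  have per: "rarrow U sc i = rarrow U sc j" "larrow U sc i = larrow U sc j" if "i mod N = j mod N" for i j
  proof -
    have e: "rarrow U sc (i + N) = rarrow U sc i" "larrow U sc (i + N) = larrow U sc i" for i
      using U_periodic(2,3)[of i] by (simp_all add: arrows_eq U_simps(2))
    show "rarrow U sc i = rarrow U sc j" by (rule periodic_mod[where g = "rarrow U sc", OF e(1) that])
    show "larrow U sc i = larrow U sc j" by (rule periodic_mod[where g = "larrow U sc", OF e(2) that])
  qed
  let ?R = "\<lambda>i. y i \<cdot> rarrow U sc i" and ?L = "\<lambda>i. y i \<cdot> larrow U sc (i - 1)"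
  have RL: "?R i \<in> carrier \<Lambda>" "?L i \<in> carrier \<Lambda>" for i using y cl by simp_all
  have "fold_sum A B (line_diff U sc y) q = fold_sum (A - 1) (B + 1) (line_diff U sc y) q"
    using line_diff_closed[OF U_local y] z' by (intro fold_sum_extend[symmetric]) auto
  also have "line_diff U sc y = (\<lambda>i. ?R (i - 1) \<oplus>\<^bsub>\<Lambda>\<^esub> ?L (i - (- 1)))"
    by (simp add: line_diff_def)
  also have "fold_sum (A - 1) (B + 1) \<dots> q =
      fold_sum (A - 1) (B + 1) (\<lambda>i. ?R (i - 1)) q \<oplus>\<^bsub>\<Lambda>\<^esub> fold_sum (A - 1) (B + 1) (\<lambda>i. ?L (i - (- 1))) q"
    by (rule fold_sum_add[where y = "\<lambda>i. ?R (i - 1)" and y' = "\<lambda>i. ?L (i - (- 1))"]) (rule RL)+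
  also have "fold_sum (A - 1) (B + 1) (\<lambda>i. ?R (i - 1)) q = fold_sum (A - 1 - 1) (B + 1 - 1) ?R (q - 1)"
    by (rule fold_sum_shift[where y = ?R]) (rule RL)
  also have "\<dots> = fold_sum A B ?R (q - 1)"
    using RL z cl by (intro fold_sum_extend) auto
  also have "\<dots> = fold_sum A B y (q - 1) \<cdot> rarrow U sc (q - 1)"
    by (rule fold_sum_mult[OF y cl(1)]) (rule per(1))
  also have "fold_sum (A - 1) (B + 1) (\<lambda>i. ?L (i - (- 1))) q = fold_sum (A - 1 - (- 1)) (B + 1 - (- 1)) ?L (q - (- 1))"
    by (rule fold_sum_shift[where y = ?L]) (rule RL)
  also have "\<dots> = fold_sum A B ?L (q + 1)"
    using RL z cl by (simp, intro fold_sum_extend) auto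
  also have "\<dots> = fold_sum A B y (q + 1) \<cdot> larrow U sc q"
  proof (rule fold_sum_mult[OF y cl(2)])
    fix p assume "p mod N = (q + 1) mod N"
    then have "(p - 1) mod N = q mod N" by (simp add: mod_eq_dvd_iff algebra_simps)
    then show "larrow U sc (p - 1) = larrow U sc q" by (rule per)
  qed
  finally show ?thesis by (simp add: line_diff_def)
qed

end

section \<open>The graph map and its kernel\<close>

context band_overlap
begin

text \<open>The graph map to the band complex: the diagonal map given by \<open>comp\<close>, followed by summation over
residue classes.\<close>

definition graph_map :: "(int \<Rightarrow> (('v, 'a) qpath \<Rightarrow> 'k) set) \<Rightarrow> int \<Rightarrow> (('v, 'a) qpath \<Rightarrow> 'k) set" where
  "graph_map u = (\<lambda>j. finsum \<Lambda> (\<lambda>i. u i \<cdot> comp i) {i \<in> {a - 1..b + 1}. (i + t) mod N = j})"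

text \<open>Every residue class has exactly one representative in the last period of the overlap, where \<open>comp\<close>
is invertible.\<close>

definition splitting :: "(int \<Rightarrow> (('v, 'a) qpath \<Rightarrow> 'k) set) \<Rightarrow> int \<Rightarrow> (('v, 'a) qpath \<Rightarrow> 'k) set" where
  "splitting y = (\<lambda>p. y ((p + t) mod N) \<cdot> (if p \<in> {b - N + 1..b} then scalar (1 / coef p) else \<zero>\<^sub>\<Lambda>))"

lemma unroll_graph_map: "unroll (graph_map u) q = fold_sum (a - 1) (b + 1) (\<lambda>i. u i \<cdot> comp i) q"
  unfolding unroll_def graph_map_def fold_sum_def mod_shift_eq_iff ..

lemma graph_map_outside: "j \<notin> {0..<N} \<Longrightarrow> graph_map u j = \<zero>\<^sub>\<Lambda>"
proof -
  assume j: "j \<notin> {0..<N}"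
  have "(i + t) mod N \<in> {0..<N}" for i using N_pos by simp
  then have e: "{i \<in> {a - 1..b + 1}. (i + t) mod N = j} = {}" using j by blast
  show ?thesis unfolding graph_map_def e by simp
qed

lemma term_proj:
  assumes "\<And>i. u i \<in> carrier \<Lambda>" "p mod N = q mod N"
  shows "u p \<cdot> comp p \<in> proj Q I (vtx U q)"
proof -
  have "vtx U p = vtx U q" by (rule periodic_mod[where g = "vtx U", OF U_periodic(1) assms(2)])
  then show ?thesis using comp_proj[of p] proj_closed(4)[OF U_verts assms(1)] by simp
qed

lemma term_degree:
  assumes u: "u \<in> obj P\<^sub>\<sigma> n" and "p mod N = q mod N" "dU q \<noteq> n"
  shows "u p \<cdot> comp p = \<zero>\<^sub>\<Lambda>"
proof (cases "comp p = \<zero>\<^sub>\<Lambda>")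
  case True
  then show ?thesis using X_obj_closed[OF u] by simp
next
  case False
  have "dU p = dU q" by (rule periodic_mod[where g = dU, OF U_periodic(4) assms(2)])
  then have "d\<sigma> p \<noteq> n" using comp_degree[OF False] assms(3) by simp
  then have "u p = \<zero>\<^sub>\<Lambda>" using u unfolding string_obj by metis
  then show ?thesis using comp_closed by simp
qed

lemma fold_sum_proj:
  assumes "\<And>p. p \<in> {A..B} \<Longrightarrow> p mod N = q mod N \<Longrightarrow> y p \<in> proj Q I (vtx U q)"
  shows "fold_sum A B y q \<in> proj Q I (vtx U q)"
  unfolding fold_sum_def using assms by (intro finsum_proj[OF U_verts] finite_residues) auto

lemma graph_map_obj:
  assumes u: "u \<in> obj P\<^sub>\<sigma> n" shows "graph_map u \<in> obj B\<^sub>\<tau> n"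
  unfolding band_obj
proof (intro conjI allI impI)
  show "unroll (graph_map u) \<in> obj (string_complex Q I U dU) n"
    unfolding string_obj U_simps(1) unroll_graph_map
  proof
    fix q
    let ?y = "\<lambda>i. u i \<cdot> comp i"
    have 1: "fold_sum (a - 1) (b + 1) ?y q \<in> proj Q I (vtx U q)"
      using term_proj[of u] X_obj_closed[OF u] by (intro fold_sum_proj) auto
    have 2: "fold_sum (a - 1) (b + 1) ?y q = \<zero>\<^sub>\<Lambda>" if "dU q \<noteq> n"
      using term_degree[OF u _ that] by (intro fold_sum_zero)
    show "if q \<in> UNIV \<and> dU q = n then fold_sum (a - 1) (b + 1) ?y q \<in> proj Q I (vtx U q)
        else fold_sum (a - 1) (b + 1) ?y q = \<zero>\<^sub>\<Lambda>"
      using 1 2 by (cases "dU q = n") simp_all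
  qed
qed (rule graph_map_outside)

lemma graph_map_module_map: "module_map \<Lambda> (obj P\<^sub>\<sigma> n) (obj B\<^sub>\<tau> n) graph_map"
  unfolding module_map_def
proof (intro conjI ballI funcsetI)
  fix u assume u: "u \<in> obj P\<^sub>\<sigma> n"
  then show "graph_map u \<in> obj B\<^sub>\<tau> n" by (rule graph_map_obj)
  { fix v assume v: "v \<in> obj P\<^sub>\<sigma> n"
    show "graph_map (\<lambda>i. u i \<oplus>\<^bsub>\<Lambda>\<^esub> v i) = (\<lambda>j. graph_map u j \<oplus>\<^bsub>\<Lambda>\<^esub> graph_map v j)"
    proof
      fix j
      let ?S = "{i \<in> {a - 1..b + 1}. (i + t) mod N = j}"
      have "graph_map (\<lambda>i. u i \<oplus>\<^bsub>\<Lambda>\<^esub> v i) j = finsum \<Lambda> (\<lambda>i. u i \<cdot> comp i \<oplus>\<^bsub>\<Lambda>\<^esub> v i \<cdot> comp i) ?S"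
        unfolding graph_map_def
        using X_obj_closed[OF u] X_obj_closed[OF v] comp_closed by (simp add: \<Lambda>.l_distr)
      also have "\<dots> = graph_map u j \<oplus>\<^bsub>\<Lambda>\<^esub> graph_map v j"
        unfolding graph_map_def using X_obj_closed[OF u] X_obj_closed[OF v] comp_closed
        by (intro \<Lambda>.finsum_addf) auto
      finally show "graph_map (\<lambda>i. u i \<oplus>\<^bsub>\<Lambda>\<^esub> v i) j = graph_map u j \<oplus>\<^bsub>\<Lambda>\<^esub> graph_map v j" .
    qed }
next
  fix r u assume r: "r \<in> carrier \<Lambda>" and u: "u \<in> obj P\<^sub>\<sigma> n"
  show "graph_map (\<lambda>i. r \<cdot> u i) = (\<lambda>j. r \<cdot> graph_map u j)"
  proof
    fix j
    let ?S = "{i \<in> {a - 1..b + 1}. (i + t) mod N = j}"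
    have fin: "finite ?S" by (rule finite_subset[of _ "{a - 1..b + 1}"]) auto
    have "graph_map (\<lambda>i. r \<cdot> u i) j = finsum \<Lambda> (\<lambda>i. r \<cdot> (u i \<cdot> comp i)) ?S"
      unfolding graph_map_def using X_obj_closed[OF u] comp_closed r by (simp add: \<Lambda>.m_assoc)
    also have "\<dots> = r \<cdot> graph_map u j"
      unfolding graph_map_def using X_obj_closed[OF u] comp_closed r fin
      by (intro \<Lambda>.finsum_rdistr[symmetric]) auto
    finally show "graph_map (\<lambda>i. r \<cdot> u i) j = r \<cdot> graph_map u j" .
  qed
qed

lemma graph_map_chain:
  assumes u: "u \<in> obj P\<^sub>\<sigma> n"
  shows "graph_map (line_diff \<sigma> (\<lambda>_. 1) u) = diff B\<^sub>\<tau> n (graph_map u)"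
proof (rule band_ext)
  note uc = X_obj_closed[OF u]
  let ?y = "\<lambda>i. u i \<cdot> comp i"
  have y: "?y p \<in> carrier \<Lambda>" for p using uc comp_closed by simp
  have dy: "line_diff U sc ?y = (\<lambda>p. line_diff \<sigma> (\<lambda>_. 1) u p \<cdot> comp p)"
    by (rule ext) (rule comp_diagonal[OF uc])
  show "unroll (graph_map (line_diff \<sigma> (\<lambda>_. 1) u)) = unroll (diff B\<^sub>\<tau> n (graph_map u))"
  proof
    fix q
    have "unroll (graph_map (line_diff \<sigma> (\<lambda>_. 1) u)) q = fold_sum (a - 1) (b + 1) (line_diff U sc ?y) q"
      unfolding unroll_graph_map dy ..
    also have "\<dots> = line_diff U sc (fold_sum (a - 1) (b + 1) ?y) q"
    proof (rule fold_sum_line_diff[where y = ?y])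
      show "?y p \<in> carrier \<Lambda>" for p by (rule y)
      show "?y p = \<zero>\<^sub>\<Lambda>" if "p \<notin> {a - 1..b + 1}" for p using comp_out[OF that] uc by simp
      show "line_diff U sc ?y p = \<zero>\<^sub>\<Lambda>" if "p \<notin> {a - 1..b + 1}" for p
        using comp_out[OF that] line_diff_closed[OF string, of u "\<lambda>_. 1" p] uc unfolding dy by simp
    qed
    also have "\<dots> = line_diff U sc (unroll (graph_map u)) q"
      using unroll_graph_map[of u, abs_def] by (simp add: line_diff_def unroll_graph_map)
    also have "\<dots> = unroll (diff B\<^sub>\<tau> n (graph_map u)) q"
      by (simp only: band_diff[OF band_obj_closed[OF graph_map_obj[OF u]]])
    finally show "unroll (graph_map (line_diff \<sigma> (\<lambda>_. 1) u)) q = unroll (diff B\<^sub>\<tau> n (graph_map u)) q" .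
  qed
qed (simp_all add: graph_map_outside band_diff_outside)

lemma splitting_obj:
  assumes y: "y \<in> obj B\<^sub>\<tau> n" shows "splitting y \<in> obj P\<^sub>\<sigma> n"
  unfolding string_obj
proof
  fix p
  note yc = band_obj_closed[OF y]
  show "if p \<in> pos \<sigma> \<and> d\<sigma> p = n then splitting y p \<in> proj Q I (vtx \<sigma> p) else splitting y p = \<zero>\<^sub>\<Lambda>"
  proof (cases "p \<in> {b - N + 1..b}")
    case True
    then have p: "p \<in> {a..b}" using long' by simp
    then have v: "vtx \<sigma> p = vtx U p" "d\<sigma> p = dU p" "p \<in> pos \<sigma>" using overlapD(2,3) in_pos by auto
    have "unroll y \<in> obj (string_complex Q I U dU) n" using y unfolding band_obj by simp
    then have u: "if dU p = n then unroll y p \<in> proj Q I (vtx U p) else unroll y p = \<zero>\<^sub>\<Lambda>"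
      unfolding string_obj U_simps(1) by simp
    have s: "splitting y p = unroll y p \<cdot> scalar (1 / coef p)" using True by (simp add: splitting_def unroll_def)
    show ?thesis
      using u v scalar_proj[OF U_verts] scalar_closed unfolding s by (cases "dU p = n") simp_all
  next
    case False
    then have s: "splitting y p = \<zero>\<^sub>\<Lambda>" unfolding splitting_def if_not_P[OF False] using yc by simp
    show ?thesis unfolding s using proj_closed(1)[OF local_stringD(3)[OF string]] by simp
  qed
qed

lemma splitting_module_map: "module_map \<Lambda> (obj B\<^sub>\<tau> n) (obj P\<^sub>\<sigma> n) splitting"
proof (rule \<Lambda>.two_term_module_map[OF band_fun_module, where B = "\<lambda>_. \<zero>\<^sub>\<Lambda>"])
  let ?A = "\<lambda>p. if p \<in> {b - N + 1..b} then scalar (1 / coef p) else \<zero>\<^sub>\<Lambda>"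
  show c: "?A p \<in> carrier \<Lambda>" for p using scalar_closed by simp
  show "\<zero>\<^sub>\<Lambda> \<in> carrier \<Lambda>" for p :: int by simp
  fix y assume y: "y \<in> obj B\<^sub>\<tau> n"
  show "splitting y \<in> obj P\<^sub>\<sigma> n" by (rule splitting_obj[OF y])
  show "splitting y = (\<lambda>p. y ((p + t) mod N) \<cdot> ?A p \<oplus>\<^bsub>\<Lambda>\<^esub> y ((p + t) mod N) \<cdot> \<zero>\<^sub>\<Lambda>)"
    unfolding splitting_def using \<Lambda>.m_closed[OF band_obj_closed[OF y] c] band_obj_closed[OF y]
    by (simp only: \<Lambda>.r_null \<Lambda>.r_zero)
qed

lemma graph_map_splitting:
  assumes y: "y \<in> obj B\<^sub>\<tau> n" shows "graph_map (splitting y) = y"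
proof (rule band_ext)
  note yc = band_obj_closed[OF y]
  show "y j = \<zero>\<^sub>\<Lambda>" if "j \<notin> {0..<N}" for j using y that unfolding band_obj by simp
  show "unroll (graph_map (splitting y)) = unroll y"
  proof
    fix q
    let ?p = "b - (b - q) mod N"
    let ?y = "\<lambda>i. splitting y i \<cdot> comp i"
    have pin: "?p \<in> {b - N + 1..b}"
      using pos_mod_bound[OF N_pos, of "b - q"] pos_mod_sign[OF N_pos, of "b - q"] by simp
    have pq: "?p mod N = q mod N" by (simp add: mod_diff_right_eq)
    have S: "{i \<in> {b - N + 1..b}. i mod N = q mod N} = {?p}"
    proof (intro equalityI subsetI)
      fix i assume i: "i \<in> {i \<in> {b - N + 1..b}. i mod N = q mod N}"
      then have "i mod N = ?p mod N" using pq by simp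
      then have "N dvd i - ?p" by (simp only: mod_eq_dvd_iff)
      moreover have "\<bar>i - ?p\<bar> < N" using i pin unfolding mem_Collect_eq atLeastAtMost_iff by linarith
      ultimately have "i - ?p = 0" using zdvd_imp_le[of N "\<bar>i - ?p\<bar>"] by fastforce
      then show "i \<in> {?p}" by simp
    qed (use pin pq in auto)
    have sc: "splitting y i \<in> carrier \<Lambda>" for i using X_obj_closed[OF splitting_obj[OF y]] .
    have yin: "?y i \<in> carrier \<Lambda>" for i using sc comp_closed by simp
    have "unroll (graph_map (splitting y)) q = fold_sum (b - N + 1) b ?y q"
      unfolding unroll_graph_map
    proof (rule fold_sum_extend[where y = ?y])
      show "?y p \<in> carrier \<Lambda>" for p by (rule yin)
      show "?y p = \<zero>\<^sub>\<Lambda>" if "p \<notin> {b - N + 1..b}" for p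
        unfolding splitting_def if_not_P[OF that] using yc comp_closed by simp
    qed (use long' in auto)
    also have "\<dots> = ?y ?p"
      unfolding fold_sum_def S using \<Lambda>.finsum_insert[of "{}" ?p ?y] yin by simp
    also have "\<dots> = unroll y q"
    proof -
      have p: "?p \<in> {a..b}" using pin long' by simp
      have e: "y ((?p + t) mod N) = unroll y q" using pq mod_shift_eq_iff[of ?p q] by (simp add: unroll_def)
      have v: "vtx U ?p = vtx U q" by (rule periodic_mod[where g = "vtx U", OF U_periodic(1) pq])
      have "unroll y \<in> obj (string_complex Q I U dU) n" using y unfolding band_obj by simp
      then have "(if dU q = n then unroll y q \<in> proj Q I (vtx U q) else unroll y q = \<zero>\<^sub>\<Lambda>)"
        unfolding string_obj U_simps(1) by simp
      then have u: "unroll y q \<in> proj Q I (vtx U q)"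
        using proj_closed(1)[OF U_verts] by (cases "dU q = n") simp_all
      have "?y ?p = unroll y q \<cdot> scalar (1 / coef ?p) \<cdot> idm (coef ?p) (vtx U q)"
        unfolding splitting_def if_P[OF pin] comp_in[OF p] e v ..
      also have "\<dots> = unroll y q \<cdot> scalar (1 / coef ?p) \<cdot> scalar (coef ?p)"
        by (rule proj_idm[OF U_verts scalar_proj[OF U_verts u]])
      also have "\<dots> = unroll y q" using unroll_closed[OF yc] coef_nonzero by (intro scalar_cancel) auto
      finally show ?thesis .
    qed
    finally show "unroll (graph_map (splitting y)) q = unroll y q" .
  qed
qed (rule graph_map_outside)

text \<open>By \<open>phi_comp\<close>, the sum over a residue class telescopes. Summands are lost at neither
end of the window: \<open>h\<close> vanishes outside \<open>a - 1, \<dots>, b - N + 1\<close>.\<close>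

lemma graph_map_phi:
  assumes z: "z \<in> obj P\<^sub>c n" shows "graph_map (phi z) = (\<lambda>_. \<zero>\<^sub>\<Lambda>)"
proof (rule band_ext)
  note zc = cut_obj_closed[OF z]
  let ?h = "\<lambda>p. z p \<cdot> cut_comp p"
  have h: "?h p \<in> carrier \<Lambda>" for p using zc cut_comp_closed by simp
  have h0: "?h p = \<zero>\<^sub>\<Lambda>" if "p \<notin> {a - 1..b - N + 1}" for p using cut_comp_out[OF that] zc by simp
  show "unroll (graph_map (phi z)) = unroll (\<lambda>_. \<zero>\<^sub>\<Lambda>)"
  proof
    fix q
    have "unroll (graph_map (phi z)) q = fold_sum (a - 1) (b + 1) (\<lambda>i. ?h i \<oplus>\<^bsub>\<Lambda>\<^esub> \<ominus>\<^bsub>\<Lambda>\<^esub> \<one>\<^bsub>\<Lambda>\<^esub> \<cdot> ?h (i - N)) q"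
      unfolding unroll_graph_map phi_comp[of z, OF zc] using h by (simp add: \<Lambda>.minus_eq \<Lambda>.l_minus)
    also have "\<dots> = fold_sum (a - 1) (b + 1) ?h q \<oplus>\<^bsub>\<Lambda>\<^esub> fold_sum (a - 1) (b + 1) (\<lambda>i. \<ominus>\<^bsub>\<Lambda>\<^esub> \<one>\<^bsub>\<Lambda>\<^esub> \<cdot> ?h (i - N)) q"
      using h by (intro fold_sum_add) auto
    also have "fold_sum (a - 1) (b + 1) (\<lambda>i. \<ominus>\<^bsub>\<Lambda>\<^esub> \<one>\<^bsub>\<Lambda>\<^esub> \<cdot> ?h (i - N)) q = \<ominus>\<^bsub>\<Lambda>\<^esub> \<one>\<^bsub>\<Lambda>\<^esub> \<cdot> fold_sum (a - 1) (b + 1) (\<lambda>i. ?h (i - N)) q"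
      unfolding fold_sum_def using h by (intro \<Lambda>.finsum_rdistr[symmetric] finite_residues) auto
    also have "fold_sum (a - 1) (b + 1) (\<lambda>i. ?h (i - N)) q = fold_sum (a - 1 - N) (b + 1 - N) ?h (q - N)"
      by (rule fold_sum_shift[where y = ?h]) (rule h)
    also have "\<dots> = fold_sum (a - 1) (b - N + 1) ?h (q - N)"
      using N_pos by (intro fold_sum_extend[where y = ?h] h h0) auto
    also have "\<dots> = fold_sum (a - 1) (b - N + 1) ?h q" by (simp add: fold_sum_def)
    also have "fold_sum (a - 1) (b + 1) ?h q = fold_sum (a - 1) (b - N + 1) ?h q"
      using N_pos by (intro fold_sum_extend[where y = ?h] h h0) auto
    finally show "unroll (graph_map (phi z)) q = unroll (\<lambda>_. \<zero>\<^sub>\<Lambda>) q"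
      using fold_sum_closed[where y = ?h, OF h] by (simp add: unroll_def \<Lambda>.l_minus \<Lambda>.r_neg)
  qed
qed (simp_all add: graph_map_outside)

text \<open>For \<open>y = x \<cdot> comp\<close>, let \<open>T p\<close> be the sum of \<open>y\<close> over the positions up to \<open>p\<close> in the residue
class of \<open>p\<close>. Then \<open>T p - T (p - N) = y p\<close>, so a preimage \<open>z\<close> of \<open>x\<close> has to satisfy \<open>z \<cdot> cut_comp = T\<close>. This is
solvable where \<open>cut_comp\<close> is invertible. At \<open>b - N + 1\<close> and beyond it is consistent with the values of \<open>z\<close>
that are prescribed to the right of the overlap, because the total sums \<open>graph_map x\<close> vanish.\<close>

lemma phi_surj:
  assumes x: "x \<in> obj P\<^sub>\<sigma> (n + 1)" and Fx: "graph_map x = (\<lambda>_. \<zero>\<^sub>\<Lambda>)"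
  shows "\<exists>z\<in>obj P\<^sub>c n. phi z = x"
proof -
  note xc = X_obj_closed[OF x]
  define y where "y p = x p \<cdot> comp p" for p
  have yc: "y p \<in> carrier \<Lambda>" for p using xc comp_closed by (simp add: y_def)
  define T where "T p = fold_sum (a - 1) p y p" for p
  have Tc: "T p \<in> carrier \<Lambda>" for p unfolding T_def by (rule fold_sum_closed[OF yc])
  have total: "fold_sum (a - 1) (b + 1) y q = \<zero>\<^sub>\<Lambda>" for q
  proof -
    have "unroll (graph_map x) q = \<zero>\<^sub>\<Lambda>" unfolding Fx unroll_def ..
    then show ?thesis unfolding unroll_graph_map y_def[abs_def] .
  qed
  have T_low: "T p = \<zero>\<^sub>\<Lambda>" if "p < a - 1" for p
    unfolding T_def using that by (intro fold_sum_zero) auto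
  have T_rec: "T p = T (p - N) \<oplus>\<^bsub>\<Lambda>\<^esub> y p" if "a - 1 \<le> p" for p
  proof -
    have S: "{i \<in> {a - 1..p}. i mod N = p mod N} = insert p {i \<in> {a - 1..p - N}. i mod N = p mod N}"
    proof (intro equalityI subsetI)
      fix i assume i: "i \<in> {i \<in> {a - 1..p}. i mod N = p mod N}"
      then have "p mod N = i mod N" by simp
      then have "N dvd p - i" by (simp only: mod_eq_dvd_iff)
      then have "p = i \<or> N \<le> p - i" using i zdvd_imp_le[of N "p - i"] by fastforce
      then show "i \<in> insert p {i \<in> {a - 1..p - N}. i mod N = p mod N}" using i by auto
    qed (use that N_pos in auto)
    have "T p = finsum \<Lambda> y (insert p {i \<in> {a - 1..p - N}. i mod N = p mod N})"
      unfolding T_def fold_sum_def S ..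
    also have "\<dots> = y p \<oplus>\<^bsub>\<Lambda>\<^esub> finsum \<Lambda> y {i \<in> {a - 1..p - N}. i mod N = p mod N}"
      using yc N_pos by (intro \<Lambda>.finsum_insert finite_residues) auto
    also have "finsum \<Lambda> y {i \<in> {a - 1..p - N}. i mod N = p mod N} = T (p - N)"
      unfolding T_def fold_sum_def by simp
    finally show ?thesis using \<Lambda>.a_comm[OF yc Tc] by simp
  qed
  have T_high: "T p = \<zero>\<^sub>\<Lambda>" if "b + 2 - N \<le> p" "p \<le> b + 1" for p
  proof -
    have "fold_sum (a - 1) (b + 1) y p = fold_sum (a - 1) p y p"
    proof (rule fold_sum_extend[where y = y, OF yc])
      fix i assume i: "i \<in> {a - 1..b + 1}" "i \<notin> {a - 1..p}" "i mod N = p mod N"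
      then have "N dvd i - p" by (simp only: mod_eq_dvd_iff)
      then have "N \<le> i - p" using i zdvd_imp_le[of N "i - p"] by auto
      then show "y i = \<zero>\<^sub>\<Lambda>" using i that by auto
    qed (use that in auto)
    then show ?thesis unfolding T_def using total by simp
  qed
  have T_proj: "T p \<in> proj Q I (vtx U p)" for p
    unfolding T_def y_def[abs_def] using term_proj[of x] xc by (intro fold_sum_proj) auto
  have T_degree: "T p = \<zero>\<^sub>\<Lambda>" if "dU p \<noteq> n + 1" for p
    unfolding T_def y_def[abs_def] using term_degree[OF x _ that] by (intro fold_sum_zero)
  \<comment> \<open>The only choice: outside \<open>a, \<dots>, b - N\<close> the values are forced by the definition of \<open>phi\<close>, inside by \<open>T\<close>.\<close>
  define z where "z p = (if p < a then x p else if p \<le> b - N then T p \<cdot> scalar (1 / coef p)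
      else \<ominus>\<^bsub>\<Lambda>\<^esub> (x (p + N) \<cdot> scalar \<mu>))" for p
  have zc: "z p \<in> carrier \<Lambda>" for p using xc Tc scalar_closed by (simp add: z_def)
  have h: "z p \<cdot> cut_comp p = T p" if p: "p \<le> b + 1" for p
  proof -
    consider "p < a - 1" | "p = a - 1" | "p \<in> {a..b - N}" | "p = b - N + 1" | "b - N + 1 < p"
      by fastforce
    then show ?thesis
    proof cases
      case 1
      then show ?thesis using cut_comp_out[of p] zc T_low by simp
    next
      case 2
      then have "z p \<cdot> cut_comp p = y p" using cut_comp_eq_comp[of p] long' by (simp add: z_def y_def)
      also have "\<dots> = T p" using T_rec[of p] T_low[of "p - N"] 2 N_pos yc by simp
      finally show ?thesis .
    next
      case 3
      then have "z p = T p \<cdot> scalar (1 / coef p)" by (simp add: z_def)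
      then have "z p \<cdot> cut_comp p = T p \<cdot> scalar (1 / coef p) \<cdot> scalar (coef p)"
        unfolding cut_comp_in[OF 3] using proj_idm[OF U_verts scalar_proj[OF U_verts T_proj]] by simp
      also have "\<dots> = T p" using Tc coef_nonzero by (intro scalar_cancel) auto
      finally show ?thesis .
    next
      case 4
      have zp: "z p = \<ominus>\<^bsub>\<Lambda>\<^esub> (x (b + 1) \<cdot> scalar \<mu>)" using 4 long' by (simp add: z_def)
      have "x (b + 1) \<cdot> scalar \<mu> \<cdot> cut_comp p = y (b + 1)"
        unfolding y_def cut_comp_right[symmetric] 4 using xc scalar_closed cut_comp_closed
          scalar_comm[OF cut_comp_closed, of \<mu> "b - N + 1"] by (simp add: \<Lambda>.m_assoc)
      then have hp: "z p \<cdot> cut_comp p = \<ominus>\<^bsub>\<Lambda>\<^esub> y (b + 1)"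
        unfolding zp using xc scalar_closed cut_comp_closed by (simp add: \<Lambda>.l_minus)
      have e: "b + 1 - N = p" using 4 by simp
      have "T p \<oplus>\<^bsub>\<Lambda>\<^esub> y (b + 1) = \<zero>\<^sub>\<Lambda>"
        using T_rec[of "b + 1"] T_high[of "b + 1"] N_ge_2 overlapD(5) unfolding e by simp
      then have "\<ominus>\<^bsub>\<Lambda>\<^esub> y (b + 1) = T p" using Tc yc by (intro \<Lambda>.minus_equality) auto
      then show ?thesis using hp by simp
    next
      case 5
      then show ?thesis using cut_comp_out[of p] zc T_high[of p] p by simp
    qed
  qed
  have zobj: "z \<in> obj P\<^sub>c n"
    unfolding string_obj
  proof
    fix p
    show "if p \<in> pos cut \<and> dcut p = n then z p \<in> proj Q I (vtx cut p) else z p = \<zero>\<^sub>\<Lambda>"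
    proof -
      consider "p < a" | "p \<in> {a..b - N}" | "b - N < p" by fastforce
      then show ?thesis
      proof cases
        case 1
        then have "p \<le> b - N" using long' by simp
        then show ?thesis
          using x[unfolded string_obj, THEN spec, of p] cut_left(1-3)[of p] 1 by (auto simp: z_def split: if_splits)
      next
        case 2
        then have zp: "z p = T p \<cdot> scalar (1 / coef p)" by (simp add: z_def)
        have pc: "p \<in> pos cut" "vtx cut p = vtx U p" "dcut p + 1 = dU p"
          using cut_overlap(2,3,6) 2 by auto
        show ?thesis
        proof (cases "dcut p = n")
          case True
          then show ?thesis using pc scalar_proj[OF U_verts T_proj] unfolding zp by simp
        next
          case False
          then have "T p = \<zero>\<^sub>\<Lambda>" using T_degree[of p] pc by simp
          then show ?thesis using False scalar_closed unfolding zp by simp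
        qed
      next
        case 3
        then have zp: "z p = \<ominus>\<^bsub>\<Lambda>\<^esub> (x (p + N) \<cdot> scalar \<mu>)" using long' by (simp add: z_def)
        have "a \<le> p" using 3 long' by simp
        note r = cut_right(1-3)[OF this]
        note xp = x[unfolded string_obj, THEN spec, of "p + N"]
        show ?thesis
        proof (cases "p \<in> pos cut \<and> dcut p = n")
          case True
          then have v: "vtx \<sigma> (p + N) \<in> verts Q" "x (p + N) \<in> proj Q I (vtx \<sigma> (p + N))"
            using local_stringD(3)[OF string] r xp by auto
          then show ?thesis unfolding if_P[OF True] zp r(2) by (intro proj_closed(3) scalar_proj)
        next
          case False
          then have "x (p + N) = \<zero>\<^sub>\<Lambda>" using r xp by (auto split: if_splits)
          then show ?thesis unfolding if_not_P[OF False] zp using scalar_closed by simp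
        qed
      qed
    qed
  qed
  have "phi z = x"
  proof
    fix p
    consider "p < a" | "a \<le> p" "p \<le> b" | "b < p" by linarith
    then show "phi z p = x p"
    proof cases
      case 1
      then show ?thesis using phi_left[of z, OF zc 1] by (simp add: z_def)
    next
      case 2
      have "z p \<cdot> cut_comp p \<ominus>\<^bsub>\<Lambda>\<^esub> z (p - N) \<cdot> cut_comp (p - N) = T p \<ominus>\<^bsub>\<Lambda>\<^esub> T (p - N)"
        using h[of p] h[of "p - N"] 2 N_pos by simp
      also have "\<dots> = y p"
      proof -
        have "T (p - N) \<oplus>\<^bsub>\<Lambda>\<^esub> y p \<ominus>\<^bsub>\<Lambda>\<^esub> T (p - N) = y p"
          using Tc yc by (simp add: \<Lambda>.minus_eq \<Lambda>.a_comm[of "T (p - N)"] \<Lambda>.a_assoc \<Lambda>.r_neg)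
        then show ?thesis using T_rec[of p] 2 by simp
      qed
      finally have "phi z p = y p \<cdot> scalar (1 / coef p)" using phi_mid[of z, OF zc 2] by simp
      also have "\<dots> = x p" unfolding y_def using 2 by (intro X_comp_cancel[OF x]) simp
      finally show ?thesis .
    next
      case 3
      have "z (p - N) = \<ominus>\<^bsub>\<Lambda>\<^esub> (x p \<cdot> scalar \<mu>)" using 3 long' by (simp add: z_def)
      then have "phi z p = x p \<cdot> scalar \<mu> \<cdot> scalar (1 / \<mu>)"
        using phi_right[of z, OF zc 3] xc scalar_closed by (simp add: \<Lambda>.l_minus)
      also have "\<dots> = x p" using xc mu by (intro scalar_cancel) auto
      finally show ?thesis .
    qed
  qed
  then show ?thesis using zobj by blast
qed

lemma phi_module_map: "module_map \<Lambda> (obj P\<^sub>c n) (obj P\<^sub>\<sigma> (n + 1)) phi"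
proof (rule \<Lambda>.two_term_module_map[OF string_fun_module[OF cut_local]])
  show "own_coeff p \<in> carrier \<Lambda>" "back_coeff p \<in> carrier \<Lambda>" for p by (rule own_coeff_back_coeff_closed)+
  fix z assume z: "z \<in> obj P\<^sub>c n"
  show "phi z \<in> obj P\<^sub>\<sigma> (n + 1)" by (rule phi_obj[OF z])
  show "phi z = (\<lambda>p. z p \<cdot> own_coeff p \<oplus>\<^bsub>\<Lambda>\<^esub> z (p - N) \<cdot> back_coeff p)" by (rule phi_def)
qed

lemma string_diff_module_map:
  assumes w: "local_string w" and d: "grading w d"
  shows "module_map \<Lambda> (obj (string_complex Q I w d) n) (obj (string_complex Q I w d) (n + 1))
    (diff (string_complex Q I w d) n)"
proof (rule \<Lambda>.two_term_module_map[OF string_fun_module[OF w]])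
  note cl = arrows_closed[OF w, of "\<lambda>_. 1"]
  show "rarrow w (\<lambda>_. 1) (p - 1) \<in> carrier \<Lambda>" "larrow w (\<lambda>_. 1) p \<in> carrier \<Lambda>" for p by (rule cl)+
  fix u assume u: "u \<in> obj (string_complex Q I w d) n"
  have e: "diff (string_complex Q I w d) n u = line_diff w (\<lambda>_. 1) u"
    by (rule string_diff_eq[OF w string_obj_closed[OF w u]])
  show "diff (string_complex Q I w d) n u = (\<lambda>p. u (p - 1) \<cdot> rarrow w (\<lambda>_. 1) (p - 1) \<oplus>\<^bsub>\<Lambda>\<^esub> u (p + 1) \<cdot> larrow w (\<lambda>_. 1) p)"
    unfolding e line_diff_def ..
  show "diff (string_complex Q I w d) n u \<in> obj (string_complex Q I w d) (n + 1)"
    unfolding e by (rule line_diff_obj[OF w d u])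
qed

lemma split_epi:
  assumes f: "\<And>n u. u \<in> obj P\<^sub>\<sigma> n \<Longrightarrow> f n u = graph_map u"
  shows "split_epi_complexes \<Lambda> P\<^sub>\<sigma> B\<^sub>\<tau> P\<^sub>c f (\<lambda>_. splitting) (\<lambda>_. phi)"
proof -
  have dX: "diff P\<^sub>\<sigma> n x = line_diff \<sigma> (\<lambda>_. 1) x" if "x \<in> obj P\<^sub>\<sigma> n" for n x
    by (rule string_diff_eq[OF string X_obj_closed[OF that]])
  have dZ: "diff P\<^sub>c n z = line_diff cut (\<lambda>_. 1) z" if "z \<in> obj P\<^sub>c n" for n z
    by (rule string_diff_eq[OF cut_local cut_obj_closed[OF that]])
  note dXm = string_diff_module_map[OF string grading_\<sigma>]
  note dXobj = \<Lambda>.module_mapD(1)[OF dXm]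
  have f_eq: "module_map \<Lambda> (obj P\<^sub>\<sigma> n) (obj B\<^sub>\<tau> n) (f n)" for n
    by (rule \<Lambda>.module_map_cong[OF graph_map_module_map string_fun_module[OF string] f])
  show ?thesis
  proof (intro split_epi_complexes.intro split_epi_complexes_axioms.intro)
    show "diff P\<^sub>\<sigma> (n + 1) (diff P\<^sub>\<sigma> n x) = (\<lambda>_. \<zero>\<^sub>\<Lambda>)" if "x \<in> obj P\<^sub>\<sigma> n" for x n
      unfolding dX[OF dXobj[OF that]] unfolding dX[OF that]
      by (rule line_diff_line_diff[OF string X_obj_closed[OF that]])
    show "f (n + 1) (diff P\<^sub>\<sigma> n x) = diff B\<^sub>\<tau> n (f n x)" if "x \<in> obj P\<^sub>\<sigma> n" for x n
      unfolding f[OF that] f[OF dXobj[OF that]] unfolding dX[OF that] by (rule graph_map_chain[OF that])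
    show "f n (splitting y) = y" if "y \<in> obj B\<^sub>\<tau> n" for y n
      unfolding f[OF splitting_obj[OF that]] by (rule graph_map_splitting[OF that])
    show "phi (diff P\<^sub>c n z) = diff P\<^sub>\<sigma> (n + 1) (phi z)" if "z \<in> obj P\<^sub>c n" for z n
      unfolding dX[OF phi_obj[OF that]] dZ[OF that] by (rule phi_chain[OF that])
    show "phi ` obj P\<^sub>c n = {x \<in> obj P\<^sub>\<sigma> (n + 1). f (n + 1) x = (\<lambda>_. \<zero>\<^sub>\<Lambda>)}" for n
    proof (intro equalityI subsetI)
      fix x assume "x \<in> phi ` obj P\<^sub>c n"
      then show "x \<in> {x \<in> obj P\<^sub>\<sigma> (n + 1). f (n + 1) x = (\<lambda>_. \<zero>\<^sub>\<Lambda>)}"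
        using phi_obj f graph_map_phi by auto
    next
      fix x assume x: "x \<in> {x \<in> obj P\<^sub>\<sigma> (n + 1). f (n + 1) x = (\<lambda>_. \<zero>\<^sub>\<Lambda>)}"
      then have "graph_map x = (\<lambda>_. \<zero>\<^sub>\<Lambda>)" using f by auto
      then show "x \<in> phi ` obj P\<^sub>c n" using phi_surj[of x n] x by blast
    qed
  qed (rule \<Lambda>.ring_axioms string_fun_module[OF string] band_fun_module string_fun_module[OF cut_local] dXm
      band_diff_module_map string_diff_module_map[OF cut_local cut_grading] band_diff_diff f_eq
      splitting_module_map phi_module_map phi_inj; assumption?)+
qed

lemma cone_iso_cut:
  assumes "\<And>n u. u \<in> obj P\<^sub>\<sigma> n \<Longrightarrow> f n u = graph_map u"
  shows "homotopy_iso \<Lambda> (mapping_cone \<Lambda> P\<^sub>\<sigma> B\<^sub>\<tau> f) P\<^sub>c"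
  by (rule split_epi_complexes.homotopy_iso_cone[OF split_epi[OF assms]])

lemma band_obj_trivial: "\<exists>D. \<forall>n. D < \<bar>n\<bar> \<longrightarrow> obj B\<^sub>\<tau> n = {\<lambda>_. \<zero>\<^sub>\<Lambda>}"
proof -
  let ?D = "Max ((\<lambda>j. \<bar>d\<tau> j\<bar>) ` {0..<N})"
  have le: "\<bar>d\<tau> j\<bar> \<le> ?D" if "j \<in> {0..<N}" for j using that by (intro Max_ge) auto
  have "obj B\<^sub>\<tau> n = {\<lambda>_. \<zero>\<^sub>\<Lambda>}" if "?D < \<bar>n\<bar>" for n
  proof -
    have "d\<tau> j \<noteq> n" if "j \<in> {0..<N}" for j using le[OF that] \<open>?D < \<bar>n\<bar>\<close> by auto
    then have "y \<in> obj B\<^sub>\<tau> n \<longleftrightarrow> (\<forall>j. y j = \<zero>\<^sub>\<Lambda>)" for y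
      unfolding band_complex_def Let_def diagram_obj N_def[symmetric] by auto
    then show ?thesis by auto
  qed
  then show ?thesis by blast
qed

text \<open>In degrees of large absolute value the band complex is zero, so \<open>phi\<close> is an isomorphism and
exactness carries over from the complex of \<open>\<sigma>\<close>.\<close>

lemma homotopy_string_cut:
  assumes w: "homotopy_string Q I \<sigma>" shows "homotopy_string Q I cut"
  unfolding homotopy_string_iff
proof (intro conjI impI exI[of _ dcut] allI)
  show "local_string cut" by (rule cut_local)
  show "grading cut dcut" by (rule cut_grading)
  assume inf: "infinite (pos cut)"
  have "pos cut \<subseteq> pos \<sigma> \<union> (\<lambda>i. i - N) ` pos \<sigma>"
  proof
    fix i assume "i \<in> pos cut"
    then have "i \<in> pos \<sigma> \<or> i + N \<in> pos \<sigma>" by (auto simp: cut_def)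
    then show "i \<in> pos \<sigma> \<union> (\<lambda>i. i - N) ` pos \<sigma>" by (auto intro: image_eqI[of _ _ "i + N"])
  qed
  then have inf': "infinite (pos \<sigma>)" using inf by (meson finite_UnI finite_imageI finite_subset)
  note X = infinite_stringD[OF w inf' grading_\<sigma>]
  show "finite {i \<in> pos cut. dcut i = n}" for n
  proof (rule finite_subset)
    let ?S = "{i \<in> pos \<sigma>. d\<sigma> i = n + 1}"
    show "{i \<in> pos cut. dcut i = n} \<subseteq> ?S \<union> (\<lambda>i. i - N) ` ?S"
    proof
      fix i assume i: "i \<in> {i \<in> pos cut. dcut i = n}"
      show "i \<in> ?S \<union> (\<lambda>i. i - N) ` ?S"
      proof (cases "i \<le> b - N")
        case True
        then show ?thesis using i cut_left(1,3)[OF True] by auto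
      next
        case False
        then have "a \<le> i" using long' by simp
        then have "i + N \<in> ?S" using i cut_right(1,3)[of i] by auto
        then show ?thesis by (intro UnI2 image_eqI[of _ _ "i + N"]) auto
      qed
    qed
    show "finite (?S \<union> (\<lambda>i. i - N) ` ?S)" using X(1) by simp
  qed
  interpret E: split_epi_complexes \<Lambda> P\<^sub>\<sigma> B\<^sub>\<tau> P\<^sub>c "\<lambda>_. graph_map" "\<lambda>_. splitting" "\<lambda>_. phi"
    by (rule split_epi) simp
  obtain M where "\<And>n. M < n \<Longrightarrow> obj P\<^sub>\<sigma> n = {\<lambda>_. \<zero>\<^sub>\<Lambda>}" using X(2) by (auto simp: right_bounded_def)
  then have "\<forall>n>M. obj P\<^sub>c n = {\<lambda>_. \<zero>\<^sub>\<Lambda>}" using E.Z_trivial by simp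
  then show "right_bounded \<Lambda> P\<^sub>c" by (auto simp: right_bounded_def)
  obtain K where K: "\<And>n. K < \<bar>n\<bar> \<Longrightarrow> {u \<in> obj P\<^sub>\<sigma> n. diff P\<^sub>\<sigma> n u = (\<lambda>_. \<zero>\<^sub>\<Lambda>)} = diff P\<^sub>\<sigma> (n - 1) ` obj P\<^sub>\<sigma> (n - 1)"
    using X(3) by (auto simp: bounded_cohomology_def)
  obtain D where D: "\<And>n. D < \<bar>n\<bar> \<Longrightarrow> obj B\<^sub>\<tau> n = {\<lambda>_. \<zero>\<^sub>\<Lambda>}" using band_obj_trivial by blast
  show "bounded_cohomology \<Lambda> P\<^sub>c"
    unfolding bounded_cohomology_def
  proof (intro exI[of _ "max D (K + 1)"] allI impI)
    fix n assume n: "max D (K + 1) < \<bar>n\<bar>"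
    have "K < \<bar>n + 1\<bar>" using n by arith
    then have "{x \<in> obj P\<^sub>\<sigma> (n + 1). diff P\<^sub>\<sigma> (n + 1) x = (\<lambda>_. \<zero>\<^sub>\<Lambda>)} = diff P\<^sub>\<sigma> n ` obj P\<^sub>\<sigma> n"
      using K[of "n + 1"] by simp
    moreover have "obj B\<^sub>\<tau> n = {\<lambda>_. \<zero>\<^sub>\<Lambda>}" using n by (intro D) simp
    ultimately show "{z \<in> obj P\<^sub>c n. diff P\<^sub>c n z = (\<lambda>_. \<zero>\<^sub>\<Lambda>)} = diff P\<^sub>c (n - 1) ` obj P\<^sub>c (n - 1)"
      by (rule E.exact_Z)
  qed
qed

end

section \<open>The decomposition and the cone\<close>

lemma nth_power_prefix:
  assumes "j \<le> length xs" "k < n * length xs + j"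
  shows "(word_power xs n @ take j xs) ! k = xs ! (k mod length xs)"
  using assms(2)
proof (induction n arbitrary: k)
  case 0
  then show ?case using assms(1) by simp
next
  case (Suc n)
  show ?case
  proof (cases "k < length xs")
    case True
    then show ?thesis by (simp add: nth_append)
  next
    case False
    then have "(word_power xs (Suc n) @ take j xs) ! k = (word_power xs n @ take j xs) ! (k - length xs)"
      by (simp add: nth_append)
    also have "\<dots> = xs ! ((k - length xs) mod length xs)" using Suc.prems False by (intro Suc.IH) auto
    also have "(k - length xs) mod length xs = k mod length xs" using False by (simp add: le_mod_geq)
    finally show ?thesis .
  qed
qed

lemma length_power: "length (word_power xs n) = n * length xs"
  by (induction n) auto

lemma strict_sublist_length: "strict_sublist xs ys \<Longrightarrow> length xs < length ys"
proof (rule ccontr)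
  assume s: "strict_sublist xs ys" and "\<not> length xs < length ys"
  obtain ps ss where "ys = ps @ xs @ ss" "xs \<noteq> ys" using s by (auto simp: strict_sublist_def sublist_def)
  then show False using \<open>\<not> length xs < length ys\<close> by auto
qed

text \<open>A finite word is inserted between the part of \<open>w\<close> to the left of \<open>a\<close> and the part to the right of
\<open>b\<close>. It has to agree with an initial segment of \<open>w\<close> after \<open>a\<close>; the rest of the segment up to \<open>b\<close> is thereby
deleted from \<open>w\<close>. If nothing is left to delete, this decomposes \<open>w\<close> into three factors.\<close>

lemma cat_cat_fin_word:
  fixes w :: "('v, 'a) word"
  assumes ab: "a \<in> pos w" "b \<in> pos w" and L: "L = int (length ls)" "a + L \<le> b"
    and letters: "\<And>i. 0 \<le> i \<Longrightarrow> i < L \<Longrightarrow> ls ! nat i = ltr w (a + i)"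
    and vertices: "\<And>i. 0 \<le> i \<Longrightarrow> i \<le> L \<Longrightarrow> vtx (fin_word Q x ls) i = vtx w (a + i)"
    and junction: "vtx w (a + L) = vtx w b"
  defines "\<beta> \<equiv> w\<lparr>pos := pos w \<inter> {..a}\<rparr>" and "\<alpha> \<equiv> w\<lparr>pos := pos w \<inter> {b..}\<rparr>"
  shows "composable \<beta> (fin_word Q x ls)" "composable (fin_word Q x ls) \<alpha>"
    "cat (cat \<beta> (fin_word Q x ls)) \<alpha> =
      \<lparr>pos = (pos w \<inter> {..a}) \<union> {a..a + L} \<union> (\<lambda>i. i - (b - (a + L))) ` (pos w \<inter> {b..}),
       vtx = (\<lambda>i. if i \<le> a + L then vtx w i else vtx w (i + (b - (a + L)))),
       ltr = (\<lambda>i. if i < a + L then ltr w i else ltr w (i + (b - (a + L))))\<rparr>"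
proof -
  let ?f = "fin_word Q x ls"
  have L0: "0 \<le> L" using L by simp
  have fields: "pos \<beta> = pos w \<inter> {..a}" "vtx \<beta> = vtx w" "ltr \<beta> = ltr w"
    "pos \<alpha> = pos w \<inter> {b..}" "vtx \<alpha> = vtx w" "ltr \<alpha> = ltr w" by (simp_all add: \<beta>_def \<alpha>_def)
  have pf: "pos ?f = {0..L}" using L by (simp add: fin_word_def)
  have sup_\<beta>: "Sup (pos \<beta>) = a" unfolding \<beta>_def using ab by (intro cSup_eq_maximum) auto
  have inf_\<alpha>: "Inf (pos \<alpha>) = b" unfolding \<alpha>_def using ab by (intro cInf_eq_minimum) auto
  have sup_f: "Sup (pos ?f) = L" unfolding pf using L0 by (intro cSup_eq_maximum) auto
  have inf_f: "Inf (pos ?f) = 0" unfolding pf using L0 by (intro cInf_eq_minimum) auto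
  have "bdd_above (pos \<beta>)" by (auto simp: \<beta>_def intro: bdd_aboveI[of _ a])
  moreover have "bdd_below (pos ?f)" "bdd_above (pos ?f)" unfolding pf by simp_all
  moreover have "bdd_below (pos \<alpha>)" by (auto simp: \<alpha>_def intro: bdd_belowI[of _ b])
  ultimately show "composable \<beta> ?f" "composable ?f \<alpha>"
    unfolding composable_def sup_\<beta> inf_f sup_f inf_\<alpha>
    using vertices[of 0] vertices[of L] L0 junction by (simp_all add: \<beta>_def \<alpha>_def)
  have c1: "cat \<beta> ?f = \<lparr>pos = (pos w \<inter> {..a}) \<union> (\<lambda>i. i - (0 - a)) ` {0..L},
     vtx = (\<lambda>i. if i \<le> a then vtx w i else vtx ?f (i + (0 - a))),
     ltr = (\<lambda>i. if i < a then ltr w i else ltr ?f (i + (0 - a)))\<rparr>"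
    unfolding cat_def Let_def sup_\<beta> inf_f unfolding pf fields ..
  have im: "(\<lambda>i. i - (0 - a)) ` {0..L} = {a..a + L}"
    by (auto simp: image_iff intro: bexI[of _ "_ - a"])
  have sup_c: "Sup (pos (cat \<beta> ?f)) = a + L"
    unfolding c1 im word.simps using L0 by (intro cSup_eq_maximum) auto
  have v: "(if i \<le> a then vtx w i else vtx ?f (i + (0 - a))) = vtx w i" if "i \<le> a + L" for i
    using vertices[of "i - a"] that by auto
  have l: "(if i < a then ltr w i else ltr ?f (i + (0 - a))) = ltr w i" if "i < a + L" for i
    using letters[of "i - a"] that by (auto simp: fin_word_def)
  show "cat (cat \<beta> ?f) \<alpha> =
      \<lparr>pos = (pos w \<inter> {..a}) \<union> {a..a + L} \<union> (\<lambda>i. i - (b - (a + L))) ` (pos w \<inter> {b..}),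
       vtx = (\<lambda>i. if i \<le> a + L then vtx w i else vtx w (i + (b - (a + L)))),
       ltr = (\<lambda>i. if i < a + L then ltr w i else ltr w (i + (b - (a + L))))\<rparr>"
    unfolding cat_def[of "cat \<beta> ?f"] Let_def sup_c inf_\<alpha>
    unfolding c1 im word.simps fields using v l by (auto simp: fun_eq_iff)
qed

context band_overlap
begin

text \<open>The overlap starts at the position \<open>a + t\<close> of the unfolded band, so the rotation by \<open>(a + t) mod N\<close>
makes it a power of the band followed by an initial segment of the band.\<close>

lemma power_prefix_word:
  fixes l :: nat
  defines "r \<equiv> nat ((a + t) mod N)"
  assumes j: "j \<le> length \<tau>" and len: "int (l * length \<tau> + j) \<le> b - a"
  defines "ls \<equiv> word_power (rotate r \<tau>) l @ take j (rotate r \<tau>)"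
  shows "length ls = l * length \<tau> + j"
    and "0 \<le> i \<Longrightarrow> i < int (length ls) \<Longrightarrow> ls ! nat i = ltr \<sigma> (a + i)"
    and "0 \<le> i \<Longrightarrow> i \<le> int (length ls) \<Longrightarrow> vtx (fin_word Q (lend Q (rotate r \<tau>)) ls) i = vtx \<sigma> (a + i)"
proof -
  have ne: "\<tau> \<noteq> []" using m by auto
  show length: "length ls = l * length \<tau> + j" using j by (simp add: ls_def length_power)
  have rot: "rotate r \<tau> ! k = ltr U (a + int k)" if "k < length \<tau>" for k
  proof -
    have "rotate r \<tau> ! k = \<tau> ! ((r + k) mod length \<tau>)" by (rule nth_rotate[OF that])
    moreover have "(r + k) mod length \<tau> = nat ((a + int k + t) mod N)"
    proof -
      have "int ((r + k) mod length \<tau>) = ((a + t) mod N + int k) mod N"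
        using N_pos by (simp add: r_def zmod_int N_def)
      also have "\<dots> = (a + int k + t) mod N" unfolding mod_add_left_eq by (simp add: ac_simps)
      finally show ?thesis by simp
    qed
    ultimately show ?thesis by (simp add: U_simps)
  qed
  show letters: "ls ! nat i = ltr \<sigma> (a + i)" if i: "0 \<le> i" "i < int (length ls)" for i
  proof -
    have "nat i < length ls" using i by linarith
    then have "nat i < l * length (rotate r \<tau>) + j" by (simp only: length length_rotate)
    then have "ls ! nat i = rotate r \<tau> ! (nat i mod length \<tau>)"
      unfolding ls_def using nth_power_prefix[of j "rotate r \<tau>" "nat i" l] j by simp
    also have "\<dots> = ltr U (a + int (nat i mod length \<tau>))" using ne by (intro rot) simp
    also have "\<dots> = ltr U (a + i)"
    proof (rule periodic_mod[where g = "ltr U", OF U_periodic(2)])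
      have "int (nat i mod length \<tau>) = i mod N" using i by (simp add: zmod_int N_def)
      then show "(a + int (nat i mod length \<tau>)) mod N = (a + i) mod N" by (simp add: mod_add_right_eq)
    qed
    also have "\<dots> = ltr \<sigma> (a + i)" using overlapD(4)[of "a + i"] i len length by simp
    finally show ?thesis .
  qed
  have ab: "a \<in> edges \<sigma>" using in_pos[of a] in_pos[of "a + 1"] long' N_ge_2 by (simp add: edges_def)
  have "hd (rotate r \<tau>) = rotate r \<tau> ! 0" using ne by (simp add: hd_conv_nth)
  then have "hd (rotate r \<tau>) = ltr \<sigma> a"
    using rot[of 0] ne overlapD(4)[of a] long' N_ge_2 by simp
  then have lend: "lend Q (rotate r \<tau>) = vtx \<sigma> a"
    using local_stringD(5)[OF string ab] by simp
  show "vtx (fin_word Q (lend Q (rotate r \<tau>)) ls) i = vtx \<sigma> (a + i)" if i: "0 \<le> i" "i \<le> int (length ls)"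
  proof (cases "i = 0")
    case True
    then show ?thesis using lend by (simp add: fin_word_simps)
  next
    case False
    then have "a + i - 1 \<in> edges \<sigma>"
      using i len length in_pos[of "a + i - 1"] in_pos[of "a + i"] by (simp add: edges_def)
    then have "rvertex Q (ltr \<sigma> (a + (i - 1))) = vtx \<sigma> (a + i)"
      using local_stringD(6)[OF string, of "a + i - 1"] by (simp add: algebra_simps)
    then show ?thesis using letters[of "i - 1"] i False by (simp add: fin_word_simps)
  qed
qed

end

theorem theorem2p4:
  fixes Q :: "('v, 'a) pre_digraph"
    and I :: "(('v, 'a) qpath \<Rightarrow> 'k::field) set"
    and \<sigma> :: "('v, 'a) word"
    and \<tau> :: "'a hletter list"
    and \<mu> :: 'k
    and l m :: nat
    and a b t :: int
    and d\<sigma> d\<tau> :: "int \<Rightarrow> int"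
    and f :: "int \<Rightarrow> (int \<Rightarrow> (('v, 'a) qpath \<Rightarrow> 'k) set) \<Rightarrow> (int \<Rightarrow> (('v, 'a) qpath \<Rightarrow> 'k) set)"
  assumes "gentle Q I"
    and "homotopy_string Q I \<sigma>" and "grading \<sigma> d\<sigma>"
    and "homotopy_band Q I \<tau>" and "grading (unfolding_word Q \<tau>) d\<tau>"
    and "\<mu> \<noteq> 0" and "m < length \<tau>" and "is_direct (\<tau> ! m)"
    and "graph_map_to_band Q I \<sigma> d\<sigma> \<tau> m \<mu> d\<tau> a b t f"
    and "1 \<le> l"
    and "\<exists>r. strict_sublist (subword \<sigma> a b) (word_power (rotate r \<tau>) (l + 1)) \<and>
             sublist (word_power (rotate r \<tau>) l) (subword \<sigma> a b)"
  shows "\<exists>r \<delta> \<gamma> \<alpha> \<beta> \<sigma>' c d.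
    rotate r \<tau> = \<delta> @ \<gamma> \<and>
    homotopy_string Q I \<alpha> \<and> homotopy_string Q I \<beta> \<and>
    \<sigma>' = fin_word Q (lend Q (rotate r \<tau>)) (word_power (rotate r \<tau>) l @ \<delta>) \<and>
    composable \<beta> \<sigma>' \<and> composable \<sigma>' \<alpha> \<and>
    word_eq \<sigma> (cat (cat \<beta> \<sigma>') \<alpha>) \<and>
    c = cat (cat \<beta> (fin_word Q (lend Q (rotate r \<tau>)) (word_power (rotate r \<tau>) (l - 1) @ \<delta>))) \<alpha> \<and>
    homotopy_string Q I c \<and>
    grading c d \<and> (\<forall>i\<in>pos \<beta>. d i = d\<sigma> i - 1) \<and>
    homotopy_iso (quiver_algebra Q I)
      (mapping_cone (quiver_algebra Q I) (string_complex Q I \<sigma> d\<sigma>) (band_complex Q I \<tau> m \<mu> d\<tau>) f)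
      (string_complex Q I c d)"
proof -
  interpret gentle_quiver Q I by (rule gentle_imp_gentle_quiver[OF assms(1)])
  let ?n = "int (length \<tau>)"
  have string: "local_string \<sigma>" using assms(2) by (simp add: homotopy_string_iff)
  have ov: "overlap \<sigma> d\<sigma> (unfolding_word Q \<tau>) d\<tau> a b t"
    using assms(9) by (simp add: graph_map_to_band_def)
  obtain fL fR coef where gm:
      "left_end (letter_left \<sigma> a) (letter_left (unfolding_word Q \<tau>) (a + t)) fL"
      "right_end (letter_right \<sigma> b) (letter_right (unfolding_word Q \<tau>) (b + t)) fR"
      "\<And>i. coef i \<noteq> 0" "\<And>i. i \<in> {a - 1..b} \<Longrightarrow> coef (i + 1) = coef i * band_scalar \<tau> m \<mu> (i + t)"
      "\<And>n u. u \<in> obj (string_complex Q I \<sigma> d\<sigma>) n \<Longrightarrow>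
         f n u = (\<lambda>j. \<Oplus>\<^bsub>quiver_algebra Q I\<^esub>i\<in>{i \<in> {a - 1..b + 1}. (i + t) mod int (length \<tau>) = j}.
                      u i \<otimes>\<^bsub>quiver_algebra Q I\<^esub> component Q I \<sigma> a b fL fR (coef i) i)"
    using assms(9) unfolding graph_map_to_band_def by blast
  have len: "length (subword \<sigma> a b) = nat (b - a)" by (simp add: subword_def)
  obtain r' where r': "strict_sublist (subword \<sigma> a b) (word_power (rotate r' \<tau>) (l + 1))"
      "sublist (word_power (rotate r' \<tau>) l) (subword \<sigma> a b)" using assms(11) by blast
  have short: "nat (b - a) < (l + 1) * length \<tau>"
    using strict_sublist_length[OF r'(1)] by (simp add: len length_power del: replicate_Suc)
  have long: "l * length \<tau> \<le> nat (b - a)"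
    using sublist_length_le[OF r'(2)] by (simp add: len length_power)
  have "length \<tau> \<le> l * length \<tau>" using assms(10) by simp
  then have long1: "a + ?n \<le> b" using long assms(7) by linarith
  interpret B: band_overlap Q I \<sigma> \<tau> \<mu> m a b t d\<sigma> d\<tau> fL fR coef
    by unfold_locales (use string assms(3-8) ov gm(1-4) long1 in auto)
  \<comment> \<open>The overlap consists of \<open>l\<close> periods and the initial segment \<open>\<delta>\<close>, of length \<open>j\<close>, of the next one.\<close>
  define r where "r = nat ((a + t) mod ?n)"
  define j where "j = nat (b - a) - l * length \<tau>"
  define \<delta> \<gamma> where "\<delta> = take j (rotate r \<tau>)" and "\<gamma> = drop j (rotate r \<tau>)"
  define \<beta> \<alpha> where "\<beta> = \<sigma>\<lparr>pos := pos \<sigma> \<inter> {..a}\<rparr>" and "\<alpha> = \<sigma>\<lparr>pos := pos \<sigma> \<inter> {b..}\<rparr>"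
  let ?x = "lend Q (rotate r \<tau>)"
  let ?ls = "word_power (rotate r \<tau>) l @ \<delta>" and ?ls' = "word_power (rotate r \<tau>) (l - 1) @ \<delta>"
  have j: "j \<le> length \<tau>" "l * length \<tau> + j = nat (b - a)" using short long by (auto simp: j_def)
  have l1: "(l - 1) * length \<tau> + j + length \<tau> = nat (b - a)"
    using j(2) assms(10) by (cases l) auto
  have ab: "a \<in> pos \<sigma>" "b \<in> pos \<sigma>" "a \<le> b" using B.in_pos B.overlapD(5) by auto
  have rN: "r = nat ((a + t) mod B.N)" by (simp add: r_def B.N_def)
  note full = B.power_prefix_word[OF j(1), of l, folded rN \<delta>_def]
  note cut = B.power_prefix_word[OF j(1), of "l - 1", folded rN \<delta>_def]
  have lf: "int (l * length \<tau> + j) \<le> b - a" "int (length ?ls) = b - a"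
    using j full(1) ab(3) by auto
  have "int ((l - 1) * length \<tau> + j + length \<tau>) = b - a" unfolding l1 using ab(3) by simp
  then have l2: "int ((l - 1) * length \<tau> + j) = b - a - B.N" unfolding B.N_def of_nat_add by linarith
  then have lc1: "int ((l - 1) * length \<tau> + j) \<le> b - a" using B.N_ge_2 by linarith
  have lc: "int ((l - 1) * length \<tau> + j) \<le> b - a" "int (length ?ls') = b - a - B.N"
    by (rule lc1) (simp only: cut(1)[OF lc1] l2)
  have vtx_cut: "vtx \<sigma> (a + (b - a - B.N)) = vtx \<sigma> b"
    using B.overlapD(2)[of "b - B.N"] B.overlapD(2)[of b] B.U_periodic(1)[of "b - B.N"] B.long' B.N_ge_2 ab(3)
    by simp
  \<comment> \<open>The same description of concatenations covers \<open>\<sigma>\<close>, with all \<open>l\<close> periods, and \<open>c\<close>, with \<open>l - 1\<close> of them.\<close>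
  note cat_full = cat_cat_fin_word[OF ab(1,2) lf(2)[symmetric], where Q = Q and x = ?x, folded \<beta>_def \<alpha>_def]
  note cat_cut = cat_cat_fin_word[OF ab(1,2) lc(2)[symmetric], where Q = Q and x = ?x, folded \<beta>_def \<alpha>_def]
  have comp: "composable \<beta> (fin_word Q ?x ?ls)" "composable (fin_word Q ?x ?ls) \<alpha>"
    by (rule cat_full(1) cat_full(2); use full(2,3)[OF lf(1)] lf(2) in simp)+
  have sigma: "cat (cat \<beta> (fin_word Q ?x ?ls)) \<alpha> = 
      \<lparr>pos = (pos \<sigma> \<inter> {..a}) \<union> {a..a + (b - a)} \<union> (\<lambda>i. i - (b - (a + (b - a)))) ` (pos \<sigma> \<inter> {b..}),
       vtx = (\<lambda>i. if i \<le> a + (b - a) then vtx \<sigma> i else vtx \<sigma> (i + (b - (a + (b - a))))),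
       ltr = (\<lambda>i. if i < a + (b - a) then ltr \<sigma> i else ltr \<sigma> (i + (b - (a + (b - a)))))\<rparr>"
    by (rule cat_full(3)) (use full(2,3)[OF lf(1)] lf(2) in simp_all)
  have "(pos \<sigma> \<inter> {..a}) \<union> {a..b} \<union> (pos \<sigma> \<inter> {b..}) = pos \<sigma>" using B.overlapD(1) by auto
  then have word_eq: "word_eq \<sigma> (cat (cat \<beta> (fin_word Q ?x ?ls)) \<alpha>)"
    unfolding sigma by (simp add: word_eq_def)
  have c: "cat (cat \<beta> (fin_word Q ?x ?ls')) \<alpha> = B.cut"
  proof -
    have "cat (cat \<beta> (fin_word Q ?x ?ls')) \<alpha> = 
      \<lparr>pos = (pos \<sigma> \<inter> {..a}) \<union> {a..a + (b - a - B.N)} \<union> (\<lambda>i. i - (b - (a + (b - a - B.N)))) ` (pos \<sigma> \<inter> {b..}),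
       vtx = (\<lambda>i. if i \<le> a + (b - a - B.N) then vtx \<sigma> i else vtx \<sigma> (i + (b - (a + (b - a - B.N))))),
       ltr = (\<lambda>i. if i < a + (b - a - B.N) then ltr \<sigma> i else ltr \<sigma> (i + (b - (a + (b - a - B.N)))))\<rparr>"
      by (rule cat_cut(3)) (use cut(2,3)[OF lc(1)] lc(2) B.N_ge_2 vtx_cut in simp_all)
    moreover have "(pos \<sigma> \<inter> {..a}) \<union> {a..b - B.N} \<union> (\<lambda>i. i - B.N) ` (pos \<sigma> \<inter> {b..}) =
        {i. i \<le> b - B.N \<and> i \<in> pos \<sigma> \<or> b - B.N \<le> i \<and> i + B.N \<in> pos \<sigma>}"
      (is "?lhs = ?rhs")
    proof (intro equalityI subsetI)
      fix i assume "i \<in> ?rhs"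
      then consider "i \<le> a" "i \<in> pos \<sigma>" | "a \<le> i" "i \<le> b - B.N" | "b - B.N \<le> i" "i + B.N \<in> pos \<sigma>" by fastforce
      then show "i \<in> ?lhs"
        by cases (auto intro: image_eqI[of _ _ "i + B.N"])
    next
      fix i assume "i \<in> ?lhs"
      then show "i \<in> ?rhs" using B.in_pos[of i] B.long' B.N_ge_2 by auto
    qed
    moreover have e: "a + (b - a - B.N) = b - B.N" "b - (b - B.N) = B.N" by auto
    ultimately show ?thesis unfolding e B.cut_def by simp
  qed
  have conv: "k \<in> pos \<sigma>" if "i \<in> pos \<sigma>" "i' \<in> pos \<sigma>" "i \<le> k" "k \<le> i'" for i i' k
    by (rule local_stringD(2)[OF string that])
  have \<beta>: "homotopy_string Q I \<beta>"
    unfolding \<beta>_def restrict_word_def[symmetric]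
  proof (rule homotopy_string_restrict_word[OF assms(2,3), where B = "{a}"])
    show "{i..i'} \<subseteq> pos \<sigma> \<inter> {..a}" if "i \<in> pos \<sigma> \<inter> {..a}" "i' \<in> pos \<sigma> \<inter> {..a}" for i i'
      using that conv[of i i'] by (simp add: subset_iff)
    show "p \<in> {a}" if "p \<in> pos \<sigma> \<inter> {..a}"
      "p + 1 \<in> pos \<sigma> - pos \<sigma> \<inter> {..a} \<or> p - 1 \<in> pos \<sigma> - pos \<sigma> \<inter> {..a}" for p
      using that by auto
  qed (use ab in auto)
  have \<alpha>: "homotopy_string Q I \<alpha>"
    unfolding \<alpha>_def restrict_word_def[symmetric]
  proof (rule homotopy_string_restrict_word[OF assms(2,3), where B = "{b}"])
    show "{i..i'} \<subseteq> pos \<sigma> \<inter> {b..}" if "i \<in> pos \<sigma> \<inter> {b..}" "i' \<in> pos \<sigma> \<inter> {b..}" for i i'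
      using that conv[of i i'] by (simp add: subset_iff)
    show "p \<in> {b}" if "p \<in> pos \<sigma> \<inter> {b..}"
      "p + 1 \<in> pos \<sigma> - pos \<sigma> \<inter> {b..} \<or> p - 1 \<in> pos \<sigma> - pos \<sigma> \<inter> {b..}" for p
      using that by auto
  qed (use ab in auto)
  have deg: "\<forall>i\<in>pos \<beta>. B.dcut i = d\<sigma> i - 1"
    using B.cut_left(3) B.long' by (auto simp: \<beta>_def)
  have iso: "homotopy_iso (quiver_algebra Q I)
      (mapping_cone (quiver_algebra Q I) (string_complex Q I \<sigma> d\<sigma>) (band_complex Q I \<tau> m \<mu> d\<tau>) f)
      (string_complex Q I B.cut B.dcut)"
    by (rule B.cone_iso_cut) (simp add: gm(5) B.graph_map_def B.comp_def B.N_def)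
  show ?thesis
    by (rule exI[of _ r], rule exI[of _ \<delta>], rule exI[of _ \<gamma>], rule exI[of _ \<alpha>], rule exI[of _ \<beta>],
        rule exI[of _ "fin_word Q ?x ?ls"], rule exI[of _ B.cut], rule exI[of _ B.dcut])
      (use \<alpha> \<beta> comp word_eq c B.homotopy_string_cut[OF assms(2)] B.cut_grading deg iso
        in \<open>simp add: \<delta>_def \<gamma>_def\<close>)
qed

end
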